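(* Let $n\in\mathbb{N}$, $0<\alpha<n$, $1<p<\frac{n}{\alpha}$, $0<\rho<\infty$, $\omega\in A_1^{\rm loc}$, and $q=\frac{n-\alpha p}{n}$. There is a constant $C=C(n,\alpha,p,[\omega]_{A_{1;160\rho}^{\rm loc}})>0$, depending only on the indicated parameters, such that for every Lebesgue measurable function $f:\mathbb{R}^n\to[-\infty,\infty]$, $$\left\|\mathbf{M}_\rho^{\rm loc}f\right\|_{L^{q,\infty}(\mathcal{R}_{\alpha,p;\rho}^{\omega})}\le C\,\|f\|_{L^q(\mathcal{R}_{\alpha,p;\rho}^{\omega})}.$$
   Context: $|x|_\infty=\max_i|x_i|$; $\omega'=\omega^{-\frac{1}{p-1}}$. Cubes are open with sides parallel to the axes; $\ell(Q)$ is the side length. A weight is a locally integrable function $\omega\ge0$ on $\mathbb{R}^n$ with $\omega>0$ a.e. $[\omega]_{A_{1;\rho}^{\rm loc}}=\sup_{\ell(Q)\le\rho}\left(\frac{1}{|Q|}\int_Q\omega\right)\|\omega^{-1}\|_{L^\infty(Q)}$; the class of weights for which this is finite does not depend on $0<\rho<\infty$ and is denoted $A_1^{\rm loc}$. $\mathbf{M}_\rho^{\rm loc}f(x)=\sup\left\{\frac{1}{|Q|}\int_Q|f|\,dy:\ x\in Q,\ \ell(Q)\le\rho\right\}$. The capacity of $E\subseteq\mathbb{R}^n$ is $\mathcal{R}_{\alpha,p;\rho}^{\omega}(E)=\inf\int_0^\rho\int_{\mathbb{R}^n}g(y,t)^p\,\omega'(y)\,dy\frac{dt}{t}$, the infimum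 over measurable $g\ge0$ on $\mathbb{R}^n\times(0,\rho)$ with $\int_0^\rho\left(\int_{|x-y|_\infty<t}\frac{g(y,t)}{t^{n-\alpha}}\,\omega'(y)\,dy\right)\frac{dt}{t}\ge1$ for every $x\in E$. For a capacity $\mathcal{R}$ and $0<q<\infty$: $\|f\|_{L^q(\mathcal{R})}=\left(\int_0^\infty\mathcal{R}(\{x:|f(x)|^q>t\})\,dt\right)^{1/q}$ and $\|f\|_{L^{q,\infty}(\mathcal{R})}=\sup_{t>0}t\,\mathcal{R}(\{x:|f(x)|>t\})^{1/q}$. *)

theory Defs
  imports "HOL-Analysis.Analysis" "HOL-Probability.Essential_Supremum"
begin

(* Only meant for exponents r > 0, so that top is sent to top. *)
definition ennreal_powr :: "ennreal \<Rightarrow> real \<Rightarrow> ennreal" where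
  "ennreal_powr x r = (if x = top then top else ennreal (enn2real x powr r))"

(* The open axis-parallel cube with lower corner a and side length l. *)
definition cube :: "real^'n \<Rightarrow> real \<Rightarrow> (real^'n) set" where
  "cube a l = box a (a + vec l)"

definition locally_integrable :: "(real^'n \<Rightarrow> real) \<Rightarrow> bool" where
  "locally_integrable f \<longleftrightarrow> (\<forall>K. compact K \<longrightarrow> set_integrable lebesgue K f)"

definition weight :: "(real^'n \<Rightarrow> real) \<Rightarrow> bool" where
  "weight \<omega> \<longleftrightarrow>
     locally_integrable \<omega> \<and> (\<forall>x. 0 \<le> \<omega> x) \<and> (AE x in lebesgue. 0 < \<omega> x)"

(* The reciprocal is taken in ennreal, where inverse 0 = top. *)
definition A1_const :: "real \<Rightarrow> (real^'n \<Rightarrow> real) \<Rightarrow> ennreal" where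
  "A1_const \<rho> \<omega> =
     (SUP (a, l) \<in> {(a, l). 0 < l \<and> l \<le> \<rho>}.
        (\<integral>\<^sup>+ y \<in> cube a l. ennreal (\<omega> y) \<partial>lebesgue) / emeasure lebesgue (cube a l)
        * esssup (restrict_space lebesgue (cube a l)) (\<lambda>y. inverse (ennreal (\<omega> y))))"

(* Finiteness of the constant does not depend on the scale, so asking for one scale
   is the same as asking for all of them. *)
definition A1_loc :: "(real^'n \<Rightarrow> real) set" where
  "A1_loc = {\<omega>. weight \<omega> \<and> (\<exists>\<rho>>0. A1_const \<rho> \<omega> < top)}"

definition local_maximal :: "real \<Rightarrow> (real^'n \<Rightarrow> ereal) \<Rightarrow> real^'n \<Rightarrow> ereal" where
  "local_maximal \<rho> f x =
     enn2ereal (SUP (a, l) \<in> {(a, l). 0 < l \<and> l \<le> \<rho> \<and> x \<in> cube a l}.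
       (\<integral>\<^sup>+ y \<in> cube a l. e2ennreal \<bar>f y\<bar> \<partial>lebesgue) / emeasure lebesgue (cube a l))"

(* Where the weight vanishes, which is a null set, this is 0 because 0 powr s = 0;
   the dual weight only ever occurs under an integral sign. *)
definition dual_weight :: "real \<Rightarrow> (real^'n \<Rightarrow> real) \<Rightarrow> real^'n \<Rightarrow> real" where
  "dual_weight p \<omega> y = \<omega> y powr (- 1 / (p - 1))"

(* Test functions g take finite values only; the values of g outside the strip
   0 < t < \<rho> are irrelevant. *)
definition admissible ::
  "real \<Rightarrow> real \<Rightarrow> real \<Rightarrow> (real^'n \<Rightarrow> real) \<Rightarrow> (real^'n) set \<Rightarrow> (real^'n \<Rightarrow> real \<Rightarrow> real) \<Rightarrow> bool"
  where
  "admissible \<alpha> p \<rho> \<omega> E g \<longleftrightarrow>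
     (\<lambda>(y, t). g y t) \<in> borel_measurable (restrict_space lebesgue (UNIV \<times> {0<..<\<rho>})) \<and>
     (\<forall>y. \<forall>t\<in>{0<..<\<rho>}. 0 \<le> g y t) \<and>
     (\<forall>x\<in>E. 1 \<le> (\<integral>\<^sup>+ t \<in> {0<..<\<rho>}.
        (\<integral>\<^sup>+ y \<in> {y. infnorm (x - y) < t}.
           ennreal (g y t / t powr (real CARD('n) - \<alpha>) * dual_weight p \<omega> y) \<partial>lebesgue)
        * ennreal (1 / t) \<partial>lebesgue))"

definition capacity ::
  "real \<Rightarrow> real \<Rightarrow> real \<Rightarrow> (real^'n \<Rightarrow> real) \<Rightarrow> (real^'n) set \<Rightarrow> ennreal" where
  "capacity \<alpha> p \<rho> \<omega> E =
     (INF g \<in> {g. admissible \<alpha> p \<rho> \<omega> E g}.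
        \<integral>\<^sup>+ t \<in> {0<..<\<rho>}.
          (\<integral>\<^sup>+ y. ennreal (g y t powr p * dual_weight p \<omega> y) \<partial>lebesgue)
          * ennreal (1 / t) \<partial>lebesgue)"

definition cap_Lq :: "('a set \<Rightarrow> ennreal) \<Rightarrow> real \<Rightarrow> ('a \<Rightarrow> ereal) \<Rightarrow> ennreal" where
  "cap_Lq R q f =
     ennreal_powr
       (\<integral>\<^sup>+ t \<in> {0<..}. R {x. ennreal_powr (e2ennreal \<bar>f x\<bar>) q > ennreal t} \<partial>lebesgue)
       (1 / q)"

definition cap_weak_Lq :: "('a set \<Rightarrow> ennreal) \<Rightarrow> real \<Rightarrow> ('a \<Rightarrow> ereal) \<Rightarrow> ennreal" where
  "cap_weak_Lq R q f =
     (SUP t \<in> {0<..}. ennreal t * ennreal_powr (R {x. \<bar>f x\<bar> > ereal t}) (1 / q))"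

end

(* Write u = g omega' for a test function g. The potential of the capacity becomes
   the unweighted potential  pot u x = int_0^rho int_{|x-y|<t} u(y,t) t^(alpha-n) dy dt/t
   and the energy becomes  int int u^p omega dy dt/t.

   Near-optimal test functions for the dyadic level sets of |f|^q, added in l^p, give a single u
   with |f|^q <= 2 (pot u)^p everywhere and energy at most a multiple of the Choquet integral.
   So it suffices to bound the maximal function of (pot u)^(p/q), where p/q = np/(n - alpha p) is
   the Sobolev exponent. On a cube Q of side l around x0 the potential splits by height t. The part
   t < l satisfies a Sobolev inequality (only Hoelder in the upper half space is needed); if its
   average is large, then the energy density of u near x0 is large at scale l. The part
   l <= t < rho/2 is dominated at x0 itself by the potential of (y,t) |-> u(y,t/2), and the part
   t >= rho/2 is again controlled by the energy density, at scale rho. The set of points with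
   large energy density is covered by a Vitali argument; the A_1 condition makes the weight on
   each selected cube comparable to its essential infimum, which turns the unweighted density
   into the weighted energy and bounds the capacity of the cubes. *)

theory Submission
  imports Defs
begin

section \<open>Powers and the Hoelder inequality in the extended nonnegative reals\<close>

text \<open>The exponent q is the one at which the scales match. For the near part on a cube of side
  l the Sobolev inequality bounds the integral of (pot u)^(p/q) by C times the 1/q-th power of the
  integral of u^p; an average above \<sigma> thus forces that integral to exceed a multiple of
  \<sigma>^q l^(n - \<alpha> p), because n q = n - \<alpha> p. Conversely, t^(-\<alpha>) on a slab
  of height about r over a cube of side about r has potential at least 1 on a slightly smaller cube,
  and its energy is about r^(-\<alpha> p) times the weight of the cube, so by A_1 at most about r^(n
  - \<alpha> p) times the essential infimum. The same power of r occurs on both sides, and no scale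
  survives in the constant. Replacing f by one u moves the problem from the Choquet integral, which
  has no linearity in f, to the energy, which is an honest integral. Heights are cut at \<rho>/2 for
  this reason: moving the vertex of a cone to x0 doubles its aperture, and restoring aperture 1
  doubles the heights, which have to stay below \<rho>.\<close>

notation ennreal_powr (infixr "powe" 80)

lemma powe_top [simp]: "top powe r = top"
  by (simp add: ennreal_powr_def)

lemma powe_ennreal: "0 \<le> a \<Longrightarrow> ennreal a powe r = ennreal (a powr r)"
  by (simp add: ennreal_powr_def)

lemma powe_0 [simp]: "0 powe r = 0"
  using powe_ennreal[of 0 r] by simp

lemma powe_1 [simp]: "1 powe r = 1"
  using powe_ennreal[of 1 r] by simp

lemma powe_one [simp]: "x powe 1 = x"
  by (cases x) (auto simp: powe_ennreal)

lemma powe_mono: "x \<le> y \<Longrightarrow> 0 \<le> r \<Longrightarrow> x powe r \<le> y powe r"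
  by (cases x; cases y) (auto simp: powe_ennreal powr_mono2 top_unique)

lemma powe_eq_0_iff [simp]: "x powe r = 0 \<longleftrightarrow> x = 0"
  by (cases x) (auto simp: powe_ennreal ennreal_eq_0_iff)

lemma powe_eq_top_iff [simp]: "x powe r = top \<longleftrightarrow> x = top"
  by (cases x) (auto simp: powe_ennreal)

lemma powe_mult: "(x * y) powe r = x powe r * y powe r"
proof (cases "x = top \<or> y = top")
  case True
  then show ?thesis
    by (cases "x = 0 \<or> y = 0") (auto simp: ennreal_mult_top ennreal_top_mult)
next
  case False
  then show ?thesis
    by (cases x; cases y) (auto simp: powe_ennreal powr_mult simp flip: ennreal_mult)
qed

lemma powe_powe: "(x powe r) powe s = x powe (r * s)"
  by (cases x) (auto simp: powe_ennreal powr_powr)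

lemma powe_add: "x powe (r + s) = x powe r * x powe s"
  by (cases x) (auto simp: powe_ennreal powr_add ennreal_top_mult simp flip: ennreal_mult)

lemma borel_measurable_powe [measurable]:
  assumes [measurable]: "f \<in> borel_measurable M"
  shows "(\<lambda>x. f x powe r) \<in> borel_measurable M"
  unfolding ennreal_powr_def by measurable

lemma ennreal_Young:
  fixes a b :: ennreal
  assumes p: "1 < p" and p': "1 / p + 1 / p' = 1"
  shows "a * b \<le> ennreal (1 / p) * a powe p + ennreal (1 / p') * b powe p'"
proof -
  have "1 / p < 1" using p by simp
  then have "0 < 1 / p'" using p' by linarith
  then have pp: "0 < p'" by (simp add: zero_less_divide_iff)
  have pne: "ennreal (1 / p) \<noteq> 0" "ennreal (1 / p') \<noteq> 0"
    using p pp by (auto simp: ennreal_eq_0_iff)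
  show ?thesis
  proof (cases "a = top \<or> b = top")
    case True
    then show ?thesis using pne p pp by (auto simp: ennreal_mult_top)
  next
    case False
    then obtain x y where xy: "0 \<le> x" "a = ennreal x" "0 \<le> y" "b = ennreal y"
      by (cases a; cases b) auto
    have "0 < 1 / p" using p by simp
    then have "1 / p' < 1" using p' by linarith
    then have pp': "1 < p'" using pp by simp
    have "x * y \<le> x powr p / p + y powr p' / p'"
      using xy p pp' p' by (intro Youngs_inequality) (auto simp: field_simps)
    then have "ennreal (x * y) \<le> ennreal (1 / p * x powr p + 1 / p' * y powr p')"
      by (intro ennreal_leI) (simp add: field_simps)
    also have "\<dots> = ennreal (1 / p) * a powe p + ennreal (1 / p') * b powe p'"
      using xy p pp by (subst ennreal_plus) (auto simp: powe_ennreal simp flip: ennreal_mult)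
    finally show ?thesis using xy by (simp add: ennreal_mult)
  qed
qed

text \<open>Young's inequality is applied to f/A and g/B, where A and B are the two norms; after
  integration the weights 1/p and 1/p' add up to 1. Norms equal to 0 or \<open>top\<close> cannot be
  divided out and are settled first: a zero norm makes the product vanish almost everywhere, even if
  the other norm is \<open>top\<close>.\<close>

lemma nn_integral_Holder:
  fixes f g :: "'a \<Rightarrow> ennreal"
  assumes p: "1 < p" and p': "1 / p + 1 / p' = 1"
    and [measurable]: "f \<in> borel_measurable M" "g \<in> borel_measurable M"
  shows "(\<integral>\<^sup>+x. f x * g x \<partial>M)
    \<le> (\<integral>\<^sup>+x. f x powe p \<partial>M) powe (1 / p) * (\<integral>\<^sup>+x. g x powe p' \<partial>M) powe (1 / p')"
proof -
  define F where "F = (\<integral>\<^sup>+x. f x powe p \<partial>M)"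
  define G where "G = (\<integral>\<^sup>+x. g x powe p' \<partial>M)"
  have "1 / p < 1" using p by simp
  then have "0 < 1 / p'" using p' by linarith
  then have pp: "0 < p'" by (simp add: zero_less_divide_iff)
  consider "F = 0 \<or> G = 0" | "F \<noteq> 0" "G \<noteq> 0" "F = top \<or> G = top"
    | "F \<noteq> 0" "G \<noteq> 0" "F \<noteq> top" "G \<noteq> top" by blast
  then show ?thesis
  proof cases
    case 1
    then have "(AE x in M. f x powe p = 0) \<or> (AE x in M. g x powe p' = 0)"
      unfolding F_def G_def
      using nn_integral_0_iff_AE[of "\<lambda>x. f x powe p" M] nn_integral_0_iff_AE[of "\<lambda>x. g x powe p'" M]
      by auto
    then have "AE x in M. f x * g x = 0" by (auto elim: eventually_mono)
    then have "(\<integral>\<^sup>+x. f x * g x \<partial>M) = 0"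
      by (subst nn_integral_0_iff_AE) auto
    then show ?thesis by simp
  next
    case 2
    then have "F powe (1 / p) * G powe (1 / p') = top"
      by (auto simp: ennreal_mult_eq_top_iff)
    then show ?thesis unfolding F_def G_def by simp
  next
    case 3
    define A where "A = F powe (1 / p)"
    define B where "B = G powe (1 / p')"
    have AB: "A \<noteq> 0" "A \<noteq> top" "B \<noteq> 0" "B \<noteq> top" using 3 by (auto simp: A_def B_def)
    have F: "F = A powe p" "G = B powe p'" using p pp by (auto simp: A_def B_def powe_powe)
    have inv: "inverse c * c = 1" if "c \<noteq> 0" "c \<noteq> top" for c :: ennreal
      using ennreal_divide_self[of c] that
      by (simp add: mult.commute[of "inverse c"] divide_ennreal_def less_top)
    have pw: "inverse A powe p * F = 1" "inverse B powe p' * G = 1"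
      unfolding F powe_mult[symmetric] using inv[of A] inv[of B] AB by simp_all
    have "f x * g x \<le> A * B * (ennreal (1 / p) * (inverse A powe p * f x powe p)
        + ennreal (1 / p') * (inverse B powe p' * g x powe p'))" for x
    proof -
      have "f x * g x = (inverse A * A) * (inverse B * B) * (f x * g x)"
        using AB by (simp add: inv)
      also have "\<dots> = A * B * ((inverse A * f x) * (inverse B * g x))"
        by (simp only: mult_ac)
      also have "\<dots> \<le> A * B * (ennreal (1 / p) * (inverse A * f x) powe p
          + ennreal (1 / p') * (inverse B * g x) powe p')"
        by (intro mult_left_mono ennreal_Young p p') auto
      finally show ?thesis by (simp add: powe_mult)
    qed
    then have "(\<integral>\<^sup>+x. f x * g x \<partial>M) \<le> (\<integral>\<^sup>+x. A * B * (ennreal (1 / p) * (inverse A powe p * f x powe p)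
        + ennreal (1 / p') * (inverse B powe p' * g x powe p')) \<partial>M)"
      by (intro nn_integral_mono) auto
    also have "\<dots> = A * B * (ennreal (1 / p) * (inverse A powe p * F)
        + ennreal (1 / p') * (inverse B powe p' * G))"
      by (simp add: nn_integral_cmult nn_integral_add F_def G_def)
    also have "\<dots> = A * B * ennreal (1 / p + 1 / p')"
      using p pp ennreal_plus[of "1 / p" "1 / p'"] by (simp add: pw)
    also have "\<dots> = A * B" using p' by simp
    finally show ?thesis unfolding A_def B_def F_def G_def .
  qed
qed

section \<open>Tents in the upper half space\<close>

lemma powe_indicator [simp]: "indicator A x powe r = indicator A x"
  by (auto simp: indicator_def)

lemma borel_measurable_fst [measurable]:
  "(fst :: 'a::second_countable_topology \<times> 'b::second_countable_topology \<Rightarrow> 'a) \<in> borel_measurable borel"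
  by (intro borel_measurable_continuous_onI continuous_intros)

lemma borel_measurable_snd [measurable]:
  "(snd :: 'a::second_countable_topology \<times> 'b::second_countable_topology \<Rightarrow> 'b) \<in> borel_measurable borel"
  by (intro borel_measurable_continuous_onI continuous_intros)

section \<open>Cubes as balls of the maximum norm, and cones in the upper half space\<close>

definition qball :: "real^'n \<Rightarrow> real \<Rightarrow> (real^'n) set" where
  "qball x h = {y. infnorm (x - y) < h}"

lemma mem_qball_iff: "y \<in> qball x h \<longleftrightarrow> (\<forall>i. \<bar>x $ i - y $ i\<bar> < h)"
proof -
  have eq: "{\<bar>(x - y) $ i\<bar> |i. i \<in> UNIV} = (\<lambda>i. \<bar>x $ i - y $ i\<bar>) ` UNIV"
    by auto
  show ?thesis
    unfolding qball_def mem_Collect_eq infnorm_cart eq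
    by (subst cSup_eq_Max, simp, simp, subst Max_less_iff) auto
qed

lemma qball_eq_cube: "qball x h = cube (x - vec h) (2 * h)"
  by (auto simp: mem_qball_iff cube_def mem_box_cart abs_less_iff algebra_simps)

lemma open_cube [simp]: "open (cube a l)"
  by (simp add: cube_def open_box)

lemma open_qball [simp]: "open (qball x h)"
  by (simp add: qball_eq_cube)

lemma sets_cube [measurable, simp]: "cube a l \<in> sets borel"
  by simp

lemma sets_qball [measurable, simp]: "qball x h \<in> sets borel"
  by simp

lemma qball_commute: "y \<in> qball x h \<longleftrightarrow> x \<in> qball y h"
  by (auto simp: qball_def infnorm_sub)

lemma qball_triangle: "y \<in> qball x h \<Longrightarrow> z \<in> qball y k \<Longrightarrow> z \<in> qball x (h + k)"
  using infnorm_triangle[of "x - y" "y - z"] by (simp add: qball_def)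

lemma emeasure_cube: 
  fixes a :: "real^'n"
  assumes "0 \<le> l" shows "emeasure lborel (cube a l) = ennreal (l ^ CARD('n))"
proof -
  have "emeasure lborel (cube a l) = ennreal (\<Prod>b\<in>Basis. (vec l :: real^'n) \<bullet> b)"
    unfolding cube_def using assms
    by (subst emeasure_lborel_box) (auto simp: Basis_vec_def inner_axis algebra_simps)
  also have "(\<Prod>b\<in>Basis. (vec l :: real^'n) \<bullet> b) = (\<Prod>b\<in>(Basis :: (real^'n) set). l)"
    by (intro prod.cong) (auto simp: Basis_vec_def inner_axis)
  finally show ?thesis by simp
qed

lemma emeasure_qball:
  fixes x :: "real^'n"
  assumes "0 \<le> h" shows "emeasure lborel (qball x h) = ennreal ((2 * h) ^ CARD('n))"
  using assms by (simp add: qball_eq_cube emeasure_cube)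

text \<open>The measure dy dt/t. The cutoff at height \<rho> sits in the density and not in the
  space, so strips of different heights are measures on one space and can be compared
  directly.\<close>

definition strip :: "real \<Rightarrow> ((real^'n) \<times> real) measure" where
  "strip \<rho> = density lborel (\<lambda>(y, t). ennreal (1 / t) * indicator {0<..<\<rho>} t)"

lemma sets_strip [measurable_cong, simp]: "sets (strip \<rho>) = sets borel"
  by (simp add: strip_def)

lemma space_strip [simp]: "space (strip \<rho>) = UNIV"
  by (simp add: strip_def)

lemma nn_integral_strip:
  fixes f :: "(real^'n) \<times> real \<Rightarrow> ennreal"
  assumes [measurable]: "f \<in> borel_measurable borel"
  shows "(\<integral>\<^sup>+z. f z \<partial>strip \<rho>)
    = (\<integral>\<^sup>+t\<in>{0<..<\<rho>}. (\<integral>\<^sup>+y. f (y, t) \<partial>lborel) * ennreal (1 / t) \<partial>lborel)"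
proof -
  have "(\<integral>\<^sup>+z. f z \<partial>strip \<rho>)
      = (\<integral>\<^sup>+z. (case z of (y, t) \<Rightarrow> ennreal (1 / t) * indicator {0<..<\<rho>} t) * f z \<partial>lborel)"
    unfolding strip_def by (subst nn_integral_density) (auto simp: split_beta')
  also have "\<dots> = (\<integral>\<^sup>+z. (ennreal (1 / snd z) * indicator {0<..<\<rho>} (snd z)) * f z
      \<partial>((lborel :: (real^'n) measure) \<Otimes>\<^sub>M lborel))"
    by (simp add: lborel_prod split_beta')
  also have "\<dots> = (\<integral>\<^sup>+t. \<integral>\<^sup>+y. (ennreal (1 / t) * indicator {0<..<\<rho>} t) * f (y, t) \<partial>lborel \<partial>lborel)"
    by (subst lborel_pair.nn_integral_snd[symmetric]) (auto simp: lborel_prod)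
  also have "\<dots> = (\<integral>\<^sup>+t\<in>{0<..<\<rho>}. (\<integral>\<^sup>+y. f (y, t) \<partial>lborel) * ennreal (1 / t) \<partial>lborel)"
    by (subst nn_integral_cmult) (auto simp: mult_ac)
  finally show ?thesis .
qed

lemma AE_strip: "AE z in strip \<rho>. 0 < snd z \<and> snd z < \<rho>"
  unfolding strip_def by (subst AE_density) (auto simp: split_beta' indicator_def)

lemma sigma_finite_strip: "sigma_finite_measure (strip \<rho>)"
  unfolding strip_def
  by (subst sigma_finite_measure.sigma_finite_iff_density_finite[OF sigma_finite_lborel])
    (auto simp: split_beta' ennreal_mult_eq_top_iff indicator_def)

text \<open>The cone with vertex x and aperture c. Aperture 1 is that of the capacity; aperture 2
  appears when the vertex is moved by at most the height.\<close>

definition tent :: "real \<Rightarrow> real^'n \<Rightarrow> ((real^'n) \<times> real) set" where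
  "tent c x = {z. infnorm (x - fst z) < c * snd z}"

lemma mem_tent_iff: "(y, t) \<in> tent c x \<longleftrightarrow> y \<in> qball x (c * t)"
  by (simp add: tent_def qball_def)

lemma continuous_on_infnorm_diff: "continuous_on UNIV (\<lambda>z. infnorm (f z - g z))"
  if "continuous_on UNIV f" "continuous_on UNIV g"
  by (intro continuous_on_infnorm continuous_on_diff that)

lemma sets_tent [measurable, simp]: "tent c x \<in> sets borel"
  unfolding tent_def
  by (intro borel_open open_Collect_less continuous_on_infnorm_diff) (auto intro!: continuous_intros)

definition pot :: "real \<Rightarrow> real \<Rightarrow> ((real^'n) \<times> real \<Rightarrow> ennreal) \<Rightarrow> real^'n \<Rightarrow> ennreal" where
  "pot \<alpha> \<rho> u x =
     (\<integral>\<^sup>+z. ennreal (snd z powr (\<alpha> - real CARD('n))) * u z * indicator (tent 1 x) z \<partial>strip \<rho>)"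

text \<open>The slice of the cone at height t is a cube of volume (2 c t)^n, and dt/t removes one
  power of t. The set A selects a range of heights.\<close>

lemma nn_integral_tent:
  fixes x :: "real^'n"
  assumes c: "0 \<le> c" and [measurable]: "A \<in> sets borel"
  shows "(\<integral>\<^sup>+z. ennreal (snd z powr b) * indicator (tent c x) z * indicator A (snd z) \<partial>strip \<rho>)
    = (\<integral>\<^sup>+t\<in>{0<..<\<rho>}. ennreal ((2 * c) ^ CARD('n) * t powr (b + real CARD('n) - 1)) * indicator A t \<partial>lborel)"
proof -
  have "(\<integral>\<^sup>+y. ennreal (t powr b) * indicator (tent c x) (y, t) * indicator A t \<partial>lborel) * ennreal (1 / t)
      = ennreal ((2 * c) ^ CARD('n) * t powr (b + real CARD('n) - 1)) * indicator A t"
    if t: "0 < t" for t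
  proof -
    have "(\<integral>\<^sup>+y. ennreal (t powr b) * indicator (tent c x) (y, t) * indicator A t \<partial>lborel)
        = (\<integral>\<^sup>+y. (ennreal (t powr b) * indicator A t) * indicator (qball x (c * t)) y \<partial>lborel)"
      by (intro nn_integral_cong) (auto simp: mem_tent_iff indicator_def)
    also have "\<dots> = ennreal (t powr b) * indicator A t * ennreal ((2 * (c * t)) ^ CARD('n))"
      using c t by (subst nn_integral_cmult_indicator) (auto simp: emeasure_qball)
    also have "\<dots> * ennreal (1 / t)
        = (ennreal (t powr b) * ennreal ((2 * (c * t)) ^ CARD('n)) * ennreal (1 / t)) * indicator A t"
      by (simp only: mult_ac)
    also have "ennreal (t powr b) * ennreal ((2 * (c * t)) ^ CARD('n)) * ennreal (1 / t)
        = ennreal (t powr b * (2 * (c * t)) ^ CARD('n) * (1 / t))"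
      using c t by (simp flip: ennreal_mult)
    also have "t powr b * (2 * (c * t)) ^ CARD('n) * (1 / t) = (2 * c) ^ CARD('n) * t powr (b + real CARD('n) - 1)"
      using t by (simp add: powr_add powr_diff powr_realpow power_mult_distrib)
    finally show ?thesis .
  qed
  then show ?thesis
    by (subst nn_integral_strip, simp, intro nn_integral_cong) (auto simp: indicator_def)
qed

text \<open>The sign of b + n decides at which end the remaining power of t is integrable: at low
  heights if it is positive, at large heights, as in \<open>nn_integral_tent_large\<close>, if it is
  negative. Neither bound depends on \<rho>.\<close>

lemma nn_integral_tent_small:
  fixes x :: "real^'n"
  assumes c: "0 \<le> c" and s: "0 < b + real CARD('n)" and d: "0 \<le> d"
  shows "(\<integral>\<^sup>+z. ennreal (snd z powr b) * indicator (tent c x) z * indicator {..<d} (snd z) \<partial>strip \<rho>)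
    \<le> ennreal ((2 * c) ^ CARD('n) * (d powr (b + real CARD('n)) / (b + real CARD('n))))"
proof -
  let ?e = "b + real CARD('n) - 1"
  have *: "((\<lambda>t. (2 * c) ^ CARD('n) * t powr ?e) has_integral
      ((2 * c) ^ CARD('n) * (d powr (?e + 1) / (?e + 1)))) {0..d}"
    by (intro has_integral_mult_right has_integral_powr_from_0) (use s d in auto)
  have "(\<integral>\<^sup>+z. ennreal (snd z powr b) * indicator (tent c x) z * indicator {..<d} (snd z) \<partial>strip \<rho>)
    \<le> (\<integral>\<^sup>+t. ennreal (indicator {0..d} t * ((2 * c) ^ CARD('n) * t powr ?e)) \<partial>lborel)"
    unfolding nn_integral_tent[OF c borel_open[OF open_lessThan]]
    by (intro nn_integral_mono) (auto simp: indicator_def)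
  also have "\<dots> = ennreal ((2 * c) ^ CARD('n) * (d powr (?e + 1) / (?e + 1)))"
    by (rule nn_integral_has_integral_lebesgue[OF _ *]) (use c in auto)
  finally show ?thesis by simp
qed

lemma nn_integral_tent_large:
  fixes x :: "real^'n"
  assumes c: "0 \<le> c" and s: "b + real CARD('n) < 0" and d: "0 < d"
  shows "(\<integral>\<^sup>+z. ennreal (snd z powr b) * indicator (tent c x) z * indicator {d..} (snd z) \<partial>strip \<rho>)
    \<le> ennreal ((2 * c) ^ CARD('n) * (d powr (b + real CARD('n)) / - (b + real CARD('n))))"
proof -
  define r where "r = b + real CARD('n)"
  let ?e = "r - 1"
  have *: "((\<lambda>t. (2 * c) ^ CARD('n) * t powr ?e) has_integral
      ((2 * c) ^ CARD('n) * (- (d powr (?e + 1)) / (?e + 1)))) {d..}"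
    by (intro has_integral_mult_right has_integral_powr_to_inf) (use s d in \<open>auto simp: r_def\<close>)
  have "(\<integral>\<^sup>+z. ennreal (snd z powr b) * indicator (tent c x) z * indicator {d..} (snd z) \<partial>strip \<rho>)
    \<le> (\<integral>\<^sup>+t. ennreal (indicator {d..} t * ((2 * c) ^ CARD('n) * t powr ?e)) \<partial>lborel)"
    unfolding nn_integral_tent[OF c borel_closed[OF closed_atLeast]] r_def
    by (intro nn_integral_mono) (auto simp: indicator_def)
  also have "\<dots> = ennreal ((2 * c) ^ CARD('n) * (- (d powr (?e + 1)) / (?e + 1)))"
    by (rule nn_integral_has_integral_lebesgue[OF _ *]) (use c in auto)
  finally show ?thesis
    unfolding r_def[symmetric] by (simp add: r_def[symmetric] diff_add_cancel)
qed

section \<open>A Sobolev inequality for the potential\<close>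

text \<open>Hoelder pairs v with the kernel on the part of the cone above height d. The p'-th power
  of the kernel is integrable there since (\<alpha> - n) p' + n = -p' (n/p - \<alpha>) is negative,
  which is exactly \<alpha> p < n. Aperture 1 serves the Sobolev inequality, aperture 2 the heights
  above \<rho>/2.\<close>

lemma pot_large_bound:
  fixes c \<alpha> p :: real
  assumes p: "1 < p" and \<alpha>: "\<alpha> * p < real CARD('n)" and c: "0 < c"
  shows "\<exists>K>0. \<forall>\<rho> d (x :: real^'n) v. v \<in> borel_measurable borel \<longrightarrow> 0 < d \<longrightarrow>
    (\<integral>\<^sup>+z. ennreal (snd z powr (\<alpha> - real CARD('n))) * v z * indicator (tent c x) z * indicator {d..} (snd z) \<partial>strip \<rho>)
    \<le> (\<integral>\<^sup>+z. v z powe p \<partial>strip \<rho>) powe (1 / p) * ennreal (K * d powr (\<alpha> - real CARD('n) / p))"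
proof -
  define n where "n = real CARD('n)"
  define p' where "p' = p / (p - 1)"
  define e where "e = n / p - \<alpha>"
  define K where "K = ((2 * c) ^ CARD('n) / (p' * e)) powr (1 / p')"
  have pp: "1 / p + 1 / p' = 1" "0 < p'" using p by (auto simp: p'_def field_simps)
  have e: "0 < e" using \<alpha> p by (simp add: e_def n_def field_simps)
  have expo: "(\<alpha> - n) * p' + n = - (p' * e)"
    using p by (simp add: p'_def e_def field_simps)
  have K: "0 < K" using c pp e by (simp add: K_def)
  have "(\<integral>\<^sup>+z. ennreal (snd z powr (\<alpha> - n)) * v z * indicator (tent c x) z * indicator {d..} (snd z) \<partial>strip \<rho>)
    \<le> (\<integral>\<^sup>+z. v z powe p \<partial>strip \<rho>) powe (1 / p) * ennreal (K * d powr (\<alpha> - n / p))"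
    if [measurable]: "v \<in> borel_measurable borel" and d: "0 < d" for \<rho> d v and x :: "real^'n"
  proof -
    have "(\<integral>\<^sup>+z. (ennreal (snd z powr (\<alpha> - n)) * indicator (tent c x) z * indicator {d..} (snd z)) powe p' \<partial>strip \<rho>)
       = (\<integral>\<^sup>+z. ennreal (snd z powr ((\<alpha> - n) * p')) * indicator (tent c x) z * indicator {d..} (snd z) \<partial>strip \<rho>)"
      by (simp add: powe_mult powe_ennreal powr_powr)
    also have "\<dots> \<le> ennreal ((2 * c) ^ CARD('n) * (d powr (- (p' * e)) / (p' * e)))"
      using nn_integral_tent_large[of c "(\<alpha> - n) * p'" d, where ?'n = 'n, folded n_def] c d pp e
      by (simp add: expo)
    finally have I: "(\<integral>\<^sup>+z. (ennreal (snd z powr (\<alpha> - n)) * indicator (tent c x) z * indicator {d..} (snd z)) powe p' \<partial>strip \<rho>)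
      \<le> ennreal ((2 * c) ^ CARD('n) * (d powr (- (p' * e)) / (p' * e)))" .
    have "(\<integral>\<^sup>+z. ennreal (snd z powr (\<alpha> - n)) * v z * indicator (tent c x) z * indicator {d..} (snd z) \<partial>strip \<rho>)
      = (\<integral>\<^sup>+z. v z * (ennreal (snd z powr (\<alpha> - n)) * indicator (tent c x) z * indicator {d..} (snd z)) \<partial>strip \<rho>)"
      by (simp only: mult_ac)
    also have "\<dots> \<le> (\<integral>\<^sup>+z. v z powe p \<partial>strip \<rho>) powe (1 / p) *
       (\<integral>\<^sup>+z. (ennreal (snd z powr (\<alpha> - n)) * indicator (tent c x) z * indicator {d..} (snd z)) powe p' \<partial>strip \<rho>) powe (1 / p')"
      by (intro nn_integral_Holder p pp) measurable
    also have "\<dots> \<le> (\<integral>\<^sup>+z. v z powe p \<partial>strip \<rho>) powe (1 / p) *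
        ennreal ((2 * c) ^ CARD('n) * (d powr (- (p' * e)) / (p' * e))) powe (1 / p')"
      using pp by (intro mult_left_mono powe_mono I) auto
    also have "ennreal ((2 * c) ^ CARD('n) * (d powr (- (p' * e)) / (p' * e))) powe (1 / p')
        = ennreal (((2 * c) ^ CARD('n) / (p' * e) * d powr (- (p' * e))) powr (1 / p'))"
      using c pp e by (subst powe_ennreal) auto
    also have "((2 * c) ^ CARD('n) / (p' * e) * d powr (- (p' * e))) powr (1 / p') = K * d powr (\<alpha> - n / p)"
      using c pp e by (subst powr_mult) (auto simp: K_def powr_powr e_def)
    finally show ?thesis .
  qed
  then show ?thesis using K unfolding n_def by blast
qed

text \<open>For \<alpha> p < n the kernel itself is not p'-integrable near height 0, so its factor
  t^(-n/p) is moved over to v. This turns the p-norm of v into a cone average of v^p, whose integral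
  over x is again a multiple of the integral of v^p. The kernel that is left is integrable, with
  exponent (\<alpha> - n + n/p) p' + n = p' \<alpha>.\<close>

lemma pot_small_bound:
  fixes \<alpha> p :: real
  assumes p: "1 < p" and \<alpha>: "0 < \<alpha>"
  shows "\<exists>K>0. \<forall>\<rho> d (x :: real^'n) v. v \<in> borel_measurable borel \<longrightarrow> 0 < d \<longrightarrow>
    (\<integral>\<^sup>+z. ennreal (snd z powr (\<alpha> - real CARD('n))) * v z * indicator (tent 1 x) z * indicator {..<d} (snd z) \<partial>strip \<rho>)
    \<le> (\<integral>\<^sup>+z. ennreal (snd z powr (- real CARD('n))) * v z powe p * indicator (tent 1 x) z \<partial>strip \<rho>) powe (1 / p)
      * ennreal (K * d powr \<alpha>)"
proof -
  define n where "n = real CARD('n)"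
  define p' where "p' = p / (p - 1)"
  define K where "K = (2 ^ CARD('n) / (p' * \<alpha>)) powr (1 / p')"
  have pp: "1 / p + 1 / p' = 1" "0 < p'" using p by (auto simp: p'_def field_simps)
  have expo: "(\<alpha> - n + n / p) * p' + n = p' * \<alpha>"
    using p by (simp add: p'_def field_simps)
  have K: "0 < K" using pp \<alpha> by (simp add: K_def)
  have "(\<integral>\<^sup>+z. ennreal (snd z powr (\<alpha> - n)) * v z * indicator (tent 1 x) z * indicator {..<d} (snd z) \<partial>strip \<rho>)
    \<le> (\<integral>\<^sup>+z. ennreal (snd z powr (- n)) * v z powe p * indicator (tent 1 x) z \<partial>strip \<rho>) powe (1 / p)
      * ennreal (K * d powr \<alpha>)"
    if [measurable]: "v \<in> borel_measurable borel" and d: "0 < d" for \<rho> d v and x :: "real^'n"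
  proof -
    have "(\<integral>\<^sup>+z. (ennreal (snd z powr (\<alpha> - n + n / p)) * indicator (tent 1 x) z * indicator {..<d} (snd z)) powe p' \<partial>strip \<rho>)
       = (\<integral>\<^sup>+z. ennreal (snd z powr ((\<alpha> - n + n / p) * p')) * indicator (tent 1 x) z * indicator {..<d} (snd z) \<partial>strip \<rho>)"
      by (simp add: powe_mult powe_ennreal powr_powr)
    also have "\<dots> \<le> ennreal (2 ^ CARD('n) * (d powr (p' * \<alpha>) / (p' * \<alpha>)))"
      using nn_integral_tent_small[of 1 "(\<alpha> - n + n / p) * p'" d, where ?'n = 'n, folded n_def] d pp \<alpha>
      by (simp add: expo)
    finally have I: "(\<integral>\<^sup>+z. (ennreal (snd z powr (\<alpha> - n + n / p)) * indicator (tent 1 x) z * indicator {..<d} (snd z)) powe p' \<partial>strip \<rho>)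
      \<le> ennreal (2 ^ CARD('n) * (d powr (p' * \<alpha>) / (p' * \<alpha>)))" .
    have split: "ennreal (t powr (\<alpha> - n)) = ennreal (t powr (- n / p)) * ennreal (t powr (\<alpha> - n + n / p))" for t :: real
      by (simp flip: ennreal_mult powr_add)
    have "(\<integral>\<^sup>+z. ennreal (snd z powr (\<alpha> - n)) * v z * indicator (tent 1 x) z * indicator {..<d} (snd z) \<partial>strip \<rho>)
      = (\<integral>\<^sup>+z. (ennreal (snd z powr (- n / p)) * v z * indicator (tent 1 x) z) *
          (ennreal (snd z powr (\<alpha> - n + n / p)) * indicator (tent 1 x) z * indicator {..<d} (snd z)) \<partial>strip \<rho>)"
      unfolding split by (intro nn_integral_cong) (auto simp: indicator_def mult_ac)
    also have "\<dots> \<le> (\<integral>\<^sup>+z. (ennreal (snd z powr (- n / p)) * v z * indicator (tent 1 x) z) powe p \<partial>strip \<rho>) powe (1 / p) *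
       (\<integral>\<^sup>+z. (ennreal (snd z powr (\<alpha> - n + n / p)) * indicator (tent 1 x) z * indicator {..<d} (snd z)) powe p' \<partial>strip \<rho>) powe (1 / p')"
      by (intro nn_integral_Holder p pp) measurable
    also have "(\<integral>\<^sup>+z. (ennreal (snd z powr (- n / p)) * v z * indicator (tent 1 x) z) powe p \<partial>strip \<rho>)
       = (\<integral>\<^sup>+z. ennreal (snd z powr (- n)) * v z powe p * indicator (tent 1 x) z \<partial>strip \<rho>)"
      using p by (simp add: powe_mult powe_ennreal powr_powr)
    also have "(\<integral>\<^sup>+z. ennreal (snd z powr (- n)) * v z powe p * indicator (tent 1 x) z \<partial>strip \<rho>) powe (1 / p) *
        (\<integral>\<^sup>+z. (ennreal (snd z powr (\<alpha> - n + n / p)) * indicator (tent 1 x) z * indicator {..<d} (snd z)) powe p' \<partial>strip \<rho>) powe (1 / p')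
      \<le> (\<integral>\<^sup>+z. ennreal (snd z powr (- n)) * v z powe p * indicator (tent 1 x) z \<partial>strip \<rho>) powe (1 / p) *
        ennreal (2 ^ CARD('n) * (d powr (p' * \<alpha>) / (p' * \<alpha>))) powe (1 / p')"
      using pp by (intro mult_left_mono powe_mono I) auto
    also have "ennreal (2 ^ CARD('n) * (d powr (p' * \<alpha>) / (p' * \<alpha>))) powe (1 / p')
        = ennreal ((2 ^ CARD('n) / (p' * \<alpha>) * d powr (p' * \<alpha>)) powr (1 / p'))"
      using pp \<alpha> by (subst powe_ennreal) auto
    also have "(2 ^ CARD('n) / (p' * \<alpha>) * d powr (p' * \<alpha>)) powr (1 / p') = K * d powr \<alpha>"
      using pp \<alpha> by (subst powr_mult) (auto simp: K_def powr_powr)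
    finally show ?thesis .
  qed
  then show ?thesis using K unfolding n_def by blast
qed

text \<open>Measurability jointly in the vertex and the point, which Tonelli over the vertices and
  the measurability of \<open>pot\<close> rely on.\<close>

lemma borel_measurable_indicator_tent [measurable]:
  "(\<lambda>w. indicator (tent c (f w)) (g w) :: ennreal) \<in> borel_measurable M"
  if [measurable]: "f \<in> borel_measurable M" "g \<in> borel_measurable M"
  for f :: "'a \<Rightarrow> real^'n" and g :: "'a \<Rightarrow> (real^'n) \<times> real"
proof -
  have "(\<lambda>x :: real^'n. infnorm x) \<in> borel_measurable borel"
    by (intro borel_measurable_continuous_onI continuous_on_infnorm continuous_on_id)
  from measurable_compose[OF _ this] have [measurable]:
      "(\<lambda>w. infnorm (h w)) \<in> borel_measurable M" if "h \<in> borel_measurable M" for h :: "'a \<Rightarrow> real^'n"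
    using that by blast
  have "(\<lambda>w. if infnorm (f w - fst (g w)) < c * snd (g w) then 1 else 0 :: ennreal) \<in> borel_measurable M"
    by measurable
  then show ?thesis by (simp add: tent_def indicator_def)
qed

text \<open>Tonelli: a point (y, t) lies in the cones whose vertices fill \<open>qball y t\<close>,
  a cube of volume (2 t)^n, and the factor t^(-n) cancels t^n.\<close>

lemma nn_integral_tent_average:
  fixes g :: "(real^'n) \<times> real \<Rightarrow> ennreal"
  assumes [measurable]: "g \<in> borel_measurable borel"
  shows "(\<integral>\<^sup>+x. (\<integral>\<^sup>+z. ennreal (snd z powr (- real CARD('n))) * g z * indicator (tent 1 x) z \<partial>strip \<rho>) \<partial>lborel)
    = 2 ^ CARD('n) * (\<integral>\<^sup>+z. g z \<partial>strip \<rho>)"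
proof -
  interpret S: sigma_finite_measure "strip \<rho> :: ((real^'n) \<times> real) measure" by (rule sigma_finite_strip)
  interpret P: pair_sigma_finite "strip \<rho> :: ((real^'n) \<times> real) measure" "lborel :: (real^'n) measure" ..
  have "(\<integral>\<^sup>+x. (\<integral>\<^sup>+z. ennreal (snd z powr (- real CARD('n))) * g z * indicator (tent 1 x) z \<partial>strip \<rho>) \<partial>lborel)
     = (\<integral>\<^sup>+z. (\<integral>\<^sup>+x. ennreal (snd z powr (- real CARD('n))) * g z * indicator (tent 1 x) z \<partial>lborel) \<partial>strip \<rho>)"
    by (rule P.Fubini') measurable
  also have "\<dots> = (\<integral>\<^sup>+z. 2 ^ CARD('n) * g z \<partial>strip \<rho>)"
  proof (rule nn_integral_cong_AE, rule eventually_mono[OF AE_strip])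
    fix z :: "(real^'n) \<times> real" assume "0 < snd z \<and> snd z < \<rho>"
    then have t: "0 < snd z" by simp
    have "(\<integral>\<^sup>+x. ennreal (snd z powr (- real CARD('n))) * g z * indicator (tent 1 x) z \<partial>lborel)
      = (\<integral>\<^sup>+x. ennreal (snd z powr (- real CARD('n))) * g z * indicator (qball (fst z) (snd z)) x \<partial>lborel)"
      by (intro nn_integral_cong) (simp add: indicator_def tent_def qball_def infnorm_sub)
    also have "\<dots> = (ennreal (snd z powr (- real CARD('n))) * ennreal ((2 * snd z) ^ CARD('n))) * g z"
      using t by (subst nn_integral_cmult_indicator) (simp_all add: emeasure_qball mult_ac)
    also have "ennreal (snd z powr (- real CARD('n))) * ennreal ((2 * snd z) ^ CARD('n)) = ennreal (2 ^ CARD('n))"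
      using t by (simp add: powr_minus powr_realpow power_mult_distrib flip: ennreal_mult)
    also have "\<dots> = 2 ^ CARD('n)" by (simp flip: ennreal_power)
    finally show "(\<integral>\<^sup>+x. ennreal (snd z powr (- real CARD('n))) * g z * indicator (tent 1 x) z \<partial>lborel)
       = 2 ^ CARD('n) * g z" .
  qed
  finally show ?thesis by (simp add: nn_integral_cmult)
qed

text \<open>The height \<open>d = (m / a) powr (1 / n)\<close> balances the two halves of the bound.\<close>

lemma interpolate_heights:
  fixes a m P :: ennreal
  assumes p: "1 < p" and \<alpha>: "0 < \<alpha>" "\<alpha> * p < n" and n: "0 < n" and q: "q = (n - \<alpha> * p) / n"
    and K: "0 < K1" "0 < K2"
    and bound: "\<And>d. 0 < d \<Longrightarrow> P \<le> a powe (1 / p) * ennreal (K1 * d powr \<alpha>)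
      + m powe (1 / p) * ennreal (K2 * d powr (\<alpha> - n / p))"
    and a0: "a = 0 \<Longrightarrow> P = 0" and m0: "m = 0 \<Longrightarrow> P = 0" and mtop: "m \<noteq> top"
  shows "P powe (p / q) \<le> ennreal ((K1 + K2) powr (p / q)) * (a * m powe (1 / q - 1))"
proof -
  \<comment> \<open>The balancing height exists only for finite positive a and m. If one of them is
    0 the hypotheses give P = 0, and for a = \<open>top\<close> the right-hand side is
    \<open>top\<close>.\<close>
  consider "a = 0 \<or> m = 0" | "a = top" "m \<noteq> 0" | "a \<noteq> 0" "a \<noteq> top" "m \<noteq> 0" by blast
  then show ?thesis
  proof cases
    case 1
    then have "P = 0" using a0 m0 by auto
    then show ?thesis by simp
  next
    case 2
    then have "ennreal ((K1 + K2) powr (p / q)) * (a * m powe (1 / q - 1)) = top"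
      using K by (simp add: ennreal_top_mult ennreal_mult_top ennreal_eq_0_iff)
    then show ?thesis by simp
  next
    case 3
    then obtain A B where AB: "0 < A" "a = ennreal A" "0 < B" "m = ennreal B"
      using mtop by (cases a; cases m) (auto simp: ennreal_eq_0_iff less_le)
    have q0: "0 < q" using q \<alpha> n by simp
    define d where "d = (B / A) powr (1 / n)"
    define X where "X = A powr (q / p) * B powr (\<alpha> / n)"
    have d: "0 < d" using AB by (simp add: d_def)
    \<comment> \<open>By this identity both terms of the bound become multiples of the same X at the
      height d.\<close>
    have qp: "1 / p - \<alpha> / n = q / p" using p n by (simp add: q field_simps)
    have 1: "A powr (1 / p) * (K1 * d powr \<alpha>) = K1 * X"
    proof -
      have "A powr (1 / p) * d powr \<alpha> = A powr (1 / p - \<alpha> / n) * B powr (\<alpha> / n)"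
        using AB by (simp add: d_def powr_powr powr_divide powr_diff)
      then show ?thesis by (simp add: X_def qp)
    qed
    have 2: "B powr (1 / p) * (K2 * d powr (\<alpha> - n / p)) = K2 * X"
    proof -
      have "(1 / n) * (\<alpha> - n / p) = - (q / p)" 
        using n qp by (simp add: field_simps)
      then have "d powr (\<alpha> - n / p) = (B / A) powr (- (q / p))"
        by (simp add: d_def powr_powr)
      also have "\<dots> = A powr (q / p) * B powr (- (q / p))"
        using AB by (simp add: powr_divide powr_minus divide_simps)
      finally have "B powr (1 / p) * d powr (\<alpha> - n / p) = A powr (q / p) * B powr (1 / p - q / p)"
        by (simp only: powr_add[symmetric] mult.left_commute) simp
      also have "1 / p - q / p = \<alpha> / n" using qp by simp
      finally show ?thesis by (simp add: X_def)
    qed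
    have "P \<le> ennreal (A powr (1 / p) * (K1 * d powr \<alpha>)) + ennreal (B powr (1 / p) * (K2 * d powr (\<alpha> - n / p)))"
      using bound[OF d] AB K by (simp add: powe_ennreal ennreal_mult)
    also have "\<dots> = ennreal ((K1 + K2) * X)"
      unfolding 1 2 using K by (subst ennreal_plus[symmetric]) (auto simp: X_def algebra_simps)
    finally have "P powe (p / q) \<le> ennreal ((K1 + K2) * X) powe (p / q)"
      by (rule powe_mono) (use p q0 in simp)
    also have "\<dots> = ennreal ((K1 + K2) powr (p / q) * (A * B powr (1 / q - 1)))"
    proof -
      have e: "\<alpha> / n * (p / q) = 1 / q - 1"
      proof -
        have "\<alpha> * p = n * (1 - q)" using n by (simp add: q field_simps)
        then have "\<alpha> / n * (p / q) = n * (1 - q) / (n * q)" by simp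
        also have "\<dots> = 1 / q - 1" using n q0 by (simp add: field_simps)
        finally show ?thesis .
      qed
      have "X powr (p / q) = A * B powr (1 / q - 1)"
        using AB p q0 by (simp add: X_def powr_mult powr_powr flip: e)
      then show ?thesis using K AB by (subst powe_ennreal) (auto simp: powr_mult X_def)
    qed
    also have "\<dots> = ennreal ((K1 + K2) powr (p / q)) * (a * m powe (1 / q - 1))"
      using K AB by (simp add: powe_ennreal ennreal_mult)
    finally show ?thesis .
  qed
qed

text \<open>Hedberg's argument in the upper half space: at each x the heights are cut where the cone
  average \<open>a x\<close> of v^p balances its total m, which gives (pot v)^(p/q) <= const * a x *
  m^(1/q - 1) pointwise. Only \<open>a x\<close> depends on x, and its integral is 2^n m by
  \<open>nn_integral_tent_average\<close>.\<close>

lemma pot_Sobolev: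
  fixes \<alpha> p q :: real
  assumes p: "1 < p" and \<alpha>: "0 < \<alpha>" "\<alpha> * p < real CARD('n)" and q: "q = (real CARD('n) - \<alpha> * p) / real CARD('n)"
  shows "\<exists>C>0. \<forall>\<rho> (v :: (real^'n) \<times> real \<Rightarrow> ennreal). v \<in> borel_measurable borel \<longrightarrow>
    (\<integral>\<^sup>+x. pot \<alpha> \<rho> v x powe (p / q) \<partial>lborel) \<le> ennreal C * (\<integral>\<^sup>+z. v z powe p \<partial>strip \<rho>) powe (1 / q)"
proof -
  define n where "n = real CARD('n)"
  have n: "0 < n" by (simp add: n_def)
  have q0: "0 < q" using q \<alpha> by simp
  obtain K1 where K1: "0 < K1" and small: "\<And>\<rho> d (x :: real^'n) v. v \<in> borel_measurable borel \<Longrightarrow> 0 < d \<Longrightarrow>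
    (\<integral>\<^sup>+z. ennreal (snd z powr (\<alpha> - n)) * v z * indicator (tent 1 x) z * indicator {..<d} (snd z) \<partial>strip \<rho>)
    \<le> (\<integral>\<^sup>+z. ennreal (snd z powr (- n)) * v z powe p * indicator (tent 1 x) z \<partial>strip \<rho>) powe (1 / p)
      * ennreal (K1 * d powr \<alpha>)"
    using pot_small_bound[OF p \<alpha>(1), where ?'n = 'n] unfolding n_def by blast
  obtain K2 where K2: "0 < K2" and large: "\<And>\<rho> d (x :: real^'n) v. v \<in> borel_measurable borel \<Longrightarrow> 0 < d \<Longrightarrow>
    (\<integral>\<^sup>+z. ennreal (snd z powr (\<alpha> - n)) * v z * indicator (tent 1 x) z * indicator {d..} (snd z) \<partial>strip \<rho>)
    \<le> (\<integral>\<^sup>+z. v z powe p \<partial>strip \<rho>) powe (1 / p) * ennreal (K2 * d powr (\<alpha> - n / p))"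
    using pot_large_bound[OF p \<alpha>(2), of 1] unfolding n_def by auto
  define C where "C = (K1 + K2) powr (p / q) * 2 ^ CARD('n)"
  have "(\<integral>\<^sup>+x. pot \<alpha> \<rho> v x powe (p / q) \<partial>lborel) \<le> ennreal C * (\<integral>\<^sup>+z. v z powe p \<partial>strip \<rho>) powe (1 / q)"
    if v[measurable]: "v \<in> borel_measurable borel" for \<rho> and v :: "(real^'n) \<times> real \<Rightarrow> ennreal"
  proof -
    define m where "m = (\<integral>\<^sup>+z. v z powe p \<partial>strip \<rho>)"
    define a where "a x = (\<integral>\<^sup>+z. ennreal (snd z powr (- n)) * v z powe p * indicator (tent 1 x) z \<partial>strip \<rho>)" for x
    show ?thesis
    proof (cases "m = top")
      case True
      have "0 < C" using K1 K2 by (simp add: C_def)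
      then have "ennreal C * m powe (1 / q) = top"
        using True by (simp add: ennreal_mult_top ennreal_eq_0_iff)
      then show ?thesis unfolding m_def by simp
    next
      case False
      have "pot \<alpha> \<rho> v x powe (p / q) \<le> ennreal ((K1 + K2) powr (p / q)) * (a x * m powe (1 / q - 1))" for x
      proof (rule interpolate_heights[OF p \<alpha>(1) \<alpha>(2)[folded n_def] n q[folded n_def] K1 K2 _ _ _ False])
        fix d :: real assume d: "0 < d"
        have "pot \<alpha> \<rho> v x =
            (\<integral>\<^sup>+z. ennreal (snd z powr (\<alpha> - n)) * v z * indicator (tent 1 x) z * indicator {..<d} (snd z)
             + ennreal (snd z powr (\<alpha> - n)) * v z * indicator (tent 1 x) z * indicator {d..} (snd z) \<partial>strip \<rho>)"
          unfolding pot_def n_def[symmetric] by (intro nn_integral_cong) (auto simp: indicator_def)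
        also have "\<dots> = (\<integral>\<^sup>+z. ennreal (snd z powr (\<alpha> - n)) * v z * indicator (tent 1 x) z * indicator {..<d} (snd z) \<partial>strip \<rho>)
             + (\<integral>\<^sup>+z. ennreal (snd z powr (\<alpha> - n)) * v z * indicator (tent 1 x) z * indicator {d..} (snd z) \<partial>strip \<rho>)"
          by (subst nn_integral_add) auto
        also have "\<dots> \<le> a x powe (1 / p) * ennreal (K1 * d powr \<alpha>) + m powe (1 / p) * ennreal (K2 * d powr (\<alpha> - n / p))"
          unfolding a_def m_def by (intro add_mono small large v d)
        finally show "pot \<alpha> \<rho> v x \<le> a x powe (1 / p) * ennreal (K1 * d powr \<alpha>)
          + m powe (1 / p) * ennreal (K2 * d powr (\<alpha> - n / p))" .
      next
        assume "a x = 0"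
        then have "AE z in strip \<rho>. ennreal (snd z powr (- n)) * v z powe p * indicator (tent 1 x) z = 0"
          unfolding a_def by (subst (asm) nn_integral_0_iff_AE) auto
        then have "AE z in strip \<rho>. ennreal (snd z powr (\<alpha> - n)) * v z * indicator (tent 1 x) z = 0"
          by (rule eventually_mono) (auto simp: ennreal_eq_0_iff)
        then show "pot \<alpha> \<rho> v x = 0"
          unfolding pot_def n_def[symmetric] by (subst nn_integral_0_iff_AE) auto
      next
        assume "m = 0"
        then have "AE z in strip \<rho>. v z powe p = 0"
          unfolding m_def by (subst (asm) nn_integral_0_iff_AE) auto
        then have "AE z in strip \<rho>. ennreal (snd z powr (\<alpha> - n)) * v z * indicator (tent 1 x) z = 0"
          by (rule eventually_mono) auto
        then show "pot \<alpha> \<rho> v x = 0"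
          unfolding pot_def n_def[symmetric] by (subst nn_integral_0_iff_AE) auto
      qed
      then have "(\<integral>\<^sup>+x. pot \<alpha> \<rho> v x powe (p / q) \<partial>lborel)
          \<le> (\<integral>\<^sup>+x. ennreal ((K1 + K2) powr (p / q)) * (a x * m powe (1 / q - 1)) \<partial>lborel)"
        by (intro nn_integral_mono)
      also have "\<dots> = ennreal ((K1 + K2) powr (p / q)) * m powe (1 / q - 1) * (\<integral>\<^sup>+x. a x \<partial>lborel)"
      proof -
        interpret S: sigma_finite_measure "strip \<rho> :: ((real^'n) \<times> real) measure" by (rule sigma_finite_strip)
        have [measurable]: "a \<in> borel_measurable lborel" unfolding a_def by measurable
        show ?thesis by (subst nn_integral_cmult[symmetric]) (auto simp: mult_ac)
      qed
      also have "(\<integral>\<^sup>+x. a x \<partial>lborel) = 2 ^ CARD('n) * m"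
        unfolding a_def m_def n_def by (rule nn_integral_tent_average) measurable
      also have "ennreal ((K1 + K2) powr (p / q)) * m powe (1 / q - 1) * (2 ^ CARD('n) * m)
          = ennreal C * (m powe (1 / q - 1) * m powe 1)"
        unfolding C_def using K1 K2 by (simp add: ennreal_mult ennreal_power[symmetric] mult_ac)
      also have "\<dots> = ennreal C * m powe (1 / q)"
        by (simp flip: powe_add del: powe_one)
      finally show ?thesis unfolding m_def .
    qed
  qed
  moreover have "0 < C" using K1 K2 by (simp add: C_def)
  ultimately show ?thesis by blast
qed

section \<open>The capacity in terms of the unweighted potential\<close>

lemma AE_lborel_swap:
  fixes P :: "'a::euclidean_space \<times> 'b::euclidean_space \<Rightarrow> bool"
  assumes "AE z in lborel. P z"
  shows "AE t in lborel. AE y in lborel. P (y, t)"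
proof -
  obtain N where N: "N \<in> null_sets lborel" "{z. \<not> P z} \<subseteq> N"
    using assms by (auto simp: eventually_ae_filter)
  then have [measurable]: "N \<in> sets borel" by auto
  have [measurable]: "(\<lambda>z. indicator N z :: ennreal) \<in> borel_measurable (borel \<Otimes>\<^sub>M borel)"
    unfolding borel_prod by measurable
  have "(\<integral>\<^sup>+t. \<integral>\<^sup>+y. indicator N (y, t) \<partial>lborel \<partial>lborel) = (\<integral>\<^sup>+z. indicator N z \<partial>(lborel \<Otimes>\<^sub>M lborel))"
    by (rule lborel_pair.nn_integral_snd) measurable
  also have "\<dots> = 0" using N by (simp add: lborel_prod null_setsD1)
  finally have "AE t in lborel. (\<integral>\<^sup>+y. indicator N (y, t) \<partial>lborel) = (0 :: ennreal)"
    by (subst (asm) nn_integral_0_iff_AE) auto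
  then show ?thesis
  proof (rule eventually_mono)
    fix t :: 'b assume "(\<integral>\<^sup>+y. indicator N (y, t) \<partial>lborel) = (0 :: ennreal)"
    then have "AE y in lborel. indicator N (y, t) = (0 :: ennreal)"
      by (subst (asm) nn_integral_0_iff_AE) auto
    then show "AE y in lborel. P (y, t)"
      using N by (auto elim!: eventually_mono simp: indicator_def split: if_splits)
  qed
qed

lemma AE_lborel_fst:
  fixes P :: "'a::euclidean_space \<Rightarrow> bool"
  assumes "AE y in lborel. P y"
  shows "AE z in (lborel :: ('a \<times> 'b::euclidean_space) measure). P (fst z)"
proof -
  obtain N where N: "N \<in> null_sets lborel" "{y. \<not> P y} \<subseteq> N"
    using assms by (auto simp: eventually_ae_filter)
  have "emeasure (lborel \<Otimes>\<^sub>M lborel) (N \<times> (UNIV :: 'b set)) = 0"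
    using N by (subst lborel.emeasure_pair_measure_Times) (auto simp: null_setsD1)
  then have "N \<times> (UNIV :: 'b set) \<in> null_sets lborel"
    using N null_setsD2[OF N(1)] by (auto simp: lborel_prod intro!: null_setsI borel_Times)
  then show ?thesis
    by (rule AE_I') (use N in auto)
qed

text \<open>The integrand k will come from a test function that is only jointly Lebesgue measurable,
  so single slices may fail to be measurable. Equality with the Borel function h almost everywhere
  passes to almost every slice by \<open>AE_lborel_swap\<close>, and \<open>nn_integral\<close> does
  not see null sets.\<close>

lemma iterated_integral_eq_strip:
  fixes h :: "(real^'n) \<times> real \<Rightarrow> ennreal"
  assumes [measurable]: "h \<in> borel_measurable borel"
    and eq: "AE z in lborel. 0 < snd z \<and> snd z < \<rho> \<longrightarrow> k (fst z) (snd z) = h z"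
  shows "(\<integral>\<^sup>+t\<in>{0<..<\<rho>}. (\<integral>\<^sup>+y. k y t \<partial>lebesgue) * ennreal (1 / t) \<partial>lebesgue) = (\<integral>\<^sup>+z. h z \<partial>strip \<rho>)"
proof -
  have "AE t in lborel. 0 < t \<and> t < \<rho> \<longrightarrow> (\<integral>\<^sup>+y. k y t \<partial>lborel) = (\<integral>\<^sup>+y. h (y, t) \<partial>lborel)"
    using AE_lborel_swap[OF eq]
  proof (rule eventually_mono, intro impI)
    fix t :: real
    assume "AE y in lborel. 0 < snd (y, t) \<and> snd (y, t) < \<rho> \<longrightarrow> k (fst (y, t)) (snd (y, t)) = h (y, t)"
      and "0 < t \<and> t < \<rho>"
    then show "(\<integral>\<^sup>+y. k y t \<partial>lborel) = (\<integral>\<^sup>+y. h (y, t) \<partial>lborel)"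
      by (intro nn_integral_cong_AE) simp
  qed
  then have "(\<integral>\<^sup>+t\<in>{0<..<\<rho>}. (\<integral>\<^sup>+y. k y t \<partial>lborel) * ennreal (1 / t) \<partial>lborel)
      = (\<integral>\<^sup>+t\<in>{0<..<\<rho>}. (\<integral>\<^sup>+y. h (y, t) \<partial>lborel) * ennreal (1 / t) \<partial>lborel)"
    by (intro nn_integral_cong_AE) (auto elim!: eventually_mono simp: indicator_def)
  then show ?thesis by (simp add: nn_integral_completion nn_integral_strip)
qed

text \<open>A Borel representative that is positive everywhere and not only almost everywhere. The
  weight enters integrals and essential suprema only, so nothing changes there, while powers and
  reciprocals can be formed pointwise.\<close>

definition positive_version :: "(real^'n \<Rightarrow> real) \<Rightarrow> (real^'n \<Rightarrow> real) \<Rightarrow> bool" where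
  "positive_version w \<omega> \<longleftrightarrow>
     w \<in> borel_measurable borel \<and> (\<forall>y. 0 < w y) \<and> (AE y in lborel. \<omega> y = w y)"

text \<open>Integrability on compact sets yields measurability of cutoffs only; the weight is the
  pointwise limit of its cutoffs to balls.\<close>

lemma weight_measurable:
  fixes \<omega> :: "real^'n \<Rightarrow> real"
  assumes "weight \<omega>" shows "\<omega> \<in> borel_measurable lebesgue"
proof (rule borel_measurable_LIMSEQ_real)
  fix i :: nat
  have "set_integrable lebesgue (cball 0 (real i)) \<omega>"
    using assms by (simp add: weight_def locally_integrable_def)
  then show "(\<lambda>x. indicator (cball 0 (real i)) x *\<^sub>R \<omega> x) \<in> borel_measurable lebesgue"
    unfolding set_integrable_def by (rule borel_measurable_integrable)
next
  fix x :: "real^'n"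
  obtain N where "norm x \<le> real N" using real_arch_simple by blast
  then have "\<forall>\<^sub>F i in sequentially. indicator (cball 0 (real i)) x *\<^sub>R \<omega> x = \<omega> x"
    by (auto simp: eventually_sequentially intro!: exI[of _ N])
  then show "(\<lambda>i. indicator (cball 0 (real i)) x *\<^sub>R \<omega> x) \<longlonglongrightarrow> \<omega> x"
    by (rule tendsto_eventually)
qed

lemma weight_positive_version:
  assumes "weight \<omega>" shows "\<exists>w. positive_version w \<omega>"
proof -
  obtain v where [measurable]: "v \<in> borel_measurable borel" and v: "AE y in lborel. \<omega> y = v y"
    using completion_ex_borel_measurable_real[OF weight_measurable[OF assms]] by auto
  have "AE y in lborel. 0 < \<omega> y"
    using assms by (simp add: weight_def AE_completion_iff)
  then have "AE y in lborel. \<omega> y = (if 0 < v y then v y else 1)"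
    using v by eventually_elim auto
  then have "positive_version (\<lambda>y. if 0 < v y then v y else 1) \<omega>"
    unfolding positive_version_def by auto
  then show ?thesis by blast
qed

section \<open>Test functions and their unweighted form\<close>

definition energy :: "real \<Rightarrow> real \<Rightarrow> (real^'n \<Rightarrow> real) \<Rightarrow> ((real^'n) \<times> real \<Rightarrow> ennreal) \<Rightarrow> ennreal" where
  "energy p \<rho> w u = (\<integral>\<^sup>+z. u z powe p * ennreal (w (fst z)) \<partial>strip \<rho>)"

text \<open>With u = g \<omega>' the potential absorbs the factor \<omega>', and \<omega>'^p
  \<omega> = \<omega>' gives u^p \<omega> = g^p \<omega>' for the energy. Since u is prescribed only
  almost everywhere in the strip it can be taken Borel; the identities then serve both for passing
  from g to u and for passing back.\<close>

lemma test_function_integrals: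
  fixes w :: "real^'n \<Rightarrow> real"
  assumes p: "1 < p" and w: "positive_version w \<omega>" and u[measurable]: "u \<in> borel_measurable borel"
    and g: "\<forall>y. \<forall>t\<in>{0<..<\<rho>}. 0 \<le> g y t"
    and ug: "AE z in lborel. 0 < snd z \<and> snd z < \<rho> \<longrightarrow>
      u z = ennreal (g (fst z) (snd z) * w (fst z) powr (- 1 / (p - 1)))"
  shows "(\<integral>\<^sup>+t\<in>{0<..<\<rho>}. (\<integral>\<^sup>+y\<in>{y. infnorm (x - y) < t}.
           ennreal (g y t / t powr (real CARD('n) - \<alpha>) * dual_weight p \<omega> y) \<partial>lebesgue)
        * ennreal (1 / t) \<partial>lebesgue) = pot \<alpha> \<rho> u x" (is ?pot)
    and "(\<integral>\<^sup>+t\<in>{0<..<\<rho>}. (\<integral>\<^sup>+y. ennreal (g y t powr p * dual_weight p \<omega> y) \<partial>lebesgue)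
        * ennreal (1 / t) \<partial>lebesgue) = energy p \<rho> w u" (is ?energy)
proof -
  have [measurable]: "w \<in> borel_measurable borel" and wpos: "\<And>y. 0 < w y"
    using w by (auto simp: positive_version_def)
  have w\<omega>: "AE z in lborel. dual_weight p \<omega> (fst z) = w (fst z :: real^'n) powr (- 1 / (p - 1))"
    by (rule AE_lborel_fst) (use w in \<open>auto simp: positive_version_def dual_weight_def elim!: eventually_mono\<close>)
  show ?pot
    unfolding pot_def
  proof (rule iterated_integral_eq_strip)
    show "(\<lambda>z. ennreal (snd z powr (\<alpha> - real CARD('n))) * u z * indicator (tent 1 x) z) \<in> borel_measurable borel"
      by measurable
  next
    show "AE z in lborel. 0 < snd z \<and> snd z < \<rho> \<longrightarrow> ennreal (g (fst z) (snd z) / snd z powr (real CARD('n) - \<alpha>) * dual_weight p \<omega> (fst z))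
          * indicator {y. infnorm (x - y) < snd z} (fst z)
        = ennreal (snd z powr (\<alpha> - real CARD('n))) * u z * indicator (tent 1 x) z"
      using ug w\<omega>
    proof (eventually_elim, intro impI)
    fix z :: "(real^'n) \<times> real"
    assume uz: "0 < snd z \<and> snd z < \<rho> \<longrightarrow> u z = ennreal (g (fst z) (snd z) * w (fst z) powr (- 1 / (p - 1)))"
      and wz: "dual_weight p \<omega> (fst z) = w (fst z) powr (- 1 / (p - 1))"
      and z: "0 < snd z \<and> snd z < \<rho>"
    have "g (fst z) (snd z) / snd z powr (real CARD('n) - \<alpha>)
        = snd z powr (\<alpha> - real CARD('n)) * g (fst z) (snd z)"
      using powr_minus_divide[of "snd z" "real CARD('n) - \<alpha>"] by simp
    then have "ennreal (g (fst z) (snd z) / snd z powr (real CARD('n) - \<alpha>) * dual_weight p \<omega> (fst z))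
        = ennreal (snd z powr (\<alpha> - real CARD('n))) * u z"
      using z uz wz g by (simp add: mult.assoc flip: ennreal_mult)
    then show "ennreal (g (fst z) (snd z) / snd z powr (real CARD('n) - \<alpha>) * dual_weight p \<omega> (fst z))
          * indicator {y. infnorm (x - y) < snd z} (fst z)
        = ennreal (snd z powr (\<alpha> - real CARD('n))) * u z * indicator (tent 1 x) z"
      by (simp add: tent_def indicator_def)
    qed
  qed
  show ?energy
    unfolding energy_def
  proof (rule iterated_integral_eq_strip)
    show "(\<lambda>z. u z powe p * ennreal (w (fst z))) \<in> borel_measurable borel"
      by measurable
  next
    show "AE z in lborel. 0 < snd z \<and> snd z < \<rho> \<longrightarrow> ennreal (g (fst z) (snd z) powr p * dual_weight p \<omega> (fst z)) = u z powe p * ennreal (w (fst z))"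
      using ug w\<omega>
    proof (eventually_elim, intro impI)
    fix z :: "(real^'n) \<times> real"
    assume uz: "0 < snd z \<and> snd z < \<rho> \<longrightarrow> u z = ennreal (g (fst z) (snd z) * w (fst z) powr (- 1 / (p - 1)))"
      and wz: "dual_weight p \<omega> (fst z) = w (fst z) powr (- 1 / (p - 1))"
      and z: "0 < snd z \<and> snd z < \<rho>"
    have g0: "0 \<le> g (fst z) (snd z)" using g z by simp
    have e: "- 1 / (p - 1) * p + 1 = - 1 / (p - 1)" using p by (simp add: field_simps)
    have "u z powe p = ennreal (g (fst z) (snd z) powr p * w (fst z) powr (- 1 / (p - 1) * p))"
      using uz z g0 by (simp add: powe_ennreal powr_mult powr_powr)
    then have "u z powe p * ennreal (w (fst z))
        = ennreal (g (fst z) (snd z) powr p * (w (fst z) powr (- 1 / (p - 1) * p) * w (fst z) powr 1))"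
      using wpos[of "fst z"] by (simp add: mult.assoc flip: ennreal_mult)
    also have "w (fst z) powr (- 1 / (p - 1) * p) * w (fst z) powr 1 = dual_weight p \<omega> (fst z)"
      unfolding wz powr_add[symmetric] e ..
    finally show "ennreal (g (fst z) (snd z) powr p * dual_weight p \<omega> (fst z)) = u z powe p * ennreal (w (fst z))" ..
    qed
  qed
qed

lemma capacity_lessD:
  fixes w :: "real^'n \<Rightarrow> real"
  assumes p: "1 < p" and w: "positive_version w \<omega>" and less: "capacity \<alpha> p \<rho> \<omega> E < b"
  shows "\<exists>u\<in>borel_measurable borel. (\<forall>x\<in>E. 1 \<le> pot \<alpha> \<rho> u x) \<and> energy p \<rho> w u < b"
proof -
  have [measurable]: "w \<in> borel_measurable borel"
    using w by (auto simp: positive_version_def)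
  obtain g where g: "admissible \<alpha> p \<rho> \<omega> E g" and gb:
    "(\<integral>\<^sup>+t\<in>{0<..<\<rho>}. (\<integral>\<^sup>+y. ennreal (g y t powr p * dual_weight p \<omega> y) \<partial>lebesgue)
        * ennreal (1 / t) \<partial>lebesgue) < b"
    using less unfolding capacity_def INF_less_iff by auto
  let ?S = "UNIV \<times> {0<..<\<rho>} :: ((real^'n) \<times> real) set"
  have S: "?S \<in> sets borel"
    by (rule borel_Times) auto
  have "(\<lambda>(y, t). g y t) \<in> borel_measurable (restrict_space lebesgue ?S)"
    using g by (simp add: admissible_def)
  then have "(\<lambda>z. ennreal (case z of (y, t) \<Rightarrow> g y t)) \<in> borel_measurable (restrict_space lebesgue ?S)"
    by (rule measurable_compose) measurable
  \<comment> \<open>\<open>admissible\<close> constrains g inside the strip only. Extended by 0 it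
    is Lebesgue measurable on the whole space and has a Borel version G.\<close>
  then have "(\<lambda>z. ennreal (case z of (y, t) \<Rightarrow> g y t) * indicator ?S z) \<in> borel_measurable lebesgue"
    using S by (subst (asm) borel_measurable_restrict_space_iff_ennreal) auto
  from completion_ex_borel_measurable[OF this] obtain G where [measurable]: "G \<in> borel_measurable borel"
    and G: "AE z in lborel. ennreal (case z of (y, t) \<Rightarrow> g y t) * indicator ?S z = G z"
    by auto
  define u where "u z = G z * ennreal (w (fst z) powr (- 1 / (p - 1)))" for z
  have u[measurable]: "u \<in> borel_measurable borel" unfolding u_def by measurable
  have g0: "\<forall>y. \<forall>t\<in>{0<..<\<rho>}. 0 \<le> g y t"
    using g by (simp add: admissible_def)
  have "AE z in lborel. 0 < snd z \<and> snd z < \<rho> \<longrightarrow>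
      u z = ennreal (g (fst z) (snd z) * w (fst z) powr (- 1 / (p - 1)))"
    using G
  proof eventually_elim
    case (elim z)
    then show ?case
      using g0 by (cases z) (auto simp: u_def ennreal_mult simp flip: elim)
  qed
  note eq = test_function_integrals[OF p w u g0 this]
  have "\<forall>x\<in>E. 1 \<le> pot \<alpha> \<rho> u x"
    using g unfolding admissible_def eq(1) by blast
  moreover have "energy p \<rho> w u < b" using gb by (simp add: eq(2))
  ultimately show ?thesis using u by blast
qed

text \<open>Test functions are real valued, while u may take the value \<open>top\<close>. Finite
  energy and w > 0 make u finite almost everywhere in the strip, so g = u/\<omega>', with
  \<open>top\<close> sent to 0, is a legitimate test function; for infinite energy the bound is
  trivial.\<close>

lemma capacity_le_energy:
  fixes w :: "real^'n \<Rightarrow> real"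
  assumes p: "1 < p" and w: "positive_version w \<omega>" and u[measurable]: "u \<in> borel_measurable borel"
    and E: "\<And>x. x \<in> E \<Longrightarrow> 1 \<le> pot \<alpha> \<rho> u x"
  shows "capacity \<alpha> p \<rho> \<omega> E \<le> energy p \<rho> w u"
proof (cases "energy p \<rho> w u = top")
  case False
  have [measurable]: "w \<in> borel_measurable borel" and wpos: "\<And>y. 0 < w y"
    using w by (auto simp: positive_version_def)
  have "AE z in strip \<rho>. u z powe p * ennreal (w (fst z)) \<noteq> \<infinity>"
    using False unfolding energy_def by (intro nn_integral_PInf_AE) auto
  then have "AE z in lborel. 0 < ennreal (1 / snd z) * indicator {0<..<\<rho>} (snd z) \<longrightarrow>
      u z powe p * ennreal (w (fst z)) \<noteq> \<infinity>"
    unfolding strip_def by (subst (asm) AE_density) (auto simp: split_beta')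
  then have fin: "AE z in lborel. 0 < snd z \<and> snd z < \<rho> \<longrightarrow> u z \<noteq> top"
  proof eventually_elim
    case (elim z)
    then show ?case using wpos[of "fst z"]
      by (auto simp: ennreal_top_mult ennreal_eq_0_iff indicator_def)
  qed
  define g where "g y t = enn2real (u (y, t)) * w y powr (1 / (p - 1))" for y t
  have g0: "\<forall>y. \<forall>t\<in>{0<..<\<rho>}. 0 \<le> g y t" by (simp add: g_def)
  have "AE z in lborel. 0 < snd z \<and> snd z < \<rho> \<longrightarrow>
      u z = ennreal (g (fst z) (snd z) * w (fst z) powr (- 1 / (p - 1)))"
    using fin
  proof eventually_elim
    case (elim z)
    have "w (fst z) powr (1 / (p - 1)) * w (fst z) powr (- 1 / (p - 1)) = 1"
      using wpos[of "fst z"] by (simp flip: powr_add)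
    with elim show ?case by (simp add: g_def mult.assoc less_top)
  qed
  note eq = test_function_integrals[OF p w u g0 this]
  have "(\<lambda>z. g (fst z) (snd z)) \<in> borel_measurable borel"
    unfolding g_def prod.collapse by measurable
  then have "(\<lambda>(y, t). g y t) \<in> borel_measurable (restrict_space lebesgue (UNIV \<times> {0<..<\<rho>}))"
    by (intro measurable_restrict_space1 measurable_completion) (simp add: split_beta')
  then have "admissible \<alpha> p \<rho> \<omega> E g"
    unfolding admissible_def eq(1) using E g0 by blast
  then have "capacity \<alpha> p \<rho> \<omega> E \<le> (\<integral>\<^sup>+t\<in>{0<..<\<rho>}. (\<integral>\<^sup>+y. ennreal (g y t powr p * dual_weight p \<omega> y) \<partial>lebesgue)
        * ennreal (1 / t) \<partial>lebesgue)"
    unfolding capacity_def by (intro INF_lower) simp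
  then show ?thesis by (simp add: eq(2))
qed simp

section \<open>Local Muckenhoupt weights\<close>

definition cube_mass :: "(real^'n \<Rightarrow> real) \<Rightarrow> real^'n \<Rightarrow> real \<Rightarrow> ennreal" where
  "cube_mass w a l = (\<integral>\<^sup>+z\<in>cube a l. ennreal (w z) \<partial>lborel)"

lemma cube_mass_mono: "cube a l \<subseteq> cube b k \<Longrightarrow> cube_mass w a l \<le> cube_mass w b k"
  unfolding cube_mass_def by (intro nn_integral_mono) (auto simp: indicator_def)

lemma cube_mass_version:
  assumes "positive_version w \<omega>"
  shows "(\<integral>\<^sup>+z\<in>cube a l. ennreal (\<omega> z) \<partial>lebesgue) = cube_mass w a l"
  unfolding cube_mass_def nn_integral_completion
  by (rule nn_integral_cong_AE) (use assms in \<open>auto simp: positive_version_def elim!: eventually_mono\<close>)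

lemma cube_mass_pos:
  assumes w: "positive_version w \<omega>" and l: "0 < l"
  shows "cube_mass w a l \<noteq> 0"
proof
  have [measurable]: "w \<in> borel_measurable borel" and wpos: "\<And>y. 0 < w y"
    using w by (auto simp: positive_version_def)
  have [simp]: "ennreal (w y) \<noteq> 0" for y using wpos by (simp add: ennreal_eq_0_iff not_le)
  assume "cube_mass w a l = 0"
  then have "AE z in lborel. ennreal (w z) * indicator (cube a l) z = 0"
    unfolding cube_mass_def by (subst (asm) nn_integral_0_iff_AE) auto
  then have "AE z in lborel. z \<notin> cube a l"
    by (rule eventually_mono) (auto simp: indicator_def)
  then have "emeasure lborel (cube a l) = 0"
    by (subst (asm) AE_iff_measurable[of "cube a l"]) auto
  then show False using l by (simp add: emeasure_cube)
qed

lemma cube_mass_finite: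
  assumes "weight \<omega>" and w: "positive_version w \<omega>"
  shows "cube_mass w a l \<noteq> top"
proof -
  let ?K = "cbox a (a + vec l)"
  have "set_integrable lebesgue ?K \<omega>"
    using assms by (simp add: weight_def locally_integrable_def compact_cbox)
  then have "(\<integral>\<^sup>+z. ennreal (norm (indicator ?K z *\<^sub>R \<omega> z)) \<partial>lebesgue) < \<infinity>"
    unfolding set_integrable_def integrable_iff_bounded by blast
  moreover have "(\<integral>\<^sup>+z\<in>cube a l. ennreal (\<omega> z) \<partial>lebesgue) \<le> (\<integral>\<^sup>+z. ennreal (norm (indicator ?K z *\<^sub>R \<omega> z)) \<partial>lebesgue)"
    using box_subset_cbox[of a "a + vec l"]
    by (intro nn_integral_mono) (auto simp: indicator_def cube_def intro!: ennreal_leI)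
  ultimately show ?thesis using cube_mass_version[OF w, of a l] by (auto simp: less_top)
qed

text \<open>The A_1 condition in the form in which it is used. Almost everywhere in the cube
  1/\<omega> is at most its essential supremum S, so 1 <= S * w y; multiplying the average by S * w
  y and by the volume gives the bound without an essential supremum.\<close>

lemma A1_mass_le:
  fixes w :: "real^'n \<Rightarrow> real"
  assumes wt: "weight \<omega>" and w: "positive_version w \<omega>" and l: "0 < l" "l \<le> R"
  shows "AE y in lborel. y \<in> cube a l \<longrightarrow>
    cube_mass w a l \<le> A1_const R \<omega> * ennreal (l ^ CARD('n)) * ennreal (w y)"
proof -
  let ?Q = "cube a l"
  let ?S = "esssup (restrict_space lebesgue ?Q) (\<lambda>y. inverse (ennreal (\<omega> y)))"
  let ?V = "ennreal (l ^ CARD('n))"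
  have Q: "?Q \<in> sets lebesgue" by simp
  have V: "?V \<noteq> 0" "?V \<noteq> top" using l by (auto simp: ennreal_eq_0_iff not_le)
  have "(\<integral>\<^sup>+ y \<in> ?Q. ennreal (\<omega> y) \<partial>lebesgue) / emeasure lebesgue ?Q * ?S \<le> A1_const R \<omega>"
    unfolding A1_const_def using l by (intro SUP_upper2[of "(a, l)"]) auto
  then have le: "cube_mass w a l / ?V * ?S \<le> A1_const R \<omega>"
    using l by (simp add: cube_mass_version[OF w] emeasure_cube)
  have "AE y in lborel. y \<in> ?Q \<longrightarrow> inverse (ennreal (\<omega> y)) \<le> ?S"
    using esssup_AE[of "\<lambda>y. inverse (ennreal (\<omega> y))" "restrict_space lebesgue ?Q"]
    by (subst (asm) AE_restrict_space_iff) (auto simp: AE_completion_iff)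
  moreover have "AE y in lborel. \<omega> y = w y"
    using w by (auto simp: positive_version_def)
  ultimately show ?thesis
  proof (eventually_elim, intro impI)
    fix y assume *: "y \<in> ?Q \<longrightarrow> inverse (ennreal (\<omega> y)) \<le> ?S" "\<omega> y = w y" "y \<in> ?Q"
    have wy: "0 < w y" using w by (auto simp: positive_version_def)
    have "1 = inverse (ennreal (w y)) * ennreal (w y)"
      using wy by (simp add: inverse_ennreal flip: ennreal_mult)
    also have "\<dots> \<le> ?S * ennreal (w y)" using * by (intro mult_right_mono) auto
    finally have 1: "1 \<le> ?S * ennreal (w y)" .
    have "cube_mass w a l = cube_mass w a l / ?V * ?V * 1"
      using V by (simp add: ennreal_divide_times less_top ennreal_divide_self ennreal_mult_divide_eq
          flip: ennreal_times_divide)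
    also have "\<dots> \<le> cube_mass w a l / ?V * ?V * (?S * ennreal (w y))"
      by (intro mult_left_mono 1) simp
    also have "\<dots> = (cube_mass w a l / ?V * ?S) * ?V * ennreal (w y)" by (simp only: mult_ac)
    also have "\<dots> \<le> A1_const R \<omega> * ?V * ennreal (w y)"
      by (intro mult_right_mono le) auto
    finally show "cube_mass w a l \<le> A1_const R \<omega> * ?V * ennreal (w y)" by simp
  qed
qed

text \<open>The converse of \<open>A1_mass_le\<close>: dividing by the mass turns the pointwise
  inequality into a bound for the essential supremum of 1/\<omega>. The division is legitimate in
  \<open>ennreal\<close> because the mass is neither 0 nor \<open>top\<close>.\<close>

lemma A1_const_le:
  fixes w :: "real^'n \<Rightarrow> real"
  assumes wt: "weight \<omega>" and w: "positive_version w \<omega>"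
    and mass: "\<And>a l. 0 < l \<Longrightarrow> l \<le> R \<Longrightarrow> AE y in lborel. y \<in> cube a l \<longrightarrow>
      cube_mass w a l \<le> K * ennreal (l ^ CARD('n)) * ennreal (w y)"
  shows "A1_const R \<omega> \<le> K"
  unfolding A1_const_def
proof (rule SUP_least, clarify)
  fix a :: "real^'n" and l :: real assume l: "0 < l" "l \<le> R"
  let ?Q = "cube a l" let ?V = "ennreal (l ^ CARD('n))" let ?I = "cube_mass w a l"
  let ?S = "esssup (restrict_space lebesgue ?Q) (\<lambda>y. inverse (ennreal (\<omega> y)))"
  have V: "?V \<noteq> 0" "?V \<noteq> top" using l by (auto simp: ennreal_eq_0_iff not_le)
  have I: "?I \<noteq> 0" "?I \<noteq> top"
    using cube_mass_pos[OF w l(1)] cube_mass_finite[OF wt w] by auto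
  have [measurable]: "\<omega> \<in> borel_measurable lebesgue" by (rule weight_measurable[OF wt])
  have S: "?S \<le> K * ?V / ?I"
  proof (rule esssup_I)
    show "(\<lambda>y. inverse (ennreal (\<omega> y))) \<in> borel_measurable (restrict_space lebesgue ?Q)"
      by (rule measurable_restrict_space1) measurable
    have "AE y in lborel. y \<in> ?Q \<longrightarrow> inverse (ennreal (\<omega> y)) \<le> K * ?V / ?I"
      using mass[OF l, of a] w[unfolded positive_version_def, THEN conjunct2, THEN conjunct2]
    proof (eventually_elim, intro impI)
      fix y assume *: "y \<in> ?Q \<longrightarrow> ?I \<le> K * ?V * ennreal (w y)" "\<omega> y = w y" "y \<in> ?Q"
      have wy: "0 < w y" using w by (auto simp: positive_version_def)
      have "?I * inverse (ennreal (w y)) \<le> (K * ?V * ennreal (w y)) * inverse (ennreal (w y))"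
        using * by (intro mult_right_mono) auto
      also have "\<dots> = K * ?V * (ennreal (w y) * inverse (ennreal (w y)))" by (simp only: mult_ac)
      also have "ennreal (w y) * inverse (ennreal (w y)) = 1"
        using wy by (simp add: inverse_ennreal flip: ennreal_mult)
      finally have "inverse (ennreal (w y)) * ?I \<le> K * ?V" by (simp add: mult.commute)
      then have "inverse (ennreal (w y)) * ?I / ?I \<le> K * ?V / ?I"
        by (rule divide_right_mono_ennreal)
      then show "inverse (ennreal (\<omega> y)) \<le> K * ?V / ?I"
        using I * by (simp add: ennreal_mult_divide_eq)
    qed
    then show "AE y in restrict_space lebesgue ?Q. inverse (ennreal (\<omega> y)) \<le> K * ?V / ?I"
      by (subst AE_restrict_space_iff) (auto simp: AE_completion_iff)
  qed
  have "?I / ?V * ?S \<le> ?I / ?V * (K * ?V / ?I)" by (intro mult_left_mono S) simp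
  also have "\<dots> = K * (?V / ?V) * (?I / ?I)"
    by (simp add: divide_ennreal_def mult_ac)
  also have "\<dots> = K" using I V by (simp add: ennreal_divide_self less_top)
  finally show "(\<integral>\<^sup>+ y \<in> ?Q. ennreal (\<omega> y) \<partial>lebesgue) / emeasure lebesgue ?Q * ?S \<le> K"
    using l by (simp add: cube_mass_version[OF w] emeasure_cube)
qed

text \<open>Corner cubes of side \<open>s\<close> cover a cube of side \<open>l \<le> 3 s / 2\<close>, and all of them
  contain the central cube of side \<open>2 s - l \<ge> s / 2\<close>, through which their masses are compared.\<close>

lemma A1_const_enlarge:
  fixes \<omega> :: "real^'n \<Rightarrow> real"
  assumes wt: "weight \<omega>" and s: "0 < s" and fin: "A1_const s \<omega> < top"
  shows "A1_const (3 / 2 * s) \<omega> < top"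
proof -
  obtain w where w: "positive_version w \<omega>" using weight_positive_version[OF wt] by blast
  have [measurable]: "w \<in> borel_measurable borel" using w by (auto simp: positive_version_def)
  define K where "K = A1_const s \<omega>"
  \<comment> \<open>N is the number of corner cubes and also bounds the volume ratio of a corner
    cube to the central cube, hence \<open>N * N\<close> below. One K comes from comparing a corner
    cube with the central cube, the other from comparing the central cube with w y.\<close>
  define N where "N = (2 :: ennreal) ^ CARD('n)"
  have N1: "1 \<le> N" unfolding N_def by (rule one_le_power) simp
  have mass: "AE y in lborel. y \<in> cube a l \<longrightarrow>
      cube_mass w a l \<le> (K + N * N * K * K) * ennreal (l ^ CARD('n)) * ennreal (w y)"
    if l: "0 < l" "l \<le> 3 / 2 * s" for a l
  proof (cases "l \<le> s")
    case True
    then show ?thesis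
      using A1_mass_le[OF wt w l(1) True, of a]
      by (elim eventually_mono)
        (auto simp: K_def[symmetric] intro!: mult_right_mono elim!: order_trans)
  next
    case False
    \<comment> \<open>S is the set of coordinates in which the corner cube is pushed to the upper
      end of the given cube.\<close>
    define c where "c S = a + (\<chi> i. if i \<in> S then l - s else 0)" for S :: "'n set"
    define b where "b = a + vec (l - s)"
    let ?P = "\<lambda>S. cube_mass w (c S) s" and ?M = "cube_mass w b (2 * s - l)"
    have sub: "cube b (2 * s - l) \<subseteq> cube (c S) s" for S
      using False l s by (auto simp: cube_def mem_box_cart b_def c_def algebra_simps) (smt (verit))+
    have cover: "\<exists>S. y \<in> cube (c S) s" if "y \<in> cube a l" for y
    proof
      \<comment> \<open>The shifted coordinates are those in which y is at least s above the lower
        face; there y also lies strictly above the shifted face because l < 2 s.\<close>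
      show "y \<in> cube (c {i. a $ i + s \<le> y $ i}) s"
        using that False l s by (auto simp: cube_def mem_box_cart c_def algebra_simps)
    qed
    have AEP: "AE y in lborel. \<forall>S. y \<in> cube (c S) s \<longrightarrow> ?P S \<le> K * ennreal (s ^ CARD('n)) * ennreal (w y)"
      unfolding K_def using A1_mass_le[OF wt w s order_refl] by (simp add: AE_all_countable)
    \<comment> \<open>The A_1 inequality of the corner cube is integrated over the central cube,
      which lies inside every corner cube.\<close>
    have central: "?P S \<le> N * K * ?M" for S
    proof -
      have "AE y in lborel. ?P S * indicator (cube b (2 * s - l)) y
          \<le> K * ennreal (s ^ CARD('n)) * (ennreal (w y) * indicator (cube b (2 * s - l)) y)"
        using AEP by eventually_elim (use sub[of S] in \<open>auto simp: indicator_def\<close>)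
      then have "(\<integral>\<^sup>+y. ?P S * indicator (cube b (2 * s - l)) y \<partial>lborel)
          \<le> (\<integral>\<^sup>+y. K * ennreal (s ^ CARD('n)) * (ennreal (w y) * indicator (cube b (2 * s - l)) y) \<partial>lborel)"
        by (rule nn_integral_mono_AE)
      then have "?P S * ennreal ((2 * s - l) ^ CARD('n)) \<le> K * ennreal (s ^ CARD('n)) * ?M"
        using l s by (simp add: nn_integral_cmult_indicator nn_integral_cmult emeasure_cube cube_mass_def)
      moreover have "?P S * ennreal ((s / 2) ^ CARD('n)) \<le> ?P S * ennreal ((2 * s - l) ^ CARD('n))"
        using l s by (intro mult_left_mono ennreal_leI power_mono) auto
      ultimately have "?P S * ennreal ((s / 2) ^ CARD('n)) \<le> K * ennreal (s ^ CARD('n)) * ?M"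
        by (rule order_trans[rotated])
      then have "?P S * ennreal ((s / 2) ^ CARD('n)) * ennreal ((2 / s) ^ CARD('n))
          \<le> K * ennreal (s ^ CARD('n)) * ?M * ennreal ((2 / s) ^ CARD('n))"
        by (rule mult_right_mono) simp
      also have "\<dots> = (ennreal (s ^ CARD('n)) * ennreal ((2 / s) ^ CARD('n))) * K * ?M" by (simp only: mult_ac)
      also have "ennreal (s ^ CARD('n)) * ennreal ((2 / s) ^ CARD('n)) = ennreal (2 ^ CARD('n))"
        using s by (simp add: power_divide flip: ennreal_mult)
      also have "\<dots> = N" by (simp add: N_def flip: ennreal_power)
      also have "?P S * ennreal ((s / 2) ^ CARD('n)) * ennreal ((2 / s) ^ CARD('n)) = ?P S"
        using s by (simp add: mult.assoc flip: ennreal_mult power_mult_distrib)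
      finally show ?thesis .
    qed
    have "cube_mass w a l \<le> (\<integral>\<^sup>+y. (\<Sum>S\<in>UNIV. ennreal (w y) * indicator (cube (c S) s) y) \<partial>lborel)"
      unfolding cube_mass_def
    proof (rule nn_integral_mono)
      fix y
      show "ennreal (w y) * indicator (cube a l) y \<le> (\<Sum>S\<in>UNIV. ennreal (w y) * indicator (cube (c S) s) y)"
      proof (cases "y \<in> cube a l")
        case True
        then obtain S where "y \<in> cube (c S) s" using cover by blast
        then have "ennreal (w y) * indicator (cube a l) y \<le> ennreal (w y) * indicator (cube (c S) s) y"
          using True by simp
        also have "\<dots> \<le> (\<Sum>S\<in>UNIV. ennreal (w y) * indicator (cube (c S) s) y)"
          by (rule member_le_sum) auto
        finally show ?thesis .
      qed simp
    qed
    also have "\<dots> = (\<Sum>S\<in>UNIV. ?P S)"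
      unfolding cube_mass_def by (subst nn_integral_sum) auto
    also have "\<dots> \<le> (\<Sum>S\<in>(UNIV :: 'n set set). N * K * ?M)" by (intro sum_mono central)
    also have "\<dots> = N * (N * K * ?M)"
      by (simp add: N_def card_UNIV_set flip: Pow_UNIV) (simp add: card_Pow)
    finally have Q: "cube_mass w a l \<le> N * N * K * ?M" by (simp only: mult.assoc)
    show ?thesis
      using AEP
    proof (eventually_elim, intro impI)
      fix y assume y: "\<forall>S. y \<in> cube (c S) s \<longrightarrow> ?P S \<le> K * ennreal (s ^ CARD('n)) * ennreal (w y)"
        and "y \<in> cube a l"
      then obtain S where "y \<in> cube (c S) s" using cover by blast
      then have "?M \<le> K * ennreal (s ^ CARD('n)) * ennreal (w y)"
        using y cube_mass_mono[OF sub] order_trans by blast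
      also have "\<dots> \<le> K * ennreal (l ^ CARD('n)) * ennreal (w y)"
        using False s by (intro mult_right_mono mult_left_mono ennreal_leI power_mono) auto
      finally have "N * N * K * ?M \<le> N * N * K * (K * ennreal (l ^ CARD('n)) * ennreal (w y))"
        by (rule mult_left_mono) simp
      with Q have "cube_mass w a l \<le> (N * N * K * K) * ennreal (l ^ CARD('n)) * ennreal (w y)"
        by (simp add: mult.assoc)
      also have "\<dots> \<le> (K + N * N * K * K) * ennreal (l ^ CARD('n)) * ennreal (w y)"
        by (intro mult_right_mono) auto
      finally show "cube_mass w a l \<le> (K + N * N * K * K) * ennreal (l ^ CARD('n)) * ennreal (w y)" .
    qed
  qed
  have "A1_const (3 / 2 * s) \<omega> \<le> K + N * N * K * K"
    by (rule A1_const_le[OF wt w mass])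
  also have "\<dots> < top" using fin by (auto simp: K_def N_def ennreal_mult_less_top power_less_top_ennreal)
  finally show ?thesis .
qed

lemma A1_const_mono: "R \<le> R' \<Longrightarrow> A1_const R \<omega> \<le> A1_const R' \<omega>"
  unfolding A1_const_def by (rule SUP_subset_mono) auto

text \<open>Membership in \<open>A1_loc\<close> provides a single finite scale; repeated enlargement
  by the factor 3/2 reaches every R. This makes the constant at scale \<open>160 * \<rho>\<close> a
  finite number.\<close>

lemma A1_const_finite:
  assumes "\<omega> \<in> A1_loc" shows "A1_const R \<omega> < top"
proof -
  from assms obtain s where wt: "weight \<omega>" and s: "0 < s" "A1_const s \<omega> < top"
    by (auto simp: A1_loc_def)
  have "A1_const ((3 / 2) ^ m * s) \<omega> < top" for m
  proof (induction m)
    case (Suc m)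
    then show ?case using A1_const_enlarge[OF wt, of "(3 / 2) ^ m * s"] s by (simp add: mult.assoc)
  qed (use s in simp)
  moreover obtain m where "R / s < (3 / 2) ^ m"
    using real_arch_pow[of "3 / 2" "R / s"] by auto
  then have "R \<le> (3 / 2) ^ m * s" using s by (simp add: field_simps)
  ultimately show ?thesis using A1_const_mono order_le_less_trans by blast
qed

section \<open>Vitali covering and sets of large energy density\<close>

text \<open>The centres form an arbitrary set and the radii are merely bounded, so the selection is
  by Zorn's lemma. A maximal family meets every ball: otherwise a missed ball whose radius exceeds
  half the supremum of the missed radii could be added. A ball with s z <= 2 s c that meets the ball
  of c has its centre within s c + s z <= 3 s c of c; only centres have to be covered, hence the
  factor 3 and not 5.\<close>

lemma Vitali_qballs:
  fixes X :: "(real^'n) set" and s :: "real^'n \<Rightarrow> real"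
  assumes s: "\<And>x. x \<in> X \<Longrightarrow> 0 < s x \<and> s x \<le> R"
  shows "\<exists>C\<subseteq>X. countable C \<and> disjoint_family_on (\<lambda>c. qball c (s c)) C \<and>
    (\<forall>z\<in>X. \<exists>c\<in>C. z \<in> qball c (3 * s c))"
proof -
  define B where "B c = qball c (s c)" for c
  \<comment> \<open>The last clause records the size selection: a ball that meets the family meets a
    member of at least half its radius. It concerns only balls already met, so it survives unions of
    chains.\<close>
  define \<A> where "\<A> = {C. C \<subseteq> X \<and> disjoint_family_on B C \<and>
    (\<forall>z\<in>X. (\<exists>c\<in>C. B z \<inter> B c \<noteq> {}) \<longrightarrow> (\<exists>c\<in>C. B z \<inter> B c \<noteq> {} \<and> s z \<le> 2 * s c))}"
  have self: "c \<in> B c" if "c \<in> X" for c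
    using s[OF that] by (simp add: B_def mem_qball_iff)
  have "\<exists>M\<in>\<A>. \<forall>C\<in>\<A>. M \<subseteq> C \<longrightarrow> C = M"
  proof (rule subset_Zorn')
    fix \<C> assume ch: "subset.chain \<A> \<C>"
    then have sub: "\<C> \<subseteq> \<A>" and lin: "\<And>C D. C \<in> \<C> \<Longrightarrow> D \<in> \<C> \<Longrightarrow> C \<subseteq> D \<or> D \<subseteq> C"
      by (auto simp: subset_chain_def)
    have "\<Union>\<C> \<subseteq> X" using sub by (auto simp: \<A>_def)
    moreover have "disjoint_family_on B (\<Union>\<C>)"
      unfolding disjoint_family_on_def
    proof (intro ballI impI)
      fix c d assume "c \<in> \<Union>\<C>" "d \<in> \<Union>\<C>" and cd: "c \<noteq> d"
      then obtain D D' where "D \<in> \<C>" "c \<in> D" "D' \<in> \<C>" "d \<in> D'" by blast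
      then obtain C where "C \<in> \<C>" "c \<in> C" "d \<in> C" using lin[of D D'] by blast
      then show "B c \<inter> B d = {}" using sub cd by (auto simp: \<A>_def disjoint_family_on_def)
    qed
    moreover have "\<exists>c\<in>\<Union>\<C>. B z \<inter> B c \<noteq> {} \<and> s z \<le> 2 * s c"
      if z: "z \<in> X" and c: "c \<in> \<Union>\<C>" "B z \<inter> B c \<noteq> {}" for z c
    proof -
      obtain C where C: "C \<in> \<C>" "c \<in> C" using c by blast
      then have "C \<in> \<A>" using sub by blast
      then have "\<exists>c\<in>C. B z \<inter> B c \<noteq> {} \<and> s z \<le> 2 * s c"
        using z c C unfolding \<A>_def by blast
      then show ?thesis using C by blast
    qed
    ultimately show "\<Union>\<C> \<in> \<A>" unfolding \<A>_def by blast
  qed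
  then obtain C where C: "C \<in> \<A>" and maxi: "\<And>D. D \<in> \<A> \<Longrightarrow> C \<subseteq> D \<Longrightarrow> D = C" by blast
  have CX: "C \<subseteq> X" and dis: "disjoint_family_on B C"
    and large: "\<And>z c. z \<in> X \<Longrightarrow> c \<in> C \<Longrightarrow> B z \<inter> B c \<noteq> {} \<Longrightarrow> \<exists>c\<in>C. B z \<inter> B c \<noteq> {} \<and> s z \<le> 2 * s c"
    using C unfolding \<A>_def by blast+
  have meets: "\<exists>c\<in>C. B z \<inter> B c \<noteq> {}" if "z \<in> X" for z
  proof (rule ccontr)
    define Y where "Y = {z\<in>X. \<forall>c\<in>C. B z \<inter> B c = {}}"
    assume "\<not> (\<exists>c\<in>C. B z \<inter> B c \<noteq> {})"
    then have zY: "z \<in> Y" using that by (auto simp: Y_def)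
    have bdd: "bdd_above (s ` Y)" using s by (intro bdd_aboveI[of _ R]) (auto simp: Y_def)
    have sup: "s y \<le> (SUP x\<in>Y. s x)" if "y \<in> Y" for y using that bdd by (intro cSUP_upper)
    have "0 < s z" using s[OF \<open>z \<in> X\<close>] by simp
    then have "0 < (SUP x\<in>Y. s x)" using sup[OF zY] by linarith
    then have "(SUP x\<in>Y. s x) / 2 < (SUP x\<in>Y. s x)" by simp
    then obtain d where d: "d \<in> Y" "(SUP x\<in>Y. s x) / 2 < s d"
      using less_cSUP_iff[of Y s] bdd zY by blast
    have "insert d C \<in> \<A>"
    proof -
      have "disjoint_family_on B (insert d C)"
        using dis d(1) by (auto simp: disjoint_family_on_def Y_def)
      moreover have "\<exists>c\<in>insert d C. B y \<inter> B c \<noteq> {} \<and> s y \<le> 2 * s c"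
        if y: "y \<in> X" and c: "c \<in> insert d C" "B y \<inter> B c \<noteq> {}" for y c
      proof (cases "y \<in> Y")
        case True
        then have "c = d" using c by (auto simp: Y_def)
        moreover have "s y \<le> 2 * s d" using sup[OF True] d(2) by simp
        ultimately show ?thesis using c by blast
      next
        case False
        then obtain c' where "c' \<in> C" "B y \<inter> B c' \<noteq> {}" using y by (auto simp: Y_def)
        then show ?thesis using large[OF y] by blast
      qed
      moreover have "insert d C \<subseteq> X" using CX d(1) by (auto simp: Y_def)
      ultimately show ?thesis unfolding \<A>_def by blast
    qed
    then have "d \<in> C" using maxi by blast
    then show False using d(1) self by (auto simp: Y_def)
  qed
  have "countable C"
  proof (rule countable_image_inj_on)
    show "countable (B ` C)"
    proof (rule countable_disjoint_open_subsets)
      show "pairwise disjnt (B ` C)"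
      proof (rule pairwiseI)
        fix S T assume "S \<in> B ` C" "T \<in> B ` C" "S \<noteq> T"
        then obtain c d where "c \<in> C" "d \<in> C" "c \<noteq> d" "S = B c" "T = B d" by blast
        then show "disjnt S T" using dis by (simp add: disjnt_def disjoint_family_on_def)
      qed
    qed (auto simp: B_def)
    show "inj_on B C"
    proof (rule inj_onI, rule ccontr)
      fix c d assume "c \<in> C" "d \<in> C" "B c = B d" "c \<noteq> d"
      then have "c \<in> B c \<inter> B d" using self CX by blast
      moreover have "B c \<inter> B d = {}"
        using dis \<open>c \<in> C\<close> \<open>d \<in> C\<close> \<open>c \<noteq> d\<close> by (simp add: disjoint_family_on_def)
      ultimately show False by blast
    qed
  qed
  moreover have "\<exists>c\<in>C. z \<in> qball c (3 * s c)" if z: "z \<in> X" for z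
  proof -
    obtain c y where c: "c \<in> C" "y \<in> B z" "y \<in> B c" "s z \<le> 2 * s c"
      using meets[OF z] large[OF z] by blast
    have "z \<in> qball c (s c + s z)"
      using qball_triangle[of y c "s c" z "s z"] c qball_commute by (auto simp: B_def)
    then have "z \<in> qball c (3 * s c)"
      using c(4) by (simp add: qball_def)
    then show ?thesis using c(1) by blast
  qed
  ultimately show ?thesis using CX dis unfolding B_def by blast
qed

section \<open>Test functions on sets of large energy density\<close>

lemma sets_qball_times [measurable, simp]: "A \<in> sets borel \<Longrightarrow> qball c h \<times> A \<in> sets borel"
  by (rule borel_Times) simp_all

lemma AE_strip_fst:
  assumes "AE y in lborel. P y" shows "AE z in strip \<rho>. P (fst z)"
  unfolding strip_def
proof (subst AE_density)
  show "AE z in lborel. 0 < (case z of (y, t) \<Rightarrow> ennreal (1 / t) * indicator {0<..<\<rho>} t) \<longrightarrow> P (fst z)"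
    using AE_lborel_fst[OF assms] by (rule eventually_mono) simp
qed (simp add: split_beta')

text \<open>On the slab t^(-b) <= (2/r)^b and the integral of dt/t is at most 1, so the left
  integral is at most (2/r)^b M, with M the weight of the cube of side 14 r. By A_1, M is at most
  the constant times (14 r)^n w y for almost every y in that cube; multiplying by u^p and
  integrating over the smaller cube \<open>qball c (2 * r)\<close> brings in \<open>bad\<close>, and
  the powers of r cancel.\<close>

lemma tent_energy_le:
  fixes c :: "real^'n" and w :: "real^'n \<Rightarrow> real"
  assumes wt: "weight \<omega>" and w: "positive_version w \<omega>" and r: "0 < r" "14 * r \<le> R" and b: "0 \<le> b"
    and u[measurable]: "u \<in> borel_measurable borel" and L: "0 \<le> L"
    and bad: "ennreal (L * r powr (real CARD('n) - b))
      \<le> (\<integral>\<^sup>+z. u z powe p * indicator (qball c (2 * r)) (fst z) \<partial>strip \<rho>)"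
  shows "ennreal L * (\<integral>\<^sup>+z. ennreal (snd z powr (- b)) * ennreal (w (fst z)) *
        indicator (qball c (7 * r) \<times> {r / 2<..<r}) z \<partial>strip \<rho>)
    \<le> ennreal (2 powr b * 14 ^ CARD('n)) * A1_const R \<omega> *
      (\<integral>\<^sup>+z. u z powe p * ennreal (w (fst z)) * indicator (qball c (2 * r)) (fst z) \<partial>strip \<rho>)"
proof -
  have [measurable]: "w \<in> borel_measurable borel" and wpos: "\<And>y. 0 < w y"
    using w by (auto simp: positive_version_def)
  define M where "M = cube_mass w (c - vec (7 * r)) (14 * r)"
  have M: "M = (\<integral>\<^sup>+y\<in>qball c (7 * r). ennreal (w y) \<partial>lborel)"
    by (simp add: M_def cube_mass_def qball_eq_cube)
  have powr_le: "ennreal (t powr (- b)) * ennreal (1 / t) \<le> ennreal ((2 / r) powr b * (2 / r))"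
    if t: "r / 2 < t" for t
  proof -
    have "0 < t" using t r by simp
    have "1 / t \<le> 2 / r" using t r by (simp add: field_simps)
    moreover have "t powr (- b) = (1 / t) powr b" using \<open>0 < t\<close> by (simp add: powr_minus_divide powr_divide)
    moreover have "(1 / t) powr b \<le> (2 / r) powr b"
      using calculation(1) \<open>0 < t\<close> b by (intro powr_mono2) auto
    ultimately have "t powr (- b) * (1 / t) \<le> (2 / r) powr b * (2 / r)"
      using \<open>0 < t\<close> by (intro mult_mono) auto
    then show ?thesis using \<open>0 < t\<close> by (simp flip: ennreal_mult add: ennreal_leI)
  qed
  have "(\<integral>\<^sup>+z. ennreal (snd z powr (- b)) * ennreal (w (fst z)) *
        indicator (qball c (7 * r) \<times> {r / 2<..<r}) z \<partial>strip \<rho>)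
      \<le> (\<integral>\<^sup>+t. ennreal ((2 / r) powr b * (2 / r)) * M * indicator {r / 2<..<r} t \<partial>lborel)"
    unfolding M
  proof (subst nn_integral_strip, measurable, intro nn_integral_mono)
    fix t :: real
    have "(\<integral>\<^sup>+y. ennreal (snd (y, t) powr (- b)) * ennreal (w (fst (y, t))) *
        indicator (qball c (7 * r) \<times> {r / 2<..<r}) (y, t) \<partial>lborel)
      = (\<integral>\<^sup>+y. (ennreal (t powr (- b)) * indicator {r / 2<..<r} t) * (ennreal (w y) * indicator (qball c (7 * r)) y) \<partial>lborel)"
      by (intro nn_integral_cong) (auto simp: indicator_def)
    also have "\<dots> = (ennreal (t powr (- b)) * indicator {r / 2<..<r} t) * (\<integral>\<^sup>+y\<in>qball c (7 * r). ennreal (w y) \<partial>lborel)"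
      by (rule nn_integral_cmult) measurable
    finally have eq: "(\<integral>\<^sup>+y. ennreal (snd (y, t) powr (- b)) * ennreal (w (fst (y, t))) *
        indicator (qball c (7 * r) \<times> {r / 2<..<r}) (y, t) \<partial>lborel)
      = (ennreal (t powr (- b)) * indicator {r / 2<..<r} t) * (\<integral>\<^sup>+y\<in>qball c (7 * r). ennreal (w y) \<partial>lborel)" .
    show "(\<integral>\<^sup>+y. ennreal (snd (y, t) powr (- b)) * ennreal (w (fst (y, t))) *
        indicator (qball c (7 * r) \<times> {r / 2<..<r}) (y, t) \<partial>lborel) * ennreal (1 / t) * indicator {0<..<\<rho>} t
      \<le> ennreal ((2 / r) powr b * (2 / r)) * (\<integral>\<^sup>+y\<in>qball c (7 * r). ennreal (w y) \<partial>lborel) * indicator {r / 2<..<r} t"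
      unfolding eq
    proof (cases "t \<in> {r / 2<..<r}")
      case True
      then have "ennreal (t powr (- b)) * (\<integral>\<^sup>+y\<in>qball c (7 * r). ennreal (w y) \<partial>lborel) * ennreal (1 / t) 
        = (ennreal (t powr (- b)) * ennreal (1 / t)) * (\<integral>\<^sup>+y\<in>qball c (7 * r). ennreal (w y) \<partial>lborel)"
        by (simp only: mult_ac)
      also have "\<dots> \<le> ennreal ((2 / r) powr b * (2 / r)) * (\<integral>\<^sup>+y\<in>qball c (7 * r). ennreal (w y) \<partial>lborel)"
        using True by (intro mult_right_mono powr_le) auto
      finally show "(ennreal (t powr (- b)) * indicator {r / 2<..<r} t) * (\<integral>\<^sup>+y\<in>qball c (7 * r). ennreal (w y) \<partial>lborel)
          * ennreal (1 / t) * indicator {0<..<\<rho>} t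
        \<le> ennreal ((2 / r) powr b * (2 / r)) * (\<integral>\<^sup>+y\<in>qball c (7 * r). ennreal (w y) \<partial>lborel) * indicator {r / 2<..<r} t"
        using True by (auto simp: indicator_def)
    qed simp
  qed
  also have "\<dots> = ennreal ((2 / r) powr b * (2 / r)) * M * ennreal (r - r / 2)"
    using r by (subst nn_integral_cmult_indicator) auto
  also have "\<dots> = ennreal ((2 / r) powr b * (2 / r) * (r - r / 2)) * M"
    using r by (subst (2) ennreal_mult) (auto simp: mult_ac)
  also have "(2 / r) powr b * (2 / r) * (r - r / 2) = (2 / r) powr b"
    using r by (simp add: field_simps)
  finally have T: "(\<integral>\<^sup>+z. ennreal (snd z powr (- b)) * ennreal (w (fst z)) *
        indicator (qball c (7 * r) \<times> {r / 2<..<r}) z \<partial>strip \<rho>) \<le> ennreal ((2 / r) powr b) * M" .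

  have "AE y in lborel. y \<in> qball c (7 * r) \<longrightarrow> M \<le> A1_const R \<omega> * ennreal ((14 * r) ^ CARD('n)) * ennreal (w y)"
    using A1_mass_le[OF wt w, of "14 * r" R "c - vec (7 * r)"] r by (simp add: M_def qball_eq_cube)
  then have "AE z in strip \<rho>. fst z \<in> qball c (7 * r) \<longrightarrow>
      M \<le> A1_const R \<omega> * ennreal ((14 * r) ^ CARD('n)) * ennreal (w (fst z))"
    by (rule AE_strip_fst)
  then have "AE z in strip \<rho>. M * (u z powe p * indicator (qball c (2 * r)) (fst z))
      \<le> A1_const R \<omega> * ennreal ((14 * r) ^ CARD('n)) *
        (u z powe p * ennreal (w (fst z)) * indicator (qball c (2 * r)) (fst z))"
  proof (rule eventually_mono)
    fix z :: "(real^'n) \<times> real"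
    assume *: "fst z \<in> qball c (7 * r) \<longrightarrow> M \<le> A1_const R \<omega> * ennreal ((14 * r) ^ CARD('n)) * ennreal (w (fst z))"
    show "M * (u z powe p * indicator (qball c (2 * r)) (fst z))
      \<le> A1_const R \<omega> * ennreal ((14 * r) ^ CARD('n)) *
        (u z powe p * ennreal (w (fst z)) * indicator (qball c (2 * r)) (fst z))"
    proof (cases "fst z \<in> qball c (2 * r)")
      case True
      then have "fst z \<in> qball c (7 * r)" using r by (auto simp: qball_def)
      then have "M * u z powe p \<le> (A1_const R \<omega> * ennreal ((14 * r) ^ CARD('n)) * ennreal (w (fst z))) * u z powe p"
        using * by (intro mult_right_mono) auto
      then show ?thesis using True by (simp add: mult_ac)
    qed simp
  qed
  then have "(\<integral>\<^sup>+z. M * (u z powe p * indicator (qball c (2 * r)) (fst z)) \<partial>strip \<rho>)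
      \<le> (\<integral>\<^sup>+z. A1_const R \<omega> * ennreal ((14 * r) ^ CARD('n)) *
        (u z powe p * ennreal (w (fst z)) * indicator (qball c (2 * r)) (fst z)) \<partial>strip \<rho>)"
    by (rule nn_integral_mono_AE)
  then have A: "M * (\<integral>\<^sup>+z. u z powe p * indicator (qball c (2 * r)) (fst z) \<partial>strip \<rho>)
    \<le> A1_const R \<omega> * ennreal ((14 * r) ^ CARD('n)) *
      (\<integral>\<^sup>+z. u z powe p * ennreal (w (fst z)) * indicator (qball c (2 * r)) (fst z) \<partial>strip \<rho>)"
    by (simp add: nn_integral_cmult)
  define J where "J = (\<integral>\<^sup>+z. u z powe p * ennreal (w (fst z)) * indicator (qball c (2 * r)) (fst z) \<partial>strip \<rho>)"
  have "L * (2 / r) powr b = (2 powr b * r powr (- real CARD('n))) * (L * r powr (real CARD('n) - b))"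
    using r by (simp add: powr_divide powr_diff powr_minus field_simps)
  then have e: "ennreal L * ennreal ((2 / r) powr b)
      = ennreal (2 powr b * r powr (- real CARD('n))) * ennreal (L * r powr (real CARD('n) - b))"
    using L by (simp only: ennreal_mult[symmetric] powr_ge_zero mult_nonneg_nonneg zero_le_numeral)
  have "ennreal L * (ennreal ((2 / r) powr b) * M) = (ennreal L * ennreal ((2 / r) powr b)) * M"
    by (simp only: mult.assoc)
  also have "\<dots> = ennreal (2 powr b * r powr (- real CARD('n))) * (M * ennreal (L * r powr (real CARD('n) - b)))"
    unfolding e by (simp only: mult_ac)
  also have "\<dots> \<le> ennreal (2 powr b * r powr (- real CARD('n))) * (A1_const R \<omega> * ennreal ((14 * r) ^ CARD('n)) * J)"
    unfolding J_def by (intro mult_left_mono order_trans[OF _ A] mult_left_mono bad) auto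
  also have "\<dots> = (ennreal (2 powr b * r powr (- real CARD('n))) * ennreal ((14 * r) ^ CARD('n))) * A1_const R \<omega> * J"
    by (simp only: mult_ac)
  also have "ennreal (2 powr b * r powr (- real CARD('n))) * ennreal ((14 * r) ^ CARD('n)) = ennreal (2 powr b * 14 ^ CARD('n))"
    using r by (simp add: powr_minus powr_realpow power_mult_distrib flip: ennreal_mult)
  finally have "ennreal L * (ennreal ((2 / r) powr b) * M) \<le> ennreal (2 powr b * 14 ^ CARD('n)) * A1_const R \<omega> * J" .
  then show ?thesis unfolding J_def using T by (meson mult_left_mono order_trans zero_le)
qed

text \<open>The function t^(-\<alpha>) on a union of slabs cancels the factor t^\<alpha> of the
  kernel: at a covered point the potential is at least the integral of 2^n dt/t over (r/2, r), hence
  at least 2^n / 2 >= 1. The energies of the slabs are bounded one by one by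
  \<open>tent_energy_le\<close>, and the bounds add up to a multiple of the energy of u because the
  cubes \<open>qball c (2 * r c)\<close> are disjoint.\<close>

lemma Vitali_test_function:
  fixes w :: "real^'n \<Rightarrow> real" and X :: "(real^'n) set"
  assumes \<alpha>: "0 < \<alpha>" and p: "1 < p" and wt: "weight \<omega>" and w: "positive_version w \<omega>"
    and R: "14 * \<rho> \<le> R" and u[measurable]: "u \<in> borel_measurable borel" and L: "0 \<le> L"
    and bad: "\<And>x. x \<in> X \<Longrightarrow> \<exists>r. 0 < r \<and> r \<le> \<rho> \<and> ennreal (L * r powr (real CARD('n) - \<alpha> * p))
      \<le> (\<integral>\<^sup>+z. u z powe p * indicator (qball x (2 * r)) (fst z) \<partial>strip \<rho>)"
  shows "\<exists>v\<in>borel_measurable borel. (\<forall>x\<in>X. 1 \<le> pot \<alpha> \<rho> v x) \<and>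
    ennreal L * energy p \<rho> w v \<le> ennreal (2 powr (\<alpha> * p) * 14 ^ CARD('n)) * A1_const R \<omega> * energy p \<rho> w u"
proof -
  have [measurable]: "w \<in> borel_measurable borel" using w by (auto simp: positive_version_def)
  have "\<forall>x\<in>X. \<exists>r. 0 < r \<and> r \<le> \<rho> \<and> ennreal (L * r powr (real CARD('n) - \<alpha> * p))
      \<le> (\<integral>\<^sup>+z. u z powe p * indicator (qball x (2 * r)) (fst z) \<partial>strip \<rho>)"
    using bad by blast
  from bchoice[OF this] obtain r where r: "\<And>x. x \<in> X \<Longrightarrow> 0 < r x \<and> r x \<le> \<rho>"
    and badr: "\<And>x. x \<in> X \<Longrightarrow> ennreal (L * r x powr (real CARD('n) - \<alpha> * p))
      \<le> (\<integral>\<^sup>+z. u z powe p * indicator (qball x (2 * r x)) (fst z) \<partial>strip \<rho>)"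
    by blast
  \<comment> \<open>The cubes to be made disjoint are those that carry the energy in
    \<open>bad\<close>, hence the radii 2 r.\<close>
  obtain C where C: "C \<subseteq> X" "countable C" and dis: "disjoint_family_on (\<lambda>c. qball c (2 * r c)) C"
    and cov: "\<And>z. z \<in> X \<Longrightarrow> \<exists>c\<in>C. z \<in> qball c (3 * (2 * r c))"
    using Vitali_qballs[of X "\<lambda>x. 2 * r x" "2 * \<rho>"] r by auto
  \<comment> \<open>7 = 6 + 1: covered points lie within 6 r of c, and below height r the cone over
    such a point extends by less than r.\<close>
  define U where "U c = qball c (7 * r c) \<times> {r c / 2<..<r c}" for c
  define v where "v z = ennreal (snd z powr (- \<alpha>)) * indicator (\<Union>c\<in>C. U c) z" for z
  have [measurable]: "U c \<in> sets borel" for c by (simp add: U_def)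
  have [measurable]: "(\<Union>c\<in>C. U c) \<in> sets borel" using C(2) by (intro sets.countable_UN') auto
  have v: "v \<in> borel_measurable borel" unfolding v_def by measurable
  have pot1: "1 \<le> pot \<alpha> \<rho> v x" if x: "x \<in> X" for x
  proof -
    obtain c where c: "c \<in> C" "x \<in> qball c (6 * r c)" using cov[OF x] by auto
    then have rc: "0 < r c" "r c \<le> \<rho>" using r C by auto
    have "1 \<le> ennreal (2 ^ CARD('n) / 2)"
      using power_increasing[of 1 "CARD('n)" "2 :: real"] by (simp flip: ennreal_1 add: ennreal_leI)
    also have "2 ^ CARD('n) / 2 = 2 ^ CARD('n) * (1 / r c) * (r c - r c / 2)" using rc by simp
    also have "ennreal (2 ^ CARD('n) * (1 / r c) * (r c - r c / 2))
        = (\<integral>\<^sup>+t. ennreal (2 ^ CARD('n) * (1 / r c)) * indicator {r c / 2<..<r c} t \<partial>lborel)"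
      using rc by (subst nn_integral_cmult_indicator) (auto simp flip: ennreal_mult)
    also have "\<dots> \<le> (\<integral>\<^sup>+t\<in>{0<..<\<rho>}. ennreal ((2 * 1) ^ CARD('n) * t powr (- real CARD('n) + real CARD('n) - 1))
        * indicator {r c / 2<..<r c} t \<partial>lborel)"
    proof (rule nn_integral_mono)
      fix t
      show "ennreal (2 ^ CARD('n) * (1 / r c)) * indicator {r c / 2<..<r c} t
        \<le> ennreal ((2 * 1) ^ CARD('n) * t powr (- real CARD('n) + real CARD('n) - 1))
          * indicator {r c / 2<..<r c} t * indicator {0<..<\<rho>} t"
      proof (cases "t \<in> {r c / 2<..<r c}")
        case True
        then have t: "0 < t" "t < \<rho>" "1 / r c \<le> 1 / t" using rc by (auto simp: field_simps)
        then have "(2 :: real) ^ CARD('n) * (1 / r c) \<le> 2 ^ CARD('n) * (1 / t)"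
          by (intro mult_left_mono) auto
        then show ?thesis using True t by (simp add: powr_minus_divide ennreal_leI)
      qed simp
    qed
    also have "\<dots> = (\<integral>\<^sup>+z. ennreal (snd z powr (- real CARD('n))) * indicator (tent 1 x) z *
        indicator {r c / 2<..<r c} (snd z) \<partial>strip \<rho>)"
      by (rule nn_integral_tent[symmetric]) auto
    also have "\<dots> \<le> pot \<alpha> \<rho> v x"
      unfolding pot_def
    proof (rule nn_integral_mono)
      fix z :: "(real^'n) \<times> real"
      show "ennreal (snd z powr (- real CARD('n))) * indicator (tent 1 x) z * indicator {r c / 2<..<r c} (snd z)
        \<le> ennreal (snd z powr (\<alpha> - real CARD('n))) * v z * indicator (tent 1 x) z"
      proof (cases "z \<in> tent 1 x \<and> snd z \<in> {r c / 2<..<r c}")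
        case True
        then have "fst z \<in> qball x (r c)" by (auto simp: tent_def qball_def)
        then have "fst z \<in> qball c (7 * r c)" using qball_triangle[OF c(2)] by fastforce
        then have "z \<in> U c" using True by (cases z) (auto simp: U_def)
        then have "v z = ennreal (snd z powr (- \<alpha>))" using c by (auto simp: v_def indicator_def)
        moreover have "snd z powr (\<alpha> - real CARD('n)) * snd z powr (- \<alpha>) = snd z powr (- real CARD('n))"
          by (simp flip: powr_add)
        ultimately show ?thesis using True by (simp flip: ennreal_mult)
      qed (auto simp: indicator_def)
    qed
    finally show ?thesis .
  qed
  define J where "J c = (\<integral>\<^sup>+z. u z powe p * ennreal (w (fst z)) * indicator (qball c (2 * r c)) (fst z) \<partial>strip \<rho>)" for c
  define A where "A = ennreal (2 powr (\<alpha> * p) * 14 ^ CARD('n)) * A1_const R \<omega>"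
  \<comment> \<open>Slabs may overlap, but v takes the same value t^(-\<alpha>) on all of them, so
    its energy is at most the sum. The sum over the countable set C is written as an integral for
    the counting measure, ready to be exchanged with the integral over the strip.\<close>
  have "energy p \<rho> w v \<le> (\<integral>\<^sup>+z. (\<integral>\<^sup>+c. ennreal (snd z powr (- (\<alpha> * p))) * ennreal (w (fst z)) * indicator (U c) z \<partial>count_space C) \<partial>strip \<rho>)"
    unfolding energy_def
  proof (rule nn_integral_mono)
    fix z :: "(real^'n) \<times> real"
    show "v z powe p * ennreal (w (fst z))
      \<le> (\<integral>\<^sup>+c. ennreal (snd z powr (- (\<alpha> * p))) * ennreal (w (fst z)) * indicator (U c) z \<partial>count_space C)"
    proof (cases "z \<in> (\<Union>c\<in>C. U c)")
      case True
      then obtain c where c: "c \<in> C" "z \<in> U c" by blast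
      have "v z powe p * ennreal (w (fst z)) = ennreal (snd z powr (- (\<alpha> * p))) * ennreal (w (fst z)) * indicator (U c) z"
        using True c by (simp add: v_def powe_ennreal powr_powr)
      also have "\<dots> \<le> (\<integral>\<^sup>+c. ennreal (snd z powr (- (\<alpha> * p))) * ennreal (w (fst z)) * indicator (U c) z \<partial>count_space C)"
        by (rule nn_integral_ge_point[OF c(1)])
      finally show ?thesis .
    qed (simp add: v_def)
  qed
  also have "\<dots> = (\<integral>\<^sup>+c. (\<integral>\<^sup>+z. ennreal (snd z powr (- (\<alpha> * p))) * ennreal (w (fst z)) * indicator (U c) z \<partial>strip \<rho>) \<partial>count_space C)"
    by (rule nn_integral_count_space_nn_integral[OF C(2)]) measurable
  finally have "ennreal L * energy p \<rho> w v
     \<le> ennreal L * (\<integral>\<^sup>+c. (\<integral>\<^sup>+z. ennreal (snd z powr (- (\<alpha> * p))) * ennreal (w (fst z)) * indicator (U c) z \<partial>strip \<rho>) \<partial>count_space C)"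
    by (rule mult_left_mono) simp
  also have "\<dots> = (\<integral>\<^sup>+c. ennreal L * (\<integral>\<^sup>+z. ennreal (snd z powr (- (\<alpha> * p))) * ennreal (w (fst z)) * indicator (U c) z \<partial>strip \<rho>) \<partial>count_space C)"
    by (rule nn_integral_cmult[symmetric]) simp
  also have "\<dots> \<le> (\<integral>\<^sup>+c. A * J c \<partial>count_space C)"
  proof (rule nn_integral_mono)
    fix c assume "c \<in> space (count_space C)"
    then have c: "c \<in> X" using C by auto
    show "ennreal L * (\<integral>\<^sup>+z. ennreal (snd z powr (- (\<alpha> * p))) * ennreal (w (fst z)) * indicator (U c) z \<partial>strip \<rho>) \<le> A * J c"
      unfolding U_def A_def J_def
      by (rule tent_energy_le[OF wt w _ _ _ u L badr[OF c]]) (use r[OF c] R \<alpha> p in auto)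
  qed
  also have "\<dots> = A * (\<integral>\<^sup>+c. J c \<partial>count_space C)"
    by (rule nn_integral_cmult) simp
  also have "(\<integral>\<^sup>+c. J c \<partial>count_space C)
      = (\<integral>\<^sup>+z. (\<integral>\<^sup>+c. u z powe p * ennreal (w (fst z)) * indicator (qball c (2 * r c)) (fst z) \<partial>count_space C) \<partial>strip \<rho>)"
    unfolding J_def by (rule nn_integral_count_space_nn_integral[OF C(2), symmetric]) measurable
  also have "\<dots> \<le> energy p \<rho> w u"
    unfolding energy_def
  proof (rule nn_integral_mono)
    fix z :: "(real^'n) \<times> real"
    have "(\<integral>\<^sup>+c. indicator (qball c (2 * r c)) (fst z) \<partial>count_space C) \<le> (1 :: ennreal)"
    proof (cases "\<exists>c\<in>C. fst z \<in> qball c (2 * r c)")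
      case True
      then obtain c where c: "c \<in> C" "fst z \<in> qball c (2 * r c)" by blast
      have "(\<integral>\<^sup>+d. indicator (qball d (2 * r d)) (fst z) \<partial>count_space C) = (\<integral>\<^sup>+d. indicator {c} d \<partial>count_space C)"
        using dis c by (intro nn_integral_cong) (auto simp: indicator_def disjoint_family_on_def)
      also have "\<dots> = (1 :: ennreal)" using c by (subst nn_integral_indicator) auto
      finally show ?thesis by simp
    next
      case False
      then have "(\<integral>\<^sup>+c. indicator (qball c (2 * r c)) (fst z) \<partial>count_space C) = (\<integral>\<^sup>+c. 0 \<partial>count_space C :: ennreal)"
        by (intro nn_integral_cong) auto
      then show ?thesis by simp
    qed
    then have "u z powe p * ennreal (w (fst z)) * (\<integral>\<^sup>+c. indicator (qball c (2 * r c)) (fst z) \<partial>count_space C)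
        \<le> u z powe p * ennreal (w (fst z)) * 1"
      by (rule mult_left_mono) simp
    then show "(\<integral>\<^sup>+c. u z powe p * ennreal (w (fst z)) * indicator (qball c (2 * r c)) (fst z) \<partial>count_space C)
        \<le> u z powe p * ennreal (w (fst z))"
      by (subst nn_integral_cmult) auto
  qed
  finally have "ennreal L * energy p \<rho> w v \<le> A * energy p \<rho> w u" by (simp add: mult_left_mono)
  then show ?thesis using v pot1 unfolding A_def by blast
qed

section \<open>Domination by a single potential\<close>

lemma pot_cmult:
  "u \<in> borel_measurable borel \<Longrightarrow> pot \<alpha> \<rho> (\<lambda>z. c * u z) x = c * pot \<alpha> \<rho> u x"
  unfolding pot_def by (subst nn_integral_cmult[symmetric]) (auto simp: mult_ac)

lemma pot_mono: "(\<And>z. u z \<le> v z) \<Longrightarrow> pot \<alpha> \<rho> u x \<le> pot \<alpha> \<rho> v x"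
  unfolding pot_def by (intro nn_integral_mono mult_right_mono mult_left_mono) auto

lemma energy_cmult:
  assumes "u \<in> borel_measurable borel" "positive_version w \<omega>"
  shows "energy p \<rho> w (\<lambda>z. c * u z) = c powe p * energy p \<rho> w u"
  unfolding energy_def using assms
  by (subst nn_integral_cmult[symmetric]) (auto simp: powe_mult mult_ac positive_version_def)

lemma nn_integral_strip_restrict:
  fixes f :: "(real^'n) \<times> real \<Rightarrow> ennreal"
  assumes [measurable]: "f \<in> borel_measurable borel" and "\<rho>' \<le> \<rho>"
  shows "(\<integral>\<^sup>+z. f z \<partial>strip \<rho>') = (\<integral>\<^sup>+z. f z * indicator {..<\<rho>'} (snd z) \<partial>strip \<rho>)"
proof -
  have "(\<integral>\<^sup>+y. f (y, t) * indicator {..<\<rho>'} t \<partial>lborel) = (\<integral>\<^sup>+y. f (y, t) \<partial>lborel) * indicator {..<\<rho>'} t" for t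
    by (cases "t < \<rho>'") auto
  then show ?thesis
    using assms(2) by (simp add: nn_integral_strip, intro nn_integral_cong) (auto simp: indicator_def)
qed

lemma nn_integral_strip_mono:
  fixes f :: "(real^'n) \<times> real \<Rightarrow> ennreal"
  assumes "f \<in> borel_measurable borel" and "\<rho>' \<le> \<rho>"
  shows "(\<integral>\<^sup>+z. f z \<partial>strip \<rho>') \<le> (\<integral>\<^sup>+z. f z \<partial>strip \<rho>)"
  unfolding nn_integral_strip_restrict[OF assms] by (intro nn_integral_mono) (auto simp: indicator_def)

text \<open>dt/t is invariant under dilations, so replacing t by 2 t only halves the height of the
  strip.\<close>

lemma nn_integral_strip_scale:
  fixes f :: "(real^'n) \<times> real \<Rightarrow> ennreal"
  assumes [measurable]: "f \<in> borel_measurable borel"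
  shows "(\<integral>\<^sup>+z. f z \<partial>strip \<rho>) = (\<integral>\<^sup>+z. f (fst z, 2 * snd z) \<partial>strip (\<rho> / 2))"
proof -
  have [measurable]: "f \<in> borel_measurable (borel \<Otimes>\<^sub>M borel)"
    by (subst borel_prod) measurable
  have 1: "(\<lambda>t. (\<integral>\<^sup>+y. f (y, t) \<partial>lborel) * ennreal (1 / t) * indicator {0<..<\<rho>} t) \<in> borel_measurable borel"
    by measurable
  have "(\<integral>\<^sup>+z. f z \<partial>strip \<rho>) = (\<integral>\<^sup>+t. (\<integral>\<^sup>+y. f (y, t) \<partial>lborel) * ennreal (1 / t) * indicator {0<..<\<rho>} t \<partial>lborel)"
    by (rule nn_integral_strip) measurable
  also have "\<dots> = ennreal 2 * (\<integral>\<^sup>+t. (\<integral>\<^sup>+y. f (y, 2 * t) \<partial>lborel) * ennreal (1 / (2 * t)) * indicator {0<..<\<rho>} (2 * t) \<partial>lborel)"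
    using nn_integral_real_affine[OF 1, of 2 0] by simp
  also have "\<dots> = (\<integral>\<^sup>+t. ennreal 2 * ((\<integral>\<^sup>+y. f (y, 2 * t) \<partial>lborel) * ennreal (1 / (2 * t)) * indicator {0<..<\<rho>} (2 * t)) \<partial>lborel)"
    by (rule nn_integral_cmult[symmetric]) measurable
  also have "\<dots> = (\<integral>\<^sup>+t. (\<integral>\<^sup>+y. f (y, 2 * t) \<partial>lborel) * ennreal (1 / t) * indicator {0<..<\<rho> / 2} t \<partial>lborel)"
  proof (rule nn_integral_cong)
    fix t :: real
    show "ennreal 2 * ((\<integral>\<^sup>+y. f (y, 2 * t) \<partial>lborel) * ennreal (1 / (2 * t)) * indicator {0<..<\<rho>} (2 * t))
        = (\<integral>\<^sup>+y. f (y, 2 * t) \<partial>lborel) * ennreal (1 / t) * indicator {0<..<\<rho> / 2} t"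
    proof (cases "t \<in> {0<..<\<rho> / 2}")
      case True
      then have "ennreal 2 * ennreal (1 / (2 * t)) = ennreal (1 / t)"
        by (subst ennreal_mult[symmetric]) auto
      then have "ennreal 2 * ((\<integral>\<^sup>+y. f (y, 2 * t) \<partial>lborel) * ennreal (1 / (2 * t)))
          = (\<integral>\<^sup>+y. f (y, 2 * t) \<partial>lborel) * ennreal (1 / t)"
        by (subst mult.left_commute) (simp only:)
      then show ?thesis using True by simp
    qed auto
  qed
  also have "\<dots> = (\<integral>\<^sup>+z. f (fst z, 2 * snd z) \<partial>strip (\<rho> / 2))"
    by (subst nn_integral_strip) auto
  finally show ?thesis .
qed

text \<open>u = (u1^p + u2^p)^(1/p) dominates both functions, and its p-th power makes the energies
  add up exactly.\<close>

lemma test_function_Un: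
  fixes w :: "real^'n \<Rightarrow> real"
  assumes p: "1 < p" and w: "positive_version w \<omega>"
    and [measurable]: "u1 \<in> borel_measurable borel" "u2 \<in> borel_measurable borel"
    and E: "\<And>x. x \<in> E1 \<Longrightarrow> 1 \<le> pot \<alpha> \<rho> u1 x" "\<And>x. x \<in> E2 \<Longrightarrow> 1 \<le> pot \<alpha> \<rho> u2 x"
  shows "capacity \<alpha> p \<rho> \<omega> (E1 \<union> E2) \<le> energy p \<rho> w u1 + energy p \<rho> w u2"
proof -
  have [measurable]: "w \<in> borel_measurable borel" using w by (auto simp: positive_version_def)
  define u where "u z = (u1 z powe p + u2 z powe p) powe (1 / p)" for z
  have u: "u \<in> borel_measurable borel" unfolding u_def by measurable
  have root: "(a powe p) powe (1 / p) = a" for a using p by (simp add: powe_powe)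
  have "u1 z \<le> u z" "u2 z \<le> u z" for z
    using p powe_mono[of "u1 z powe p" "u1 z powe p + u2 z powe p" "1 / p"]
      powe_mono[of "u2 z powe p" "u1 z powe p + u2 z powe p" "1 / p"]
    by (simp_all add: u_def root)
  then have "1 \<le> pot \<alpha> \<rho> u x" if "x \<in> E1 \<union> E2" for x
    using that E pot_mono order_trans by (metis UnE)
  then have "capacity \<alpha> p \<rho> \<omega> (E1 \<union> E2) \<le> energy p \<rho> w u"
    by (rule capacity_le_energy[OF p w u])
  also have "\<dots> = (\<integral>\<^sup>+z. u1 z powe p * ennreal (w (fst z)) + u2 z powe p * ennreal (w (fst z)) \<partial>strip \<rho>)"
    unfolding energy_def using p by (simp add: u_def powe_powe distrib_right)
  also have "\<dots> = energy p \<rho> w u1 + energy p \<rho> w u2"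
    unfolding energy_def by (rule nn_integral_add) measurable
  finally show ?thesis .
qed

text \<open>For P = a > 0 the power with 2^k <= 2 a < 2^(k+1) satisfies a < 2^k <= 2 P < F; for P =
  0 any small power will do. The strict lower inequality is split into \<open>\<le>\<close> and
  \<open>\<noteq>\<close>, the form in which \<open>dyadic_domination\<close> contradicts it by
  antisymmetry.\<close>

lemma exists_dyadic_between:
  fixes P F :: ennreal
  assumes "2 * P < F"
  shows "\<exists>k :: int. P \<le> ennreal (2 powr real_of_int k) \<and> ennreal (2 powr real_of_int k) < F \<and> P \<noteq> ennreal (2 powr real_of_int k)"
proof -
  have "P \<noteq> top" using assms by auto
  then obtain a where a: "P = ennreal a" "0 \<le> a" by (cases P) auto
  have dy: "\<exists>k :: int. 2 powr real_of_int k \<le> y \<and> y < 2 * 2 powr real_of_int k" if "0 < y" for y :: real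
  proof (intro exI conjI)
    have y: "y = 2 powr log 2 y" using that by simp
    show "2 powr real_of_int \<lfloor>log 2 y\<rfloor> \<le> y"
      by (subst (2) y) (intro powr_mono, auto)
    have "y < 2 powr (1 + real_of_int \<lfloor>log 2 y\<rfloor>)"
      by (subst y) (intro powr_less_mono, linarith, simp)
    then show "y < 2 * 2 powr real_of_int \<lfloor>log 2 y\<rfloor>" by (simp add: powr_add)
  qed
  show ?thesis
  proof (cases "a = 0")
    case True
    then have "0 < F" using assms a by simp
    then obtain y where y: "0 < y" "ennreal y < F"
      using dense[of 0 F] by (metis ennreal_cases ennreal_less_zero_iff ennreal_neq_top less_top not_less_iff_gr_or_eq order.strict_trans2 top_greatest)
    obtain k :: int where "2 powr real_of_int k \<le> y" using dy[OF y(1)] by blast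
    then have "ennreal (2 powr real_of_int k) < F" using y(2) by (meson ennreal_leI order_le_less_trans)
    then show ?thesis using True a by (intro exI[of _ k]) (auto simp: ennreal_eq_0_iff)
  next
    case False
    then have "0 < 2 * a" using a by simp
    from dy[OF this] obtain k :: int where k: "2 powr real_of_int k \<le> 2 * a" "a < 2 powr real_of_int k" by auto
    have "ennreal (2 powr real_of_int k) \<le> 2 * P"
      using k(1) a by (auto simp: ennreal_mult intro: ennreal_leI order_trans)
    then have "ennreal (2 powr real_of_int k) < F" using assms by simp
    then show ?thesis using k(2) a by (intro exI[of _ k]) (auto intro: ennreal_leI)
  qed
qed

lemma capacity_mono: "E \<subseteq> F \<Longrightarrow> capacity \<alpha> p \<rho> \<omega> E \<le> capacity \<alpha> p \<rho> \<omega> F"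
  unfolding capacity_def by (rule INF_superset_mono[OF _ order_refl]) (unfold admissible_def, blast)

text \<open>Applied with F = |f|^q, so that N is the Choquet integral. The \<open>v m\<close> are
  nearly optimal for the sets where F exceeds the dyadic level \<open>b m\<close>, and u^p is the
  sum of b m * (v m)^p. Thus (pot u)^p is at least every dyadic level below F x, hence at least F x
  / 2. In the energy, b m times the capacity of \<open>E m\<close> is at most twice the integral of
  the capacities over (b m / 2, b m], by monotonicity; these intervals are disjoint, whence 2
  N.\<close>

lemma dyadic_domination:
  fixes w :: "real^'n \<Rightarrow> real" and F :: "real^'n \<Rightarrow> ennreal"
  assumes p: "1 < p" and w: "positive_version w \<omega>" and e: "0 < e"
    and N: "N = (\<integral>\<^sup>+t\<in>{0<..}. capacity \<alpha> p \<rho> \<omega> {x. F x > ennreal t} \<partial>lebesgue)" and fin: "N \<noteq> top"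
  shows "\<exists>u\<in>borel_measurable borel. (\<forall>x. F x \<le> 2 * pot \<alpha> \<rho> u x powe p) \<and> energy p \<rho> w u \<le> 2 * N + ennreal e"
proof -
  have [measurable]: "w \<in> borel_measurable borel" using w by (auto simp: positive_version_def)
  \<comment> \<open>All integer powers of 2, listed along the natural numbers so that they can be
    summed as a series.\<close>
  define b where "b m = 2 powr real_of_int (int_decode m)" for m :: nat
  define E where "E m = {x. F x > ennreal (b m)}" for m
  define I where "I m = {b m / 2<..b m}" for m
  have b: "0 < b m" for m by (simp add: b_def)
  have disj: "disjoint_family I"
    unfolding disjoint_family_on_def
  proof (intro ballI impI)
    fix m k :: nat assume "m \<noteq> k"
    have *: "I m' \<inter> I k' = {}" if "int_decode m' < int_decode k'" for m' k'
    proof -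
      have "b m' \<le> b k' / 2"
      proof -
        have "b m' \<le> 2 powr (real_of_int (int_decode k') - 1)"
          unfolding b_def using that by (intro powr_mono) auto
        then show ?thesis by (simp add: b_def powr_diff)
      qed
      then show ?thesis by (auto simp: I_def)
    qed
    have "int_decode m \<noteq> int_decode k" using \<open>m \<noteq> k\<close> by (simp add: inj_int_decode[THEN inj_eq])
    then show "I m \<inter> I k = {}" using *[of m k] *[of k m] by fastforce
  qed
  have "(\<Sum>m. capacity \<alpha> p \<rho> \<omega> (E m) * ennreal (b m / 2)) = (\<Sum>m. \<integral>\<^sup>+t. capacity \<alpha> p \<rho> \<omega> (E m) * indicator (I m) t \<partial>lborel)"
    using b by (intro suminf_cong, subst nn_integral_cmult_indicator) (auto simp: I_def less_imp_le)
  also have "\<dots> = (\<integral>\<^sup>+t. (\<Sum>m. capacity \<alpha> p \<rho> \<omega> (E m) * indicator (I m) t) \<partial>lborel)"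
    by (rule nn_integral_suminf[symmetric]) (auto simp: I_def)
  also have "\<dots> \<le> N"
    unfolding N nn_integral_completion
  proof (rule nn_integral_mono)
    fix t :: real
    show "(\<Sum>m. capacity \<alpha> p \<rho> \<omega> (E m) * indicator (I m) t) \<le> capacity \<alpha> p \<rho> \<omega> {x. F x > ennreal t} * indicator {0<..} t"
    proof (cases "\<exists>m. t \<in> I m")
      case True
      then obtain m where m: "t \<in> I m" by blast
      then have t: "0 < t" "t \<le> b m" using b[of m] by (auto simp: I_def intro: order.strict_trans[of 0 "b m / 2"])
      have "(\<Sum>m. capacity \<alpha> p \<rho> \<omega> (E m) * indicator (I m) t) = capacity \<alpha> p \<rho> \<omega> (E m)"
        by (rule suminf_cmult_indicator[OF disj m])
      also have "\<dots> \<le> capacity \<alpha> p \<rho> \<omega> {x. F x > ennreal t}"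
        using t by (intro capacity_mono) (auto simp: E_def intro: order.strict_trans1[OF ennreal_leI])
      finally show ?thesis using t by simp
    next
      case False
      then show ?thesis by simp
    qed
  qed
  finally have sumN: "(\<Sum>m. capacity \<alpha> p \<rho> \<omega> (E m) * ennreal (b m / 2)) \<le> N" .
  \<comment> \<open>Finiteness makes the capacity plus \<open>d m\<close> strictly larger than the
    capacity, so that \<open>capacity_lessD\<close> yields a near-optimal test function.\<close>
  have capfin: "capacity \<alpha> p \<rho> \<omega> (E m) \<noteq> top" for m
  proof
    assume "capacity \<alpha> p \<rho> \<omega> (E m) = top"
    then have "top = capacity \<alpha> p \<rho> \<omega> (E m) * ennreal (b m / 2)"
      using b[of m] by (simp add: ennreal_top_mult ennreal_eq_0_iff)
    also have "\<dots> \<le> (\<Sum>m. capacity \<alpha> p \<rho> \<omega> (E m) * ennreal (b m / 2))"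
      using sum_le_suminf[of "\<lambda>m. capacity \<alpha> p \<rho> \<omega> (E m) * ennreal (b m / 2)" "{m}"] by simp
    finally show False using sumN fin by (simp add: top_unique)
  qed
  \<comment> \<open>Dividing by the weight b m turns the weighted errors into e times a geometric
    series with sum 1.\<close>
  define d where "d m = e * (1 / 2) ^ Suc m / b m" for m
  have d: "0 < d m" for m using e b by (simp add: d_def)
  have "\<forall>m. \<exists>u. u \<in> borel_measurable borel \<and> (\<forall>x\<in>E m. 1 \<le> pot \<alpha> \<rho> u x) \<and>
      energy p \<rho> w u < capacity \<alpha> p \<rho> \<omega> (E m) + ennreal (d m)"
  proof
    fix m
    have "capacity \<alpha> p \<rho> \<omega> (E m) < capacity \<alpha> p \<rho> \<omega> (E m) + ennreal (d m)"
      using capfin[of m] d[of m]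
      by (cases "capacity \<alpha> p \<rho> \<omega> (E m)") (auto simp: ennreal_less_iff less_imp_le simp flip: ennreal_plus)
    from capacity_lessD[OF p w this]
    show "\<exists>u. u \<in> borel_measurable borel \<and> (\<forall>x\<in>E m. 1 \<le> pot \<alpha> \<rho> u x) \<and>
      energy p \<rho> w u < capacity \<alpha> p \<rho> \<omega> (E m) + ennreal (d m)" by blast
  qed
  from choice[OF this] obtain v where v[measurable]: "\<And>m. v m \<in> borel_measurable borel"
    and vE: "\<And>m x. x \<in> E m \<Longrightarrow> 1 \<le> pot \<alpha> \<rho> (v m) x"
    and ve: "\<And>m. energy p \<rho> w (v m) < capacity \<alpha> p \<rho> \<omega> (E m) + ennreal (d m)"
    by blast
  define u where "u z = (\<Sum>m. ennreal (b m) * v m z powe p) powe (1 / p)" for z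
  have u: "u \<in> borel_measurable borel" unfolding u_def by measurable
  have low: "ennreal (b m) powe (1 / p) * v m z \<le> u z" for m z
  proof -
    have "ennreal (b m) powe (1 / p) * v m z = (ennreal (b m) * v m z powe p) powe (1 / p)"
      using p by (simp add: powe_mult powe_powe)
    also have "\<dots> \<le> u z"
      unfolding u_def using p sum_le_suminf[of "\<lambda>m. ennreal (b m) * v m z powe p" "{m}"]
      by (intro powe_mono) simp_all
    finally show ?thesis .
  qed
  have level: "ennreal (b m) \<le> pot \<alpha> \<rho> u x powe p" if "x \<in> E m" for m x
  proof -
    have "ennreal (b m) powe (1 / p) * 1 \<le> ennreal (b m) powe (1 / p) * pot \<alpha> \<rho> (v m) x"
      by (intro mult_left_mono vE that) simp
    also have "\<dots> = pot \<alpha> \<rho> (\<lambda>z. ennreal (b m) powe (1 / p) * v m z) x"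
      by (simp add: pot_cmult)
    also have "\<dots> \<le> pot \<alpha> \<rho> u x" by (intro pot_mono low)
    finally have "(ennreal (b m) powe (1 / p)) powe p \<le> pot \<alpha> \<rho> u x powe p"
      using p by (intro powe_mono) simp_all
    then show ?thesis using p by (simp add: powe_powe)
  qed
  have "F x \<le> 2 * pot \<alpha> \<rho> u x powe p" for x
  proof (rule ccontr)
    assume "\<not> F x \<le> 2 * pot \<alpha> \<rho> u x powe p"
    then obtain k :: int where k: "pot \<alpha> \<rho> u x powe p \<le> ennreal (2 powr real_of_int k)"
      "ennreal (2 powr real_of_int k) < F x" "pot \<alpha> \<rho> u x powe p \<noteq> ennreal (2 powr real_of_int k)"
      using exists_dyadic_between[of "pot \<alpha> \<rho> u x powe p" "F x"] by (auto simp: not_le)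
    have bk: "b (int_encode k) = 2 powr real_of_int k" by (simp add: b_def)
    have "x \<in> E (int_encode k)" using k(2) by (simp add: E_def bk)
    from level[OF this] show False using k(1,3) by (simp add: bk)
  qed
  moreover have "energy p \<rho> w u \<le> 2 * N + ennreal e"
  proof -
    have "energy p \<rho> w u = (\<integral>\<^sup>+z. (\<Sum>m. ennreal (b m) * (v m z powe p * ennreal (w (fst z)))) \<partial>strip \<rho>)"
      unfolding energy_def u_def using p by (simp add: powe_powe mult.assoc flip: ennreal_suminf_multc)
    also have "\<dots> = (\<Sum>m. \<integral>\<^sup>+z. ennreal (b m) * (v m z powe p * ennreal (w (fst z))) \<partial>strip \<rho>)"
      by (rule nn_integral_suminf) measurable
    also have "\<dots> = (\<Sum>m. ennreal (b m) * energy p \<rho> w (v m))"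
      unfolding energy_def by (intro suminf_cong nn_integral_cmult) measurable
    also have "\<dots> \<le> (\<Sum>m. 2 * (capacity \<alpha> p \<rho> \<omega> (E m) * ennreal (b m / 2)) + ennreal (e * (1 / 2) ^ Suc m))"
    proof (rule suminf_le)
      fix m
      have "ennreal (b m) * energy p \<rho> w (v m) \<le> ennreal (b m) * (capacity \<alpha> p \<rho> \<omega> (E m) + ennreal (d m))"
        by (intro mult_left_mono less_imp_le[OF ve]) simp
      also have "\<dots> = ennreal (b m) * capacity \<alpha> p \<rho> \<omega> (E m) + ennreal (b m * d m)"
        by (subst ennreal_mult) (auto simp: distrib_left less_imp_le b d)
      also have "ennreal (b m) * capacity \<alpha> p \<rho> \<omega> (E m) = 2 * (capacity \<alpha> p \<rho> \<omega> (E m) * ennreal (b m / 2))"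
      proof -
        have "ennreal (b m) = 2 * ennreal (b m / 2)"
          using b[of m] ennreal_mult[of 2 "b m / 2"] by simp
        then show ?thesis by (simp only: mult_ac)
      qed
      also have "b m * d m = e * (1 / 2) ^ Suc m" using b[of m] by (simp add: d_def)
      finally show "ennreal (b m) * energy p \<rho> w (v m)
          \<le> 2 * (capacity \<alpha> p \<rho> \<omega> (E m) * ennreal (b m / 2)) + ennreal (e * (1 / 2) ^ Suc m)" .
    qed simp_all
    also have "\<dots> = 2 * (\<Sum>m. capacity \<alpha> p \<rho> \<omega> (E m) * ennreal (b m / 2)) + (\<Sum>m. ennreal (e * (1 / 2) ^ Suc m))"
      by (subst suminf_add[symmetric]) (simp_all add: ennreal_suminf_cmult)
    also have "(\<Sum>m. ennreal (e * (1 / 2) ^ Suc m)) = ennreal e"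
      using sums_mult[OF power_half_series, of e] e by (intro suminf_ennreal_eq) auto
    also have "2 * (\<Sum>m. capacity \<alpha> p \<rho> \<omega> (E m) * ennreal (b m / 2)) + ennreal e \<le> 2 * N + ennreal e"
      by (intro add_mono mult_left_mono sumN) auto
    finally show ?thesis .
  qed
  ultimately show ?thesis using u by blast
qed

section \<open>Averages of the potential\<close>

lemma borel_measurable_pot [measurable]:
  assumes [measurable]: "u \<in> borel_measurable borel"
  shows "pot \<alpha> \<rho> u \<in> borel_measurable borel"
proof -
  interpret S: sigma_finite_measure "strip \<rho> :: ((real^'n) \<times> real) measure" by (rule sigma_finite_strip)
  show ?thesis unfolding pot_def by measurable
qed

lemma powe_add3_le:
  assumes e: "0 < e"
  shows "(a + b + d) powe e \<le> ennreal (3 powr e) * (a powe e + b powe e + d powe e)"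
proof -
  have "a + b + d \<le> 3 * max a (max b d)"
  proof -
    have "a + b + d \<le> max a (max b d) + max a (max b d) + max a (max b d)"
      by (intro add_mono) (auto simp: le_max_iff_disj)
    also have "\<dots> = (1 + 1 + 1) * max a (max b d)" by (simp only: distrib_right mult_1)
    finally show ?thesis by simp
  qed
  then have "(a + b + d) powe e \<le> (3 * max a (max b d)) powe e" using e by (intro powe_mono) auto
  also have "\<dots> = ennreal (3 powr e) * max a (max b d) powe e"
    using powe_ennreal[of 3 e] by (simp add: powe_mult)
  also have "max a (max b d) powe e \<le> a powe e + b powe e + d powe e"
    by (auto simp: max_def add.assoc intro: add_increasing add_increasing2)
  finally show ?thesis by (simp add: mult_left_mono)
qed

text \<open>Below height l the cone at x stays over \<open>qball x0 (2 * l)\<close>, and the vertex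
  x is kept. From height l on, the distance from x to x0 is less than the height, so the cone at x
  lies in the cone of aperture 2 at x0 and the bound no longer depends on x. The middle integral is
  extended to all heights below \<rho>/2, which only enlarges it.\<close>

lemma pot_split:
  fixes u :: "(real^'n) \<times> real \<Rightarrow> ennreal"
  assumes [measurable]: "u \<in> borel_measurable borel" and l: "0 < l" "l \<le> \<rho>"
    and x: "x \<in> cube a l" "x0 \<in> cube a l"
  shows "pot \<alpha> \<rho> u x \<le> pot \<alpha> l (\<lambda>z. u z * indicator (qball x0 (2 * l)) (fst z)) x
    + (\<integral>\<^sup>+z. ennreal (snd z powr (\<alpha> - real CARD('n))) * u z * indicator (tent 2 x0) z \<partial>strip (\<rho> / 2))
    + (\<integral>\<^sup>+z. ennreal (snd z powr (\<alpha> - real CARD('n))) * (u z * indicator (qball x0 (2 * \<rho>)) (fst z))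
        * indicator (tent 2 x0) z * indicator {\<rho> / 2..} (snd z) \<partial>strip \<rho>)"
proof -
  define k where "k z = ennreal (snd z powr (\<alpha> - real CARD('n)))" for z :: "(real^'n) \<times> real"
  have [measurable]: "k \<in> borel_measurable borel" unfolding k_def by measurable
  have "x \<in> qball x0 l"
    using x by (auto simp: mem_qball_iff cube_def mem_box_cart abs_less_iff algebra_simps) (smt (verit))+
  have near: "y \<in> qball x0 (l + t)" if "y \<in> qball x t" for y t
    using qball_triangle[OF \<open>x \<in> qball x0 l\<close> that] .
  have qmono: "y \<in> qball x0 s" if "y \<in> qball x0 s'" "s' \<le> s" for y s s'
    using that by (auto simp: qball_def)
  have "pot \<alpha> \<rho> u x \<le> (\<integral>\<^sup>+z. k z * (u z * indicator (qball x0 (2 * l)) (fst z)) * indicator (tent 1 x) z * indicator {..<l} (snd z)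
    + k z * u z * indicator (tent 2 x0) z * indicator {..<\<rho> / 2} (snd z)
    + k z * (u z * indicator (qball x0 (2 * \<rho>)) (fst z)) * indicator (tent 2 x0) z * indicator {\<rho> / 2..} (snd z) \<partial>strip \<rho>)"
    unfolding pot_def k_def[symmetric]
  proof (rule nn_integral_mono_AE, rule eventually_mono[OF AE_strip])
    fix z :: "(real^'n) \<times> real" assume t: "0 < snd z \<and> snd z < \<rho>"
    show "k z * u z * indicator (tent 1 x) z \<le> k z * (u z * indicator (qball x0 (2 * l)) (fst z)) * indicator (tent 1 x) z * indicator {..<l} (snd z)
      + k z * u z * indicator (tent 2 x0) z * indicator {..<\<rho> / 2} (snd z)
      + k z * (u z * indicator (qball x0 (2 * \<rho>)) (fst z)) * indicator (tent 2 x0) z * indicator {\<rho> / 2..} (snd z)"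
    proof (cases "z \<in> tent 1 x")
      case True
      then have y: "fst z \<in> qball x0 (l + snd z)" by (intro near) (simp add: tent_def qball_def)
      show ?thesis
      proof (cases "snd z < l")
        case t: True
        then have "fst z \<in> qball x0 (2 * l)" using qmono[OF y] by simp
        then show ?thesis using t True by (simp add: add.assoc)
      next
        case False
        then have "fst z \<in> qball x0 (2 * snd z)" using qmono[OF y] by simp
        then have z: "z \<in> tent 2 x0" by (simp add: tent_def qball_def)
        have "fst z \<in> qball x0 (2 * \<rho>)" using qmono[OF y] t False l by simp
        then show ?thesis using z True by (cases "snd z < \<rho> / 2") auto
      qed
    qed simp
  qed
  also have "\<dots> = (\<integral>\<^sup>+z. k z * (u z * indicator (qball x0 (2 * l)) (fst z)) * indicator (tent 1 x) z * indicator {..<l} (snd z) \<partial>strip \<rho>)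
    + (\<integral>\<^sup>+z. k z * u z * indicator (tent 2 x0) z * indicator {..<\<rho> / 2} (snd z) \<partial>strip \<rho>)
    + (\<integral>\<^sup>+z. k z * (u z * indicator (qball x0 (2 * \<rho>)) (fst z)) * indicator (tent 2 x0) z * indicator {\<rho> / 2..} (snd z) \<partial>strip \<rho>)"
    by (simp add: nn_integral_add)
  also have "(\<integral>\<^sup>+z. k z * (u z * indicator (qball x0 (2 * l)) (fst z)) * indicator (tent 1 x) z * indicator {..<l} (snd z) \<partial>strip \<rho>)
     = pot \<alpha> l (\<lambda>z. u z * indicator (qball x0 (2 * l)) (fst z)) x"
    unfolding pot_def k_def[symmetric] by (rule nn_integral_strip_restrict[symmetric]) (use l in auto)
  also have "(\<integral>\<^sup>+z. k z * u z * indicator (tent 2 x0) z * indicator {..<\<rho> / 2} (snd z) \<partial>strip \<rho>)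
     = (\<integral>\<^sup>+z. k z * u z * indicator (tent 2 x0) z \<partial>strip (\<rho> / 2))"
    by (rule nn_integral_strip_restrict[symmetric]) (use l in auto)
  finally show ?thesis unfolding k_def .
qed

text \<open>If both alternatives fail, each of the three parts of \<open>pot_split\<close>
  contributes at most a third of \<sigma> l^n, a contradiction. The threshold of the second
  alternative is (c \<sigma>)^q r^(n q), whose 1/q-th power is c \<sigma> r^n; its failure is used
  at r = l for the near part and at r = \<rho> for the far part.\<close>

lemma average_dichotomy:
  fixes \<alpha> p q :: real
  assumes p: "1 < p" and \<alpha>: "0 < \<alpha>" "\<alpha> * p < real CARD('n)" and q: "q = (real CARD('n) - \<alpha> * p) / real CARD('n)"
  shows "\<exists>c>0. \<forall>\<rho> u \<sigma> l (a :: real^'n) x0. u \<in> borel_measurable borel \<longrightarrow> 0 < l \<longrightarrow> l \<le> \<rho> \<longrightarrow>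
    x0 \<in> cube a l \<longrightarrow> 0 < \<sigma> \<longrightarrow>
    ennreal (\<sigma> * l ^ CARD('n)) < (\<integral>\<^sup>+x\<in>cube a l. pot \<alpha> \<rho> u x powe (p / q) \<partial>lborel) \<longrightarrow>
    ennreal (c * \<sigma>) \<le> (\<integral>\<^sup>+z. ennreal (snd z powr (\<alpha> - real CARD('n))) * u z * indicator (tent 2 x0) z \<partial>strip (\<rho> / 2)) powe (p / q) \<or>
    (\<exists>r. 0 < r \<and> r \<le> \<rho> \<and> ennreal ((c * \<sigma>) powr q * r powr (real CARD('n) - \<alpha> * p))
      \<le> (\<integral>\<^sup>+z. u z powe p * indicator (qball x0 (2 * r)) (fst z) \<partial>strip \<rho>))"
proof -
  define n where "n = real CARD('n)"
  have n: "0 < n" by (simp add: n_def)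
  have q0: "0 < q" using q \<alpha> by simp
  define e where "e = p / q"
  have e: "0 < e" using p q0 by (simp add: e_def)
  have nq: "n - \<alpha> * p = n * q" using n by (simp add: q n_def)
  obtain C where C: "0 < C" and Sob: "\<And>\<rho> (v :: (real^'n) \<times> real \<Rightarrow> ennreal). v \<in> borel_measurable borel \<Longrightarrow>
    (\<integral>\<^sup>+x. pot \<alpha> \<rho> v x powe e \<partial>lborel) \<le> ennreal C * (\<integral>\<^sup>+z. v z powe p \<partial>strip \<rho>) powe (1 / q)"
    using pot_Sobolev[OF p \<alpha> q] unfolding e_def by blast
  obtain K where K: "0 < K" and large: "\<And>\<rho> d (x :: real^'n) v. v \<in> borel_measurable borel \<Longrightarrow> 0 < d \<Longrightarrow>
    (\<integral>\<^sup>+z. ennreal (snd z powr (\<alpha> - n)) * v z * indicator (tent 2 x) z * indicator {d..} (snd z) \<partial>strip \<rho>)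
    \<le> (\<integral>\<^sup>+z. v z powe p \<partial>strip \<rho>) powe (1 / p) * ennreal (K * d powr (\<alpha> - n / p))"
    using pot_large_bound[OF p \<alpha>(2), of 2] unfolding n_def by auto
  \<comment> \<open>C is the Sobolev constant of the near part and K^e 2^n the constant of the far
    part, where 2^n stems from the height \<rho>/2. In \<kappa>, 3^(-e) undoes the constant of
    \<open>powe_add3_le\<close> and 1/3 shares \<sigma> among the three parts.\<close>
  define C' where "C' = C + K powr e * 2 ^ CARD('n)"
  define \<kappa> where "\<kappa> = 3 powr (- e) / 3"
  define c where "c = min \<kappa> (\<kappa> / C')"
  have C': "0 < C'" "C \<le> C'" "K powr e * 2 ^ CARD('n) \<le> C'" using C by (auto simp: C'_def add_pos_nonneg)
  have \<kappa>: "0 < \<kappa>" by (simp add: \<kappa>_def)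
  have c: "0 < c" using \<kappa> C' by (simp add: c_def)
  have c\<kappa>: "c \<le> \<kappa>" "C' * c \<le> \<kappa>"
  proof -
    have "c \<le> \<kappa> / C'" by (simp add: c_def)
    then show "C' * c \<le> \<kappa>" using C' by (simp add: field_simps)
  qed (simp add: c_def)
  have Cc: "C * c \<le> \<kappa>" "K powr e * 2 ^ CARD('n) * c \<le> \<kappa>"
    using mult_right_mono[OF C'(2), of c] mult_right_mono[OF C'(3), of c] c c\<kappa> by linarith+
  have "ennreal (c * \<sigma>) \<le> (\<integral>\<^sup>+z. ennreal (snd z powr (\<alpha> - n)) * u z * indicator (tent 2 x0) z \<partial>strip (\<rho> / 2)) powe e \<or>
    (\<exists>r. 0 < r \<and> r \<le> \<rho> \<and> ennreal ((c * \<sigma>) powr q * r powr (n - \<alpha> * p))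
      \<le> (\<integral>\<^sup>+z. u z powe p * indicator (qball x0 (2 * r)) (fst z) \<partial>strip \<rho>))"
    if u[measurable]: "u \<in> borel_measurable borel" and l: "0 < l" "l \<le> \<rho>" and x0: "x0 \<in> cube a l" and \<sigma>: "0 < \<sigma>"
      and big: "ennreal (\<sigma> * l ^ CARD('n)) < (\<integral>\<^sup>+x\<in>cube a l. pot \<alpha> \<rho> u x powe e \<partial>lborel)"
    for \<rho> u \<sigma> l and a x0 :: "real^'n"
  proof (rule ccontr)
    define F1 where "F1 = (\<integral>\<^sup>+z. ennreal (snd z powr (\<alpha> - n)) * u z * indicator (tent 2 x0) z \<partial>strip (\<rho> / 2))"
    define B where "B r = (\<integral>\<^sup>+z. u z powe p * indicator (qball x0 (2 * r)) (fst z) \<partial>strip \<rho>)" for r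
    define v where "v r z = u z * indicator (qball x0 (2 * r)) (fst z)" for r z
    define F2 where "F2 = (\<integral>\<^sup>+z. ennreal (snd z powr (\<alpha> - n)) * v \<rho> z * indicator (tent 2 x0) z * indicator {\<rho> / 2..} (snd z) \<partial>strip \<rho>)"
    have v[measurable]: "v r \<in> borel_measurable borel" for r unfolding v_def by measurable
    have vB: "(\<integral>\<^sup>+z. v r z powe p \<partial>strip \<rho>) = B r" for r by (simp add: v_def B_def powe_mult)
    assume "\<not> ?thesis"
    then have F1: "F1 powe e < ennreal (c * \<sigma>)"
      and B: "\<And>r. 0 < r \<Longrightarrow> r \<le> \<rho> \<Longrightarrow> B r < ennreal ((c * \<sigma>) powr q * r powr (n * q))"
      unfolding F1_def B_def nq by (auto simp: not_le)
    have Bq: "B r powe (1 / q) \<le> ennreal (c * \<sigma> * r ^ CARD('n))" if r: "0 < r" "r \<le> \<rho>" for r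
    proof -
      have "B r powe (1 / q) \<le> ennreal ((c * \<sigma>) powr q * r powr (n * q)) powe (1 / q)"
        using B[OF r] q0 by (intro powe_mono) auto
      also have "\<dots> = ennreal (c * \<sigma> * r powr n)"
        using q0 c \<sigma> r by (subst powe_ennreal) (auto simp: powr_mult powr_powr)
      finally show ?thesis using r by (simp add: n_def powr_realpow)
    qed
    have F2e: "F2 powe e \<le> ennreal (\<kappa> * \<sigma>)"
    proof -
      have \<rho>: "0 < \<rho>" using l by simp
      have "F2 \<le> B \<rho> powe (1 / p) * ennreal (K * (\<rho> / 2) powr (\<alpha> - n / p))"
        unfolding F2_def vB[symmetric] using \<rho> by (intro large v) auto
      then have "F2 powe e \<le> (B \<rho> powe (1 / p) * ennreal (K * (\<rho> / 2) powr (\<alpha> - n / p))) powe e"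
        using e by (intro powe_mono) auto
      also have "\<dots> = B \<rho> powe (1 / q) * ennreal (K powr e * (\<rho> / 2) powr ((\<alpha> - n / p) * e))"
        using p K by (simp add: powe_mult powe_powe powe_ennreal powr_mult powr_powr e_def)
      \<comment> \<open>The power e = p/q turns the decay exponent into -n, which cancels the
        \<rho>^n of the density bound; the far part is therefore bounded independently of
        \<rho>.\<close>
      also have "(\<alpha> - n / p) * e = - n"
      proof -
        have "(\<alpha> - n / p) * e = - ((n - \<alpha> * p) / q)" using p q0 by (simp add: e_def field_simps)
        then show ?thesis using q0 by (simp add: nq)
      qed
      also have "B \<rho> powe (1 / q) * ennreal (K powr e * (\<rho> / 2) powr (- n))
          \<le> ennreal (c * \<sigma> * \<rho> ^ CARD('n)) * ennreal (K powr e * (\<rho> / 2) powr (- n))"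
        using \<rho> by (intro mult_right_mono Bq) auto
      also have "\<dots> = ennreal (c * \<sigma> * \<rho> ^ CARD('n) * (K powr e * (\<rho> / 2) powr (- n)))"
        using c \<sigma> \<rho> by (subst ennreal_mult) auto
      also have "c * \<sigma> * \<rho> ^ CARD('n) * (K powr e * (\<rho> / 2) powr (- n)) = K powr e * 2 ^ CARD('n) * c * \<sigma>"
        using \<rho> by (simp add: n_def powr_minus powr_realpow power_divide)
      also have "ennreal \<dots> \<le> ennreal (\<kappa> * \<sigma>)"
        using Cc \<sigma> by (intro ennreal_leI mult_right_mono) auto
      finally show ?thesis .
    qed
    have nearS: "(\<integral>\<^sup>+x. pot \<alpha> l (v l) x powe e \<partial>lborel) \<le> ennreal (\<kappa> * \<sigma> * l ^ CARD('n))"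
    proof -
      have "(\<integral>\<^sup>+x. pot \<alpha> l (v l) x powe e \<partial>lborel) \<le> ennreal C * (\<integral>\<^sup>+z. v l z powe p \<partial>strip l) powe (1 / q)"
        by (rule Sob) measurable
      also have "\<dots> \<le> ennreal C * B l powe (1 / q)"
        unfolding vB[symmetric] using q0 l by (intro mult_left_mono powe_mono nn_integral_strip_mono) auto
      also have "\<dots> \<le> ennreal C * ennreal (c * \<sigma> * l ^ CARD('n))"
        using l by (intro mult_left_mono Bq) auto
      also have "\<dots> = ennreal (C * c * (\<sigma> * l ^ CARD('n)))"
        using C c \<sigma> l by (subst ennreal_mult[symmetric]) (auto simp: mult_ac)
      also have "\<dots> \<le> ennreal (\<kappa> * (\<sigma> * l ^ CARD('n)))"
        using Cc \<sigma> l by (intro ennreal_leI mult_right_mono) auto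
      finally show ?thesis by (simp only: mult.assoc)
    qed
    have "pot \<alpha> \<rho> u x powe e \<le> ennreal (3 powr e) * (pot \<alpha> l (v l) x powe e + F1 powe e + F2 powe e)"
      if x: "x \<in> cube a l" for x
    proof -
      have "pot \<alpha> \<rho> u x \<le> pot \<alpha> l (v l) x + F1 + F2"
        using pot_split[OF u l x x0, of \<alpha>] by (simp add: v_def[abs_def] F1_def F2_def n_def)
      then have "pot \<alpha> \<rho> u x powe e \<le> (pot \<alpha> l (v l) x + F1 + F2) powe e" using e by (intro powe_mono) auto
      also have "\<dots> \<le> ennreal (3 powr e) * (pot \<alpha> l (v l) x powe e + F1 powe e + F2 powe e)"
        by (rule powe_add3_le[OF e])
      finally show ?thesis .
    qed
    then have "(\<integral>\<^sup>+x\<in>cube a l. pot \<alpha> \<rho> u x powe e \<partial>lborel)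
        \<le> (\<integral>\<^sup>+x. ennreal (3 powr e) * (pot \<alpha> l (v l) x powe e + (F1 powe e + F2 powe e) * indicator (cube a l) x) \<partial>lborel)"
      by (intro nn_integral_mono) (auto simp: indicator_def add.assoc)
    also have "\<dots> = ennreal (3 powr e) * ((\<integral>\<^sup>+x. pot \<alpha> l (v l) x powe e \<partial>lborel) + (F1 powe e + F2 powe e) * ennreal (l ^ CARD('n)))"
      using l by (simp add: nn_integral_cmult nn_integral_add nn_integral_cmult_indicator emeasure_cube)
    also have "\<dots> \<le> ennreal (3 powr e) * (ennreal (\<kappa> * \<sigma> * l ^ CARD('n)) + (ennreal (\<kappa> * \<sigma>) + ennreal (\<kappa> * \<sigma>)) * ennreal (l ^ CARD('n)))"
    proof (intro mult_left_mono add_mono mult_right_mono nearS F2e)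
      have "F1 powe e \<le> ennreal (c * \<sigma>)" using F1 by simp
      also have "\<dots> \<le> ennreal (\<kappa> * \<sigma>)" using c\<kappa> \<sigma> by (intro ennreal_leI mult_right_mono) auto
      finally show "F1 powe e \<le> ennreal (\<kappa> * \<sigma>)" .
    qed auto
    also have "\<dots> = ennreal (3 powr e * (\<kappa> * \<sigma> * l ^ CARD('n) + (\<kappa> * \<sigma> + \<kappa> * \<sigma>) * l ^ CARD('n)))"
    proof -
      have "0 \<le> \<kappa> * \<sigma>" "0 \<le> l ^ CARD('n)" using \<kappa> \<sigma> l by simp_all
      then show ?thesis
        by (simp only: ennreal_mult[symmetric] ennreal_plus[symmetric] mult_nonneg_nonneg
            add_nonneg_nonneg powr_ge_zero)
    qed
    also have "3 powr e * (\<kappa> * \<sigma> * l ^ CARD('n) + (\<kappa> * \<sigma> + \<kappa> * \<sigma>) * l ^ CARD('n)) = \<sigma> * l ^ CARD('n)"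
    proof -
      have "3 powr e * (\<kappa> * 3) = 1" by (simp add: \<kappa>_def flip: powr_add)
      moreover have "3 powr e * (\<kappa> * \<sigma> * l ^ CARD('n) + (\<kappa> * \<sigma> + \<kappa> * \<sigma>) * l ^ CARD('n)) 
          = (3 powr e * (\<kappa> * 3)) * (\<sigma> * l ^ CARD('n))" by (simp add: algebra_simps)
      ultimately show ?thesis by simp
    qed
    finally show False using big by simp
  qed
  then show ?thesis using c unfolding n_def e_def by blast
qed

section \<open>The weak-type estimate\<close>

text \<open>Aperture 1 at height 2 t is aperture 2 at height t; dt/t is invariant and the kernel
  contributes 2^(\<alpha> - n). This turns the middle part of \<open>pot_split\<close> into a
  potential of aperture 1, for which test functions are available.\<close>

lemma pot_halved_heights:
  fixes u :: "(real^'n) \<times> real \<Rightarrow> ennreal"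
  assumes [measurable]: "u \<in> borel_measurable borel"
  shows "pot \<alpha> \<rho> (\<lambda>z. u (fst z, snd z / 2)) x = ennreal (2 powr (\<alpha> - real CARD('n))) *
    (\<integral>\<^sup>+z. ennreal (snd z powr (\<alpha> - real CARD('n))) * u z * indicator (tent 2 x) z \<partial>strip (\<rho> / 2))"
proof -
  have [measurable]: "u \<in> borel_measurable (borel \<Otimes>\<^sub>M borel)"
    by (subst borel_prod) measurable
  have "pot \<alpha> \<rho> (\<lambda>z. u (fst z, snd z / 2)) x
      = (\<integral>\<^sup>+z. ennreal ((2 * snd z) powr (\<alpha> - real CARD('n))) * u (fst z, snd z) * indicator (tent 1 x) (fst z, 2 * snd z) \<partial>strip (\<rho> / 2))"
    unfolding pot_def by (subst nn_integral_strip_scale) simp_all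
  also have "\<dots> = (\<integral>\<^sup>+z. ennreal (2 powr (\<alpha> - real CARD('n))) *
      (ennreal (snd z powr (\<alpha> - real CARD('n))) * u z * indicator (tent 2 x) z) \<partial>strip (\<rho> / 2))"
    by (intro nn_integral_cong_AE eventually_mono[OF AE_strip])
      (auto simp: tent_def indicator_def powr_mult ennreal_mult mult.assoc)
  also have "\<dots> = ennreal (2 powr (\<alpha> - real CARD('n))) *
    (\<integral>\<^sup>+z. ennreal (snd z powr (\<alpha> - real CARD('n))) * u z * indicator (tent 2 x) z \<partial>strip (\<rho> / 2))"
    by (rule nn_integral_cmult) measurable
  finally show ?thesis .
qed

lemma energy_halved_heights:
  fixes u :: "(real^'n) \<times> real \<Rightarrow> ennreal"
  assumes [measurable]: "u \<in> borel_measurable borel" "w \<in> borel_measurable borel" and "0 < \<rho>"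
  shows "energy p \<rho> w (\<lambda>z. u (fst z, snd z / 2)) \<le> energy p \<rho> w u"
proof -
  have [measurable]: "u \<in> borel_measurable (borel \<Otimes>\<^sub>M borel)"
    by (subst borel_prod) measurable
  have "energy p \<rho> w (\<lambda>z. u (fst z, snd z / 2)) = (\<integral>\<^sup>+z. u z powe p * ennreal (w (fst z)) \<partial>strip (\<rho> / 2))"
    unfolding energy_def by (subst nn_integral_strip_scale) simp_all
  also have "\<dots> \<le> energy p \<rho> w u"
    unfolding energy_def using assms by (intro nn_integral_strip_mono) auto
  finally show ?thesis .
qed

text \<open>The dichotomy puts the set into X1 \<union> X2. On X1 a multiple of u with halved
  heights is a test function; on X2 it is the Vitali construction, and only this one brings in the
  A_1 constant, through cubes of side at most 14 \<rho>. The factor (c \<sigma>)^q stays on the left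
  to avoid dividing in \<open>ennreal\<close>.\<close>

lemma level_set_estimate:
  fixes \<alpha> p q :: real
  assumes p: "1 < p" and \<alpha>: "0 < \<alpha>" "\<alpha> * p < real CARD('n)" and q: "q = (real CARD('n) - \<alpha> * p) / real CARD('n)"
  shows "\<exists>c>0. \<forall>\<rho> \<sigma> \<omega> (w :: real^'n \<Rightarrow> real) u. 0 < \<rho> \<longrightarrow> 0 < \<sigma> \<longrightarrow> weight \<omega> \<longrightarrow> positive_version w \<omega> \<longrightarrow>
    u \<in> borel_measurable borel \<longrightarrow>
    ennreal ((c * \<sigma>) powr q) * capacity \<alpha> p \<rho> \<omega> {x. \<exists>a l. 0 < l \<and> l \<le> \<rho> \<and> x \<in> cube a l \<and>
        ennreal (\<sigma> * l ^ CARD('n)) < (\<integral>\<^sup>+y\<in>cube a l. pot \<alpha> \<rho> u y powe (p / q) \<partial>lborel)}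
    \<le> (ennreal (2 powr ((real CARD('n) - \<alpha>) * p)) + ennreal (2 powr (\<alpha> * p) * 14 ^ CARD('n)) * A1_const (160 * \<rho>) \<omega>)
      * energy p \<rho> w u"
proof -
  define n where "n = real CARD('n)"
  have q0: "0 < q" using q \<alpha> by simp
  obtain c where c: "0 < c" and dich: "\<And>\<rho> u \<sigma> l (a :: real^'n) x0. u \<in> borel_measurable borel \<Longrightarrow> 0 < l \<Longrightarrow> l \<le> \<rho> \<Longrightarrow>
    x0 \<in> cube a l \<Longrightarrow> 0 < \<sigma> \<Longrightarrow>
    ennreal (\<sigma> * l ^ CARD('n)) < (\<integral>\<^sup>+x\<in>cube a l. pot \<alpha> \<rho> u x powe (p / q) \<partial>lborel) \<Longrightarrow>
    ennreal (c * \<sigma>) \<le> (\<integral>\<^sup>+z. ennreal (snd z powr (\<alpha> - n)) * u z * indicator (tent 2 x0) z \<partial>strip (\<rho> / 2)) powe (p / q) \<or>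
    (\<exists>r. 0 < r \<and> r \<le> \<rho> \<and> ennreal ((c * \<sigma>) powr q * r powr (n - \<alpha> * p))
      \<le> (\<integral>\<^sup>+z. u z powe p * indicator (qball x0 (2 * r)) (fst z) \<partial>strip \<rho>))"
    using average_dichotomy[OF p \<alpha> q] unfolding n_def by blast
  have "ennreal ((c * \<sigma>) powr q) * capacity \<alpha> p \<rho> \<omega> {x. \<exists>a l. 0 < l \<and> l \<le> \<rho> \<and> x \<in> cube a l \<and>
        ennreal (\<sigma> * l ^ CARD('n)) < (\<integral>\<^sup>+y\<in>cube a l. pot \<alpha> \<rho> u y powe (p / q) \<partial>lborel)}
    \<le> (ennreal (2 powr ((n - \<alpha>) * p)) + ennreal (2 powr (\<alpha> * p) * 14 ^ CARD('n)) * A1_const (160 * \<rho>) \<omega>)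
      * energy p \<rho> w u"
    if \<rho>: "0 < \<rho>" and \<sigma>: "0 < \<sigma>" and wt: "weight \<omega>" and w: "positive_version w \<omega>"
      and u[measurable]: "u \<in> borel_measurable borel"
    for \<rho> \<sigma> \<omega> and w :: "real^'n \<Rightarrow> real" and u
  proof -
    have [measurable]: "w \<in> borel_measurable borel" using w by (auto simp: positive_version_def)
    have [measurable]: "u \<in> borel_measurable (borel \<Otimes>\<^sub>M borel)"
      by (subst borel_prod) measurable
    define L where "L = (c * \<sigma>) powr q"
    define E where "E = {x. \<exists>a l. 0 < l \<and> l \<le> \<rho> \<and> x \<in> cube a l \<and>
        ennreal (\<sigma> * l ^ CARD('n)) < (\<integral>\<^sup>+y\<in>cube a l. pot \<alpha> \<rho> u y powe (p / q) \<partial>lborel)}"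
    define G where "G x = (\<integral>\<^sup>+z. ennreal (snd z powr (\<alpha> - n)) * u z * indicator (tent 2 x) z \<partial>strip (\<rho> / 2))" for x
    define X1 where "X1 = {x. ennreal (c * \<sigma>) \<le> G x powe (p / q)}"
    define X2 where "X2 = {x. \<exists>r. 0 < r \<and> r \<le> \<rho> \<and> ennreal (L * r powr (n - \<alpha> * p))
      \<le> (\<integral>\<^sup>+z. u z powe p * indicator (qball x (2 * r)) (fst z) \<partial>strip \<rho>)}"
    have L: "0 < L" using c \<sigma> by (simp add: L_def)
    have "E \<subseteq> X1 \<union> X2"
      using dich[OF u _ _ _ \<sigma>] unfolding E_def X1_def X2_def G_def L_def by blast
    then have cap: "capacity \<alpha> p \<rho> \<omega> E \<le> capacity \<alpha> p \<rho> \<omega> (X1 \<union> X2)"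
      by (rule capacity_mono)
    obtain v where v: "v \<in> borel_measurable borel" "\<And>x. x \<in> X2 \<Longrightarrow> 1 \<le> pot \<alpha> \<rho> v x"
      and ve: "ennreal L * energy p \<rho> w v
        \<le> ennreal (2 powr (\<alpha> * p) * 14 ^ CARD('n)) * A1_const (160 * \<rho>) \<omega> * energy p \<rho> w u"
    proof -
      have "\<exists>v\<in>borel_measurable borel. (\<forall>x\<in>X2. 1 \<le> pot \<alpha> \<rho> v x) \<and>
        ennreal L * energy p \<rho> w v \<le> ennreal (2 powr (\<alpha> * p) * 14 ^ CARD('n)) * A1_const (160 * \<rho>) \<omega> * energy p \<rho> w u"
        by (rule Vitali_test_function[OF \<alpha>(1) p wt w _ u less_imp_le[OF L]])
          (use \<rho> in \<open>auto simp: X2_def n_def\<close>)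
      then show thesis using that by blast
    qed
    \<comment> \<open>b undoes the factor 2^(\<alpha> - n) of the halved heights and the threshold
      (c \<sigma>)^(q/p), so the potential reaches 1 on X1; b^p contains (c \<sigma>)^(-q), which
      cancels L.\<close>
    define b where "b = 2 powr (n - \<alpha>) * (c * \<sigma>) powr (- (q / p))"
    define u' where "u' z = ennreal b * u (fst z, snd z / 2)" for z
    have u': "u' \<in> borel_measurable borel" unfolding u'_def by measurable
    have h: "(\<lambda>z. u (fst z, snd z / 2)) \<in> borel_measurable borel" by measurable
    have pot1: "1 \<le> pot \<alpha> \<rho> u' x" if "x \<in> X1" for x
    proof -
      have "ennreal ((c * \<sigma>) powr (q / p)) = ennreal (c * \<sigma>) powe (q / p)"
        using c \<sigma> by (subst powe_ennreal) auto
      also have "\<dots> \<le> (G x powe (p / q)) powe (q / p)"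
        using that p q0 by (intro powe_mono) (auto simp: X1_def)
      also have "\<dots> = G x" using p q0 by (simp add: powe_powe)
      finally have G: "ennreal ((c * \<sigma>) powr (q / p)) \<le> G x" .
      have "b * (2 powr (\<alpha> - n) * (c * \<sigma>) powr (q / p)) = (2 powr (n - \<alpha>) * 2 powr (\<alpha> - n)) * ((c * \<sigma>) powr (- (q / p)) * (c * \<sigma>) powr (q / p))"
        by (simp only: b_def mult_ac)
      also have "\<dots> = 1" using c \<sigma> by (simp flip: powr_add)
      finally have "1 = ennreal b * (ennreal (2 powr (\<alpha> - n)) * ennreal ((c * \<sigma>) powr (q / p)))"
        by (simp add: b_def flip: ennreal_mult)
      also have "\<dots> \<le> ennreal b * (ennreal (2 powr (\<alpha> - n)) * G x)"
        by (intro mult_left_mono G) auto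
      also have "\<dots> = pot \<alpha> \<rho> u' x"
        unfolding u'_def pot_cmult[OF h] pot_halved_heights[OF u] G_def n_def ..
      finally show ?thesis .
    qed
    have e1: "ennreal L * energy p \<rho> w u' \<le> ennreal (2 powr ((n - \<alpha>) * p)) * energy p \<rho> w u"
    proof -
      have "ennreal L * energy p \<rho> w u' = ennreal L * (ennreal b powe p * energy p \<rho> w (\<lambda>z. u (fst z, snd z / 2)))"
        unfolding u'_def energy_cmult[OF h w] ..
      also have "\<dots> \<le> ennreal L * (ennreal b powe p * energy p \<rho> w u)"
        using \<rho> by (intro mult_left_mono energy_halved_heights) auto
      also have "ennreal b powe p = ennreal (b powr p)" by (rule powe_ennreal) (simp add: b_def)
      also have "ennreal L * (ennreal (b powr p) * energy p \<rho> w u) = ennreal (L * b powr p) * energy p \<rho> w u"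
        using L by (simp add: ennreal_mult mult.assoc)
      also have "L * b powr p = 2 powr ((n - \<alpha>) * p)"
      proof -
        have "b powr p = 2 powr ((n - \<alpha>) * p) * (c * \<sigma>) powr (- q)"
          unfolding b_def using p by (subst powr_mult) (auto simp: powr_powr)
        then have "L * b powr p = 2 powr ((n - \<alpha>) * p) * ((c * \<sigma>) powr q * (c * \<sigma>) powr (- q))"
          by (simp only: L_def mult.left_commute)
        also have "(c * \<sigma>) powr q * (c * \<sigma>) powr (- q) = 1"
          using c \<sigma> by (simp flip: powr_add)
        finally show ?thesis by simp
      qed
      finally show ?thesis .
    qed
    have "ennreal L * capacity \<alpha> p \<rho> \<omega> E \<le> ennreal L * (energy p \<rho> w u' + energy p \<rho> w v)"
      by (intro mult_left_mono order_trans[OF cap] test_function_Un[OF p w u' v(1) pot1 v(2)]) auto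
    also have "\<dots> = ennreal L * energy p \<rho> w u' + ennreal L * energy p \<rho> w v"
      by (rule distrib_left)
    also have "\<dots> \<le> ennreal (2 powr ((n - \<alpha>) * p)) * energy p \<rho> w u
        + ennreal (2 powr (\<alpha> * p) * 14 ^ CARD('n)) * A1_const (160 * \<rho>) \<omega> * energy p \<rho> w u"
      by (rule add_mono[OF e1 ve])
    also have "\<dots> = (ennreal (2 powr ((n - \<alpha>) * p)) + ennreal (2 powr (\<alpha> * p) * 14 ^ CARD('n)) * A1_const (160 * \<rho>) \<omega>)
      * energy p \<rho> w u"
      by (rule distrib_right[symmetric])
    finally show ?thesis unfolding L_def E_def .
  qed
  then show ?thesis using c unfolding n_def by blast
qed

text \<open>The q-th root of \<open>dom\<close> reads |f| <= 2^(1/q) (pot u)^(p/q), so a cube with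
  average of |f| above t has average of (pot u)^(p/q) above t / 2^(1/q).\<close>

lemma maximal_level_set:
  fixes f :: "real^'n \<Rightarrow> ereal"
  assumes q: "0 < q" and t: "0 < t" and [measurable]: "u \<in> borel_measurable borel"
    and dom: "\<And>y. e2ennreal \<bar>f y\<bar> powe q \<le> 2 * pot \<alpha> \<rho> u y powe p"
  shows "{x. \<bar>local_maximal \<rho> f x\<bar> > ereal t} \<subseteq> {x. \<exists>a l. 0 < l \<and> l \<le> \<rho> \<and> x \<in> cube a l \<and>
        ennreal (t / 2 powr (1 / q) * l ^ CARD('n)) < (\<integral>\<^sup>+y\<in>cube a l. pot \<alpha> \<rho> u y powe (p / q) \<partial>lborel)}"
proof
  fix x assume "x \<in> {x. \<bar>local_maximal \<rho> f x\<bar> > ereal t}"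
  then have "ereal t < local_maximal \<rho> f x" by (simp add: local_maximal_def)
  then have "ennreal t < (SUP (a, l) \<in> {(a, l). 0 < l \<and> l \<le> \<rho> \<and> x \<in> cube a l}.
       (\<integral>\<^sup>+ y \<in> cube a l. e2ennreal \<bar>f y\<bar> \<partial>lebesgue) / emeasure lebesgue (cube a l))"
    using t by (simp add: local_maximal_def less_ennreal.rep_eq enn2ereal_ennreal)
  then obtain a l where l: "0 < l" "l \<le> \<rho>" and x: "x \<in> cube a l" and
    avg: "ennreal t < (\<integral>\<^sup>+ y \<in> cube a l. e2ennreal \<bar>f y\<bar> \<partial>lborel) / ennreal (l ^ CARD('n))"
    by (auto simp: less_SUP_iff nn_integral_completion emeasure_cube)
  define D where "D = 2 powr (1 / q)"
  define I where "I = (\<integral>\<^sup>+y\<in>cube a l. pot \<alpha> \<rho> u y powe (p / q) \<partial>lborel)"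
  have D: "0 < D" by (simp add: D_def)
  have fle: "e2ennreal \<bar>f y\<bar> \<le> ennreal D * pot \<alpha> \<rho> u y powe (p / q)" for y
  proof -
    have "(e2ennreal \<bar>f y\<bar> powe q) powe (1 / q) \<le> (2 * pot \<alpha> \<rho> u y powe p) powe (1 / q)"
      using dom q by (intro powe_mono) auto
    then show ?thesis
      using q powe_ennreal[of 2 "1 / q"] by (simp add: powe_powe powe_mult D_def)
  qed
  have "(\<integral>\<^sup>+ y \<in> cube a l. e2ennreal \<bar>f y\<bar> \<partial>lborel) \<le> (\<integral>\<^sup>+y. ennreal D * (pot \<alpha> \<rho> u y powe (p / q) * indicator (cube a l) y) \<partial>lborel)"
    using fle by (intro nn_integral_mono) (auto simp: indicator_def)
  also have "\<dots> = ennreal D * I" unfolding I_def by (rule nn_integral_cmult) measurable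
  finally have "ennreal t < ennreal D * I / ennreal (l ^ CARD('n))"
    using avg divide_right_mono_ennreal order_less_le_trans by blast
  have "ennreal (t / D * l ^ CARD('n)) < I"
  proof (rule ccontr)
    assume "\<not> ?thesis"
    then have "ennreal D * I / ennreal (l ^ CARD('n)) \<le> ennreal D * ennreal (t / D * l ^ CARD('n)) / ennreal (l ^ CARD('n))"
      by (intro divide_right_mono_ennreal mult_left_mono) auto
    also have "\<dots> = ennreal (D * (t / D * l ^ CARD('n)) / l ^ CARD('n))"
      using D t l by (simp add: divide_ennreal flip: ennreal_mult)
    also have "D * (t / D * l ^ CARD('n)) / l ^ CARD('n) = t" using D l by simp
    finally show False using \<open>ennreal t < ennreal D * I / ennreal (l ^ CARD('n))\<close> by simp
  qed
  then show "x \<in> {x. \<exists>a l. 0 < l \<and> l \<le> \<rho> \<and> x \<in> cube a l \<and>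
        ennreal (t / 2 powr (1 / q) * l ^ CARD('n)) < (\<integral>\<^sup>+y\<in>cube a l. pot \<alpha> \<rho> u y powe (p / q) \<partial>lborel)}"
    using l x unfolding D_def I_def by blast
qed

text \<open>K is fixed before the radius, the weight and the function, so the constant depends on n,
  \<alpha>, p and K alone. For an infinite Choquet integral there is nothing to prove; otherwise the
  dominating potential costs an arbitrarily small error, removed by
  \<open>ennreal_le_epsilon\<close>.\<close>

lemma weak_type_estimate:
  fixes \<alpha> p q :: real and K :: ennreal
  assumes p: "1 < p" and \<alpha>: "0 < \<alpha>" "\<alpha> * p < real CARD('n)" and q: "q = (real CARD('n) - \<alpha> * p) / real CARD('n)"
  shows "\<exists>C>0. \<forall>\<rho> \<omega> (f :: real^'n \<Rightarrow> ereal). 0 < \<rho> \<longrightarrow> \<omega> \<in> A1_loc \<longrightarrow> A1_const (160 * \<rho>) \<omega> = K \<longrightarrow>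
    cap_weak_Lq (capacity \<alpha> p \<rho> \<omega>) q (local_maximal \<rho> f) \<le> ennreal C * cap_Lq (capacity \<alpha> p \<rho> \<omega>) q f"
proof -
  have q0: "0 < q" using q \<alpha> by simp
  obtain c where c: "0 < c" and level: "\<And>\<rho> \<sigma> \<omega> (w :: real^'n \<Rightarrow> real) u. 0 < \<rho> \<Longrightarrow> 0 < \<sigma> \<Longrightarrow> weight \<omega> \<Longrightarrow>
    positive_version w \<omega> \<Longrightarrow> u \<in> borel_measurable borel \<Longrightarrow>
    ennreal ((c * \<sigma>) powr q) * capacity \<alpha> p \<rho> \<omega> {x. \<exists>a l. 0 < l \<and> l \<le> \<rho> \<and> x \<in> cube a l \<and>
        ennreal (\<sigma> * l ^ CARD('n)) < (\<integral>\<^sup>+y\<in>cube a l. pot \<alpha> \<rho> u y powe (p / q) \<partial>lborel)}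
    \<le> (ennreal (2 powr ((real CARD('n) - \<alpha>) * p)) + ennreal (2 powr (\<alpha> * p) * 14 ^ CARD('n)) * A1_const (160 * \<rho>) \<omega>)
      * energy p \<rho> w u"
    using level_set_estimate[OF p \<alpha> q] by blast
  \<comment> \<open>\<open>enn2real K\<close> loses nothing, since K is finite whenever it is the
    constant of a weight in \<open>A1_loc\<close>. B trades (c \<sigma>)^q with \<sigma> = t /
    2^(1/q) for t^q, and the 2 in C is that of the energy bound 2 N.\<close>
  define A where "A = 2 powr ((real CARD('n) - \<alpha>) * p) + 2 powr (\<alpha> * p) * 14 ^ CARD('n) * enn2real K"
  define B where "B = A * (2 powr (1 / q) / c) powr q"
  define C where "C = (2 * B) powr (1 / q)"
  have A: "0 < A" by (auto simp: A_def intro!: add_pos_nonneg)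
  have B: "0 < B" using A c by (simp add: B_def)
  have "cap_weak_Lq (capacity \<alpha> p \<rho> \<omega>) q (local_maximal \<rho> f) \<le> ennreal C * cap_Lq (capacity \<alpha> p \<rho> \<omega>) q f"
    if \<rho>: "0 < \<rho>" and \<omega>: "\<omega> \<in> A1_loc" and K: "A1_const (160 * \<rho>) \<omega> = K" for \<rho> \<omega> and f :: "real^'n \<Rightarrow> ereal"
  proof -
    have wt: "weight \<omega>" using \<omega> by (simp add: A1_loc_def)
    obtain w where w: "positive_version w \<omega>" using weight_positive_version[OF wt] by blast
    have "K < top" using A1_const_finite[OF \<omega>] K by blast
    then have Kreal: "ennreal (2 powr ((real CARD('n) - \<alpha>) * p)) + ennreal (2 powr (\<alpha> * p) * 14 ^ CARD('n)) * K = ennreal A"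
      unfolding A_def by (subst ennreal_plus) (auto simp: ennreal_mult ennreal_enn2real)
    define N where "N = (\<integral>\<^sup>+t\<in>{0<..}. capacity \<alpha> p \<rho> \<omega> {x. ennreal_powr (e2ennreal \<bar>f x\<bar>) q > ennreal t} \<partial>lebesgue)"
    have Lq: "cap_Lq (capacity \<alpha> p \<rho> \<omega>) q f = N powe (1 / q)"
      by (simp add: cap_Lq_def N_def)
    have C: "0 < C" using B by (simp add: C_def)
    show ?thesis
    proof (cases "N = top")
      case True
      then have "ennreal C * cap_Lq (capacity \<alpha> p \<rho> \<omega>) q f = top"
        using C by (simp add: Lq ennreal_mult_top ennreal_eq_0_iff)
      then show ?thesis by simp
    next
      case fin: False
      have claim: "ennreal (t powr q) * capacity \<alpha> p \<rho> \<omega> {x. \<bar>local_maximal \<rho> f x\<bar> > ereal t} \<le> ennreal (2 * B) * N"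
        if t: "0 < t" for t
      proof (rule ennreal_le_epsilon)
        fix \<epsilon> :: real assume \<epsilon>: "0 < \<epsilon>"
        have "0 < \<epsilon> / B" using \<epsilon> B by simp
        from dyadic_domination[OF p w this N_def fin] obtain u where u: "u \<in> borel_measurable borel"
          and dom: "\<And>x. e2ennreal \<bar>f x\<bar> powe q \<le> 2 * pot \<alpha> \<rho> u x powe p"
          and en: "energy p \<rho> w u \<le> 2 * N + ennreal (\<epsilon> / B)" by blast
        define \<sigma> where "\<sigma> = t / 2 powr (1 / q)"
        define E where "E = capacity \<alpha> p \<rho> \<omega> {x. \<bar>local_maximal \<rho> f x\<bar> > ereal t}"
        have \<sigma>: "0 < \<sigma>" using t by (simp add: \<sigma>_def)
        have "E \<le> capacity \<alpha> p \<rho> \<omega> {x. \<exists>a l. 0 < l \<and> l \<le> \<rho> \<and> x \<in> cube a l \<and>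
          ennreal (\<sigma> * l ^ CARD('n)) < (\<integral>\<^sup>+y\<in>cube a l. pot \<alpha> \<rho> u y powe (p / q) \<partial>lborel)}"
          unfolding E_def \<sigma>_def by (intro capacity_mono maximal_level_set[OF q0 t u dom])
        then have "ennreal ((c * \<sigma>) powr q) * E \<le> ennreal A * energy p \<rho> w u"
          using level[OF \<rho> \<sigma> wt w u] unfolding K Kreal
          by (meson mult_left_mono order_trans zero_le)
        also have "\<dots> \<le> ennreal A * (2 * N + ennreal (\<epsilon> / B))"
          by (intro mult_left_mono en) simp
        finally have 1: "ennreal ((2 powr (1 / q) / c) powr q) * (ennreal ((c * \<sigma>) powr q) * E)
          \<le> ennreal ((2 powr (1 / q) / c) powr q) * (ennreal A * (2 * N + ennreal (\<epsilon> / B)))"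
          by (rule mult_left_mono) simp
        have "(2 powr (1 / q) / c) powr q * (c * \<sigma>) powr q = (2 powr (1 / q) / c * (c * \<sigma>)) powr q"
          using c \<sigma> by (subst powr_mult) auto
        also have "2 powr (1 / q) / c * (c * \<sigma>) = t" using c by (simp add: \<sigma>_def)
        finally have "ennreal ((2 powr (1 / q) / c) powr q) * ennreal ((c * \<sigma>) powr q) = ennreal (t powr q)"
          by (simp flip: ennreal_mult)
        then have 2: "ennreal ((2 powr (1 / q) / c) powr q) * (ennreal ((c * \<sigma>) powr q) * E) = ennreal (t powr q) * E"
          by (simp only: mult.assoc[symmetric])
        have "ennreal ((2 powr (1 / q) / c) powr q) * (ennreal A * (2 * N + ennreal (\<epsilon> / B)))
            = ennreal B * (2 * N + ennreal (\<epsilon> / B))"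
          unfolding B_def using A by (subst ennreal_mult) (auto simp: mult_ac)
        also have "\<dots> = ennreal B * 2 * N + ennreal B * ennreal (\<epsilon> / B)"
          by (simp only: distrib_left mult.assoc)
        also have "ennreal B * 2 = ennreal (2 * B)"
          using B by (subst ennreal_mult) (auto simp: mult.commute)
        also have "ennreal B * ennreal (\<epsilon> / B) = ennreal \<epsilon>"
          using B \<epsilon> by (subst ennreal_mult[symmetric]) auto
        finally show "ennreal (t powr q) * capacity \<alpha> p \<rho> \<omega> {x. \<bar>local_maximal \<rho> f x\<bar> > ereal t}
            \<le> ennreal (2 * B) * N + ennreal \<epsilon>"
          using 1 2 by (simp add: E_def)
      qed
      have "ennreal t * (capacity \<alpha> p \<rho> \<omega> {x. \<bar>local_maximal \<rho> f x\<bar> > ereal t}) powe (1 / q) \<le> ennreal C * N powe (1 / q)"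
        if t: "0 < t" for t
      proof -
        have "(ennreal (t powr q) * capacity \<alpha> p \<rho> \<omega> {x. \<bar>local_maximal \<rho> f x\<bar> > ereal t}) powe (1 / q)
            \<le> (ennreal (2 * B) * N) powe (1 / q)"
          using q0 by (intro powe_mono claim t) simp
        then show ?thesis
          using t q0 B by (simp add: powe_mult powe_ennreal powr_powr C_def)
      qed
      then show ?thesis
        unfolding cap_weak_Lq_def Lq by (intro SUP_least) auto
    qed
  qed
  moreover have "0 < C" using B by (simp add: C_def)
  ultimately show ?thesis by blast
qed

theorem theorem4p3p6:
  shows "\<exists>C :: real \<Rightarrow> real \<Rightarrow> ennreal \<Rightarrow> real.
    (\<forall>\<alpha> p K. 0 < C \<alpha> p K) \<and>
    (\<forall>\<alpha> p \<rho> q. \<forall>\<omega> \<in> A1_loc. \<forall>f :: real^'n \<Rightarrow> ereal.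
       0 < \<alpha> \<longrightarrow> \<alpha> < real CARD('n) \<longrightarrow>
       1 < p \<longrightarrow> p < real CARD('n) / \<alpha> \<longrightarrow>
       0 < \<rho> \<longrightarrow>
       q = (real CARD('n) - \<alpha> * p) / real CARD('n) \<longrightarrow>
       f \<in> borel_measurable lebesgue \<longrightarrow>
       cap_weak_Lq (capacity \<alpha> p \<rho> \<omega>) q (local_maximal \<rho> f)
         \<le> ennreal (C \<alpha> p (A1_const (160 * \<rho>) \<omega>)) * cap_Lq (capacity \<alpha> p \<rho> \<omega>) q f)"
proof -
  \<comment> \<open>C has to be positive for all arguments, also outside the admissible range. The
    range is therefore a premise inside \<open>good\<close>, so that every triple has a good C, with
    1 serving outside the range; the scale, weight and function are quantified inside, so the choice
    depends on \<alpha>, p and K only.\<close>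
  define good where "good \<alpha> p K C \<longleftrightarrow> 0 < C \<and>
    (0 < \<alpha> \<longrightarrow> 1 < p \<longrightarrow> \<alpha> * p < real CARD('n) \<longrightarrow>
      (\<forall>\<rho> \<omega> (f :: real^'n \<Rightarrow> ereal). 0 < \<rho> \<longrightarrow> \<omega> \<in> A1_loc \<longrightarrow> A1_const (160 * \<rho>) \<omega> = K \<longrightarrow>
        cap_weak_Lq (capacity \<alpha> p \<rho> \<omega>) ((real CARD('n) - \<alpha> * p) / real CARD('n)) (local_maximal \<rho> f)
        \<le> ennreal C * cap_Lq (capacity \<alpha> p \<rho> \<omega>) ((real CARD('n) - \<alpha> * p) / real CARD('n)) f))"
    for \<alpha> p K C
  have ex: "\<exists>C. good \<alpha> p K C" for \<alpha> p K
  proof (cases "0 < \<alpha> \<and> 1 < p \<and> \<alpha> * p < real CARD('n)")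
    case True
    then show ?thesis
      using weak_type_estimate[where ?'n = 'n and \<alpha> = \<alpha> and p = p and K = K, OF _ _ _ refl]
      unfolding good_def by blast
  next
    case False
    then show ?thesis unfolding good_def by (intro exI[of _ 1]) auto
  qed
  have good: "good \<alpha> p K (SOME C. good \<alpha> p K C)" for \<alpha> p K
    using ex by (rule someI_ex)
  show ?thesis
  proof (intro exI[of _ "\<lambda>\<alpha> p K. SOME C. good \<alpha> p K C"] conjI allI ballI impI)
    show "0 < (SOME C. good \<alpha> p K C)" for \<alpha> p K
      using good[of \<alpha> p K] by (simp add: good_def)
  next
    fix \<alpha> p \<rho> q :: real and \<omega> :: "real^'n \<Rightarrow> real" and f :: "real^'n \<Rightarrow> ereal"
    assume "\<omega> \<in> A1_loc" "0 < \<alpha>" "1 < p" "p < real CARD('n) / \<alpha>" "0 < \<rho>"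
      and q: "q = (real CARD('n) - \<alpha> * p) / real CARD('n)"
    then show "cap_weak_Lq (capacity \<alpha> p \<rho> \<omega>) q (local_maximal \<rho> f)
        \<le> ennreal (SOME C. good \<alpha> p (A1_const (160 * \<rho>) \<omega>) C) * cap_Lq (capacity \<alpha> p \<rho> \<omega>) q f"
      using good[of \<alpha> p "A1_const (160 * \<rho>) \<omega>"] unfolding q good_def
      by (simp add: pos_less_divide_eq mult.commute)
  qed
qed

end
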